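(* Let $R$ be a commutative Noetherian ring, $\mathfrak{a}$ an ideal of $R$, and $t$ a non-negative integer. Let $M$ be an $R$-module such that $\operatorname{Ext}^{t+1}_R(R/\mathfrak{a}, M)$ is a finitely generated $R$-module. If the local cohomology module $H^i_{\mathfrak{a}}(M)$ is $\mathfrak{a}$-cofinite for all $i<t$, then $\operatorname{Ext}^1_R(R/\mathfrak{a}, H^t_{\mathfrak{a}}(M))$ is a finitely generated $R$-module.
   Context: $H^i_{\mathfrak{a}}(M)$ denotes the $i$-th local cohomology module of $M$ with respect to $\mathfrak{a}$ (the $i$-th right derived functor of the $\mathfrak{a}$-torsion functor $\Gamma_{\mathfrak{a}}$, where $\Gamma_{\mathfrak a}(M)$ is the submodule of elements annihilated by some power of $\mathfrak{a}$). An $R$-module $X$ is called $\mathfrak{a}$-cofinite if (i) $\operatorname{Supp}(X)\subseteq V(\mathfrak{a})$, where $V(\mathfrak{a})$ is the set of prime ideals containing $\mathfrak{a}$, and (ii) $\operatorname{Ext}^i_R(R/\mathfrak{a}, X)$ is a finitely generated $R$-module for all $i\ge 0$. *)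

theory Defs
  imports "HOL-Algebra.IntRing" "HOL-Algebra.Ring_Divisibility" "HOL-Algebra.Ideal_Product" "HOL-Algebra.Module"
begin

section \<open>Modules over a commutative ring\<close>

text \<open>
  Module records extend ring records, so they carry fields \<open>mult\<close> and \<open>one\<close> that have no
  meaning for a module; they are set to \<^const>\<open>undefined\<close> below.
\<close>

definition mod_hom :: "('r, 'k) ring_scheme \<Rightarrow> ('r, 'm) module \<Rightarrow> ('r, 'n) module \<Rightarrow> ('m \<Rightarrow> 'n) set"
  where "mod_hom R M N = {f \<in> carrier M \<rightarrow> carrier N.
    (\<forall>x\<in>carrier M. \<forall>y\<in>carrier M. f (x \<oplus>\<^bsub>M\<^esub> y) = f x \<oplus>\<^bsub>N\<^esub> f y) \<and>
    (\<forall>r\<in>carrier R. \<forall>x\<in>carrier M. f (r \<odot>\<^bsub>M\<^esub> x) = r \<odot>\<^bsub>N\<^esub> f x)}"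

text \<open>
  Elements of \<open>Hom(M,N)\<close> are required to be extensional, so that each linear map is
  represented by exactly one function.
\<close>

definition hom_module :: "('r, 'k) ring_scheme \<Rightarrow> ('r, 'm) module \<Rightarrow> ('r, 'n) module \<Rightarrow> ('r, 'm \<Rightarrow> 'n) module"
  where "hom_module R M N =
    \<lparr>carrier = mod_hom R M N \<inter> extensional (carrier M), monoid.mult = undefined, one = undefined,
     ring.zero = (\<lambda>x\<in>carrier M. \<zero>\<^bsub>N\<^esub>), ring.add = (\<lambda>f g. \<lambda>x\<in>carrier M. f x \<oplus>\<^bsub>N\<^esub> g x),
     smult = (\<lambda>r f. \<lambda>x\<in>carrier M. r \<odot>\<^bsub>N\<^esub> f x)\<rparr>"

definition self_module :: "('r, 'k) ring_scheme \<Rightarrow> ('r, 'r) module"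
  where "self_module R = \<lparr>carrier = carrier R, monoid.mult = undefined, one = undefined,
    ring.zero = \<zero>\<^bsub>R\<^esub>, ring.add = (\<oplus>\<^bsub>R\<^esub>), smult = (\<otimes>\<^bsub>R\<^esub>)\<rparr>"

definition quotient_module :: "('r, 'm) module \<Rightarrow> 'm set \<Rightarrow> ('r, 'm set) module"
  where "quotient_module M N = \<lparr>carrier = a_rcosets\<^bsub>M\<^esub> N, monoid.mult = undefined, one = undefined,
    ring.zero = N, ring.add = set_add M, smult = (\<lambda>r X. \<Union>x\<in>X. N +>\<^bsub>M\<^esub> (r \<odot>\<^bsub>M\<^esub> x))\<rparr>"

definition module_span :: "('r, 'k) ring_scheme \<Rightarrow> ('r, 'm) module \<Rightarrow> 'm set \<Rightarrow> 'm set"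
  where "module_span R M A = \<Inter>{H. submodule H R M \<and> A \<subseteq> H}"

definition fg_module :: "('r, 'k) ring_scheme \<Rightarrow> ('r, 'm) module \<Rightarrow> bool"
  where "fg_module R M \<longleftrightarrow> (\<exists>A. finite A \<and> A \<subseteq> carrier M \<and> module_span R M A = carrier M)"


section \<open>Localisation and support\<close>

definition fraction_rel :: "('r, 'k) ring_scheme \<Rightarrow> 'r set \<Rightarrow> ('r, 'm) module \<Rightarrow> (('m \<times> 'r) \<times> ('m \<times> 'r)) set"
  where "fraction_rel R S M = {((x, s), (y, t)). x \<in> carrier M \<and> s \<in> S \<and> y \<in> carrier M \<and> t \<in> S \<and>
    (\<exists>u\<in>S. u \<odot>\<^bsub>M\<^esub> (t \<odot>\<^bsub>M\<^esub> x) = u \<odot>\<^bsub>M\<^esub> (s \<odot>\<^bsub>M\<^esub> y))}"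

definition localization :: "('r, 'k) ring_scheme \<Rightarrow> 'r set \<Rightarrow> ('r, 'm) module \<Rightarrow> ('r, ('m \<times> 'r) set) module"
  where "localization R S M =
    \<lparr>carrier = (carrier M \<times> S) // fraction_rel R S M, monoid.mult = undefined, one = undefined,
     ring.zero = fraction_rel R S M `` {(\<zero>\<^bsub>M\<^esub>, \<one>\<^bsub>R\<^esub>)},
     ring.add = (\<lambda>X Y. \<Union>(x, s)\<in>X. \<Union>(y, t)\<in>Y.
       fraction_rel R S M `` {(t \<odot>\<^bsub>M\<^esub> x \<oplus>\<^bsub>M\<^esub> s \<odot>\<^bsub>M\<^esub> y, s \<otimes>\<^bsub>R\<^esub> t)}),
     smult = (\<lambda>r X. \<Union>(x, s)\<in>X. fraction_rel R S M `` {(r \<odot>\<^bsub>M\<^esub> x, s)})\<rparr>"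

definition Supp :: "('r, 'k) ring_scheme \<Rightarrow> ('r, 'm) module \<Rightarrow> 'r set set"
  where "Supp R M = {P. primeideal P R \<and>
    carrier (localization R (carrier R - P) M) \<noteq> {\<zero>\<^bsub>localization R (carrier R - P) M\<^esub>}}"

definition variety :: "('r, 'k) ring_scheme \<Rightarrow> 'r set \<Rightarrow> 'r set set"
  where "variety R \<aa> = {P. primeideal P R \<and> \<aa> \<subseteq> P}"


section \<open>Cohomology of a cochain complex\<close>

definition cohomology :: "(nat \<Rightarrow> ('r, 'x) module) \<Rightarrow> (nat \<Rightarrow> 'x \<Rightarrow> 'x) \<Rightarrow> nat \<Rightarrow> ('r, 'x set) module"
  where "cohomology C d n =
    quotient_module ((C n)\<lparr>carrier := a_kernel (C n) (C (Suc n)) (d n)\<rparr>)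
      (case n of 0 \<Rightarrow> {\<zero>\<^bsub>C 0\<^esub>} | Suc k \<Rightarrow> d k ` carrier (C k))"


section \<open>Ext\<close>

definition free_module :: "('r, 'k) ring_scheme \<Rightarrow> ('r, 't \<Rightarrow> 'r) module"
  where "free_module R =
    \<lparr>carrier = {f. range f \<subseteq> carrier R \<and> finite {t. f t \<noteq> \<zero>\<^bsub>R\<^esub>}}, monoid.mult = undefined, one = undefined,
     ring.zero = (\<lambda>t. \<zero>\<^bsub>R\<^esub>), ring.add = (\<lambda>f g t. f t \<oplus>\<^bsub>R\<^esub> g t), smult = (\<lambda>r f t. r \<otimes>\<^bsub>R\<^esub> f t)\<rparr>"

definition linear_extension ::
    "('r, 'k) ring_scheme \<Rightarrow> ('r, 'm) module \<Rightarrow> ('t \<Rightarrow> 'm) \<Rightarrow> ('t \<Rightarrow> 'r) \<Rightarrow> 'm"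
  where "linear_extension R M \<phi> f = (\<Oplus>\<^bsub>M\<^esub>t\<in>{t. f t \<noteq> \<zero>\<^bsub>R\<^esub>}. f t \<odot>\<^bsub>M\<^esub> \<phi> t)"

text \<open>
  Every \<open>R\<close>-module \<open>N\<close> has a free resolution \<open>\<dots> \<rightarrow> F \<rightarrow> F \<rightarrow> N \<rightarrow> 0\<close> with the same free module \<open>F\<close>
  in every degree, whose basis is the following type. A basis element \<open>Elt x\<close> is sent to \<open>x\<close> by the
  augmentation. A basis element \<open>Syz l\<close> names the formal linear combination \<open>l\<close> of basis elements;
  a differential sends it to that combination whenever the latter lies in the kernel of the
  preceding map. All other basis elements are sent to zero. Exactness is proved in
  \<open>free_resolution\<close> below.
\<close>

datatype ('r, 'n) res_basis = Elt 'n | Syz "('r \<times> ('r, 'n) res_basis) list"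

fun combination :: "('r, 'k) ring_scheme \<Rightarrow> ('r \<times> 't) list \<Rightarrow> 't \<Rightarrow> 'r"
  where
    "combination R [] = (\<lambda>s. \<zero>\<^bsub>R\<^esub>)"
  | "combination R ((c, t) # l) = (\<lambda>s. (if s = t then c else \<zero>\<^bsub>R\<^esub>) \<oplus>\<^bsub>R\<^esub> combination R l s)"

definition augmentation :: "('r, 'k) ring_scheme \<Rightarrow> ('r, 'n) module \<Rightarrow> (('r, 'n) res_basis \<Rightarrow> 'r) \<Rightarrow> 'n"
  where "augmentation R N = linear_extension R N
    (\<lambda>t. case t of Elt x \<Rightarrow> if x \<in> carrier N then x else \<zero>\<^bsub>N\<^esub> | Syz l \<Rightarrow> \<zero>\<^bsub>N\<^esub>)"

definition kernel_cover :: "('r, 'k) ring_scheme \<Rightarrow> ((('r, 'n) res_basis \<Rightarrow> 'r) \<Rightarrow> bool) \<Rightarrow>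
    (('r, 'n) res_basis \<Rightarrow> 'r) \<Rightarrow> ('r, 'n) res_basis \<Rightarrow> 'r"
  where "kernel_cover R inker = linear_extension R (free_module R)
    (\<lambda>t. case t of
        Elt x \<Rightarrow> \<zero>\<^bsub>free_module R\<^esub>
      | Syz l \<Rightarrow> if fst ` set l \<subseteq> carrier R \<and> inker (combination R l)
                then combination R l else \<zero>\<^bsub>free_module R\<^esub>)"

text \<open>\<open>res_diff R N n\<close> is the differential from degree \<open>n + 1\<close> to degree \<open>n\<close>.\<close>

primrec res_diff :: "('r, 'k) ring_scheme \<Rightarrow> ('r, 'n) module \<Rightarrow> nat \<Rightarrow>
    (('r, 'n) res_basis \<Rightarrow> 'r) \<Rightarrow> ('r, 'n) res_basis \<Rightarrow> 'r"
  where
    "res_diff R N 0 = kernel_cover R (\<lambda>f. augmentation R N f = \<zero>\<^bsub>N\<^esub>)"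
  | "res_diff R N (Suc n) = kernel_cover R (\<lambda>f. res_diff R N n f = \<zero>\<^bsub>free_module R\<^esub>)"

definition Ext :: "('r, 'k) ring_scheme \<Rightarrow> nat \<Rightarrow> ('r, 'n) module \<Rightarrow> ('r, 'x) module \<Rightarrow>
    ('r, ((('r, 'n) res_basis \<Rightarrow> 'r) \<Rightarrow> 'x) set) module"
  where "Ext R n N X = cohomology (\<lambda>k. hom_module R (free_module R) X)
    (\<lambda>k g. compose (carrier (free_module R)) g (res_diff R N k)) n"


section \<open>Injective resolutions and local cohomology\<close>

text \<open>
  The test modules \<open>A\<close> and \<open>B\<close> have to be taken in some fixed type. The type \<open>'r + 'e\<close> accommodates
  copies of \<open>R\<close>, so by Baer's criterion the choice of this type is no restriction.
\<close>

definition injective_module :: "('r, 'k) ring_scheme \<Rightarrow> ('r, 'e) module \<Rightarrow> bool"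
  where "injective_module R E \<longleftrightarrow> module R E \<and>
    (\<forall>(A :: ('r, 'r + 'e) module) (B :: ('r, 'r + 'e) module) j f.
      module R A \<and> module R B \<and> j \<in> mod_hom R A B \<and> inj_on j (carrier A) \<and> f \<in> mod_hom R A E \<longrightarrow>
      (\<exists>g\<in>mod_hom R B E. \<forall>x\<in>carrier A. g (j x) = f x))"

definition injective_resolution :: "('r, 'k) ring_scheme \<Rightarrow> ('r, 'm) module \<Rightarrow>
    (nat \<Rightarrow> ('r, 'e) module) \<Rightarrow> ('m \<Rightarrow> 'e) \<Rightarrow> (nat \<Rightarrow> 'e \<Rightarrow> 'e) \<Rightarrow> bool"
  where "injective_resolution R M I \<epsilon> d \<longleftrightarrow>
    (\<forall>n. injective_module R (I n)) \<and>
    \<epsilon> \<in> mod_hom R M (I 0) \<and> inj_on \<epsilon> (carrier M) \<and>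
    (\<forall>n. d n \<in> mod_hom R (I n) (I (Suc n))) \<and>
    \<epsilon> ` carrier M = a_kernel (I 0) (I 1) (d 0) \<and>
    (\<forall>n. d n ` carrier (I n) = a_kernel (I (Suc n)) (I (Suc (Suc n))) (d (Suc n)))"

text \<open>
  A type that is large enough to contain an injective resolution of every \<open>R\<close>-module with elements
  in \<open>'m\<close>; see \<open>injective_resolution_exists\<close> below. It contains \<open>'m\<close> and is closed under forming
  finite formal sums with rational coefficients and functions on \<open>'r\<close>. This is what is needed to
  embed a module \<open>X\<close> into the injective module of additive maps from \<open>R\<close> to a divisible group
  containing \<open>X\<close>.
\<close>

datatype ('r, 'm) inj_type =
  Base 'm | Formal_Sum "(rat \<times> ('r, 'm) inj_type) list" | Fun_On "'r \<Rightarrow> ('r, 'm) inj_type"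

definition chosen_injective_resolution :: "('r, 'k) ring_scheme \<Rightarrow> ('r, 'm) module \<Rightarrow>
    (nat \<Rightarrow> ('r, ('r, 'm) inj_type) module) \<times> (nat \<Rightarrow> ('r, 'm) inj_type \<Rightarrow> ('r, 'm) inj_type)"
  where "chosen_injective_resolution R M = (SOME (I, d). \<exists>\<epsilon>. injective_resolution R M I \<epsilon> d)"

text \<open>The power of \<open>\<aa>\<close> is taken in the monoid of ideals of \<open>R\<close>.\<close>

definition torsion :: "('r, 'k) ring_scheme \<Rightarrow> 'r set \<Rightarrow> ('r, 'm) module \<Rightarrow> ('r, 'm) module"
  where "torsion R \<aa> M = M\<lparr>carrier := {x \<in> carrier M.
    \<exists>n::nat. \<forall>r \<in> \<aa> [^]\<^bsub>ideals_set R\<^esub> n. r \<odot>\<^bsub>M\<^esub> x = \<zero>\<^bsub>M\<^esub>}\<rparr>"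

definition local_cohomology :: "('r, 'k) ring_scheme \<Rightarrow> 'r set \<Rightarrow> nat \<Rightarrow> ('r, 'm) module \<Rightarrow>
    ('r, ('r, 'm) inj_type set) module"
  where "local_cohomology R \<aa> i M =
    (case chosen_injective_resolution R M of (I, d) \<Rightarrow> cohomology (\<lambda>n. torsion R \<aa> (I n)) d i)"

definition cofinite_module :: "('r, 'k) ring_scheme \<Rightarrow> 'r set \<Rightarrow> ('r, 'x) module \<Rightarrow> bool"
  where "cofinite_module R \<aa> X \<longleftrightarrow> Supp R X \<subseteq> variety R \<aa> \<and>
    (\<forall>i. fg_module R (Ext R i (quotient_module (self_module R) \<aa>) X))"


section \<open>Exactness of the free resolution\<close>

lemma mod_homI:
  assumes "\<And>x. x \<in> carrier M \<Longrightarrow> f x \<in> carrier N"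
    and "\<And>x y. x \<in> carrier M \<Longrightarrow> y \<in> carrier M \<Longrightarrow> f (x \<oplus>\<^bsub>M\<^esub> y) = f x \<oplus>\<^bsub>N\<^esub> f y"
    and "\<And>r x. r \<in> carrier R \<Longrightarrow> x \<in> carrier M \<Longrightarrow> f (r \<odot>\<^bsub>M\<^esub> x) = r \<odot>\<^bsub>N\<^esub> f x"
  shows "f \<in> mod_hom R M N"
  using assms unfolding mod_hom_def by auto

lemma mod_homD:
  assumes "f \<in> mod_hom R M N"
  shows "x \<in> carrier M \<Longrightarrow> f x \<in> carrier N"
    and "x \<in> carrier M \<Longrightarrow> y \<in> carrier M \<Longrightarrow> f (x \<oplus>\<^bsub>M\<^esub> y) = f x \<oplus>\<^bsub>N\<^esub> f y"
    and "r \<in> carrier R \<Longrightarrow> x \<in> carrier M \<Longrightarrow> f (r \<odot>\<^bsub>M\<^esub> x) = r \<odot>\<^bsub>N\<^esub> f x"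
  using assms unfolding mod_hom_def by auto

lemma mod_hom_compose:
  assumes "f \<in> mod_hom R M N" "g \<in> mod_hom R N L"
  shows "(\<lambda>x. g (f x)) \<in> mod_hom R M L"
  by (rule mod_homI) (auto simp: mod_homD[OF assms(1)] mod_homD[OF assms(2)])

lemma mod_hom_zero:
  assumes "module R M" "module R N" "f \<in> mod_hom R M N"
  shows "f \<zero>\<^bsub>M\<^esub> = \<zero>\<^bsub>N\<^esub>"
proof -
  interpret M: module R M by fact
  interpret N: module R N by fact
  have "f \<zero>\<^bsub>M\<^esub> = f (\<zero>\<^bsub>R\<^esub> \<odot>\<^bsub>M\<^esub> \<zero>\<^bsub>M\<^esub>)" by simp
  also have "\<dots> = \<zero>\<^bsub>R\<^esub> \<odot>\<^bsub>N\<^esub> f \<zero>\<^bsub>M\<^esub>" using mod_homD(3)[OF assms(3)] by blast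
  also have "\<dots> = \<zero>\<^bsub>N\<^esub>" using mod_homD(1)[OF assms(3)] by simp
  finally show ?thesis .
qed

lemma mod_hom_minus:
  assumes "module R M" "module R N" "f \<in> mod_hom R M N" "x \<in> carrier M"
  shows "f (\<ominus>\<^bsub>M\<^esub> x) = \<ominus>\<^bsub>N\<^esub> f x"
proof -
  interpret M: module R M by fact
  interpret N: module R N by fact
  have "f x \<oplus>\<^bsub>N\<^esub> f (\<ominus>\<^bsub>M\<^esub> x) = f (x \<oplus>\<^bsub>M\<^esub> \<ominus>\<^bsub>M\<^esub> x)" using mod_homD(2)[OF assms(3)] assms(4) by simp
  also have "\<dots> = \<zero>\<^bsub>N\<^esub>" using mod_hom_zero[OF assms(1-3)] assms(4) by (simp add: M.r_neg)
  finally show ?thesis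
    using mod_homD(1)[OF assms(3)] assms(4) by (metis M.a_inv_closed N.minus_equality N.a_comm)
qed

lemma mod_hom_finsum:
  assumes "module R M" "module R N" "f \<in> mod_hom R M N" "finite T" "g \<in> T \<rightarrow> carrier M"
  shows "f (\<Oplus>\<^bsub>M\<^esub>t\<in>T. g t) = (\<Oplus>\<^bsub>N\<^esub>t\<in>T. f (g t))"
  using assms(4,5)
proof (induction)
  case empty
  interpret M: module R M by fact
  interpret N: module R N by fact
  show ?case using mod_hom_zero[OF assms(1-3)] by simp
next
  case (insert x F)
  interpret M: module R M by fact
  interpret N: module R N by fact
  have "(\<lambda>t. f (g t)) \<in> F \<rightarrow> carrier N" "f (g x) \<in> carrier N"
    using insert.prems mod_homD(1)[OF assms(3)] by auto
  moreover have "g \<in> F \<rightarrow> carrier M" using insert.prems by auto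
  ultimately show ?case
    using insert mod_homD(2)[OF assms(3)] by (simp add: Pi_iff)
qed

lemma a_kernel_iff: "x \<in> a_kernel M N f \<longleftrightarrow> x \<in> carrier M \<and> f x = \<zero>\<^bsub>N\<^esub>"
  by (simp add: a_kernel_def kernel_def)

lemma free_module_simps:
  "carrier (free_module R) = {f. (\<forall>t. f t \<in> carrier R) \<and> finite {t. f t \<noteq> \<zero>\<^bsub>R\<^esub>}}"
  "zero (free_module R) = (\<lambda>t. \<zero>\<^bsub>R\<^esub>)"
  "add (free_module R) = (\<lambda>f g t. f t \<oplus>\<^bsub>R\<^esub> g t)"
  "smult (free_module R) = (\<lambda>r f t. r \<otimes>\<^bsub>R\<^esub> f t)"
  by (auto simp: free_module_def)

lemma free_module_module:
  assumes "cring R"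
  shows "module R (free_module R :: ('r, 't \<Rightarrow> 'r) module)"
proof -
  interpret cring R by fact
  have fa: "finite {t. f t \<oplus>\<^bsub>R\<^esub> g t \<noteq> \<zero>\<^bsub>R\<^esub>}" if "finite {t. f t \<noteq> \<zero>\<^bsub>R\<^esub>}" "finite {t. g t \<noteq> \<zero>\<^bsub>R\<^esub>}" for f g :: "'t \<Rightarrow> 'r"
    by (rule finite_subset[of _ "{t. f t \<noteq> \<zero>\<^bsub>R\<^esub>} \<union> {t. g t \<noteq> \<zero>\<^bsub>R\<^esub>}"]) (use that in auto)
  have fm: "finite {t. r \<otimes>\<^bsub>R\<^esub> f t \<noteq> \<zero>\<^bsub>R\<^esub>}" if "finite {t. f t \<noteq> \<zero>\<^bsub>R\<^esub>}" "r \<in> carrier R" for r and f :: "'t \<Rightarrow> 'r"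
    by (rule finite_subset[of _ "{t. f t \<noteq> \<zero>\<^bsub>R\<^esub>}"]) (use that in auto)
  show ?thesis
  proof (rule moduleI)
    show "abelian_group (free_module R :: ('r, 't \<Rightarrow> 'r) module)"
    proof (rule abelian_groupI)
      fix x :: "'t \<Rightarrow> 'r" assume x: "x \<in> carrier (free_module R)"
      have eq: "{t. \<ominus>\<^bsub>R\<^esub> x t \<noteq> \<zero>\<^bsub>R\<^esub>} \<subseteq> {t. x t \<noteq> \<zero>\<^bsub>R\<^esub>}" by auto
      have "(\<lambda>t. \<ominus>\<^bsub>R\<^esub> x t) \<in> carrier (free_module R)"
        using x finite_subset[OF eq] by (simp add: free_module_simps)
      moreover have "(\<lambda>t. \<ominus>\<^bsub>R\<^esub> x t) \<oplus>\<^bsub>free_module R\<^esub> x = \<zero>\<^bsub>free_module R\<^esub>"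
        using x by (simp add: free_module_simps l_neg)
      ultimately show "\<exists>y\<in>carrier (free_module R). y \<oplus>\<^bsub>free_module R\<^esub> x = \<zero>\<^bsub>free_module R\<^esub>" by blast
    qed (auto simp: free_module_simps fa a_ac)
  qed (auto simp: free_module_simps fm l_distr r_distr m_assoc assms)
qed

definition unit_vec :: "('r, 'k) ring_scheme \<Rightarrow> 't \<Rightarrow> 't \<Rightarrow> 'r"
  where "unit_vec R t = (\<lambda>s. if s = t then \<one>\<^bsub>R\<^esub> else \<zero>\<^bsub>R\<^esub>)"

lemma linear_extension_superset:
  assumes "module R M" "\<And>t. \<phi> t \<in> carrier M" "f \<in> carrier (free_module R)"
    "finite T" "{t. f t \<noteq> \<zero>\<^bsub>R\<^esub>} \<subseteq> T"
  shows "linear_extension R M \<phi> f = (\<Oplus>\<^bsub>M\<^esub>t\<in>T. f t \<odot>\<^bsub>M\<^esub> \<phi> t)"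
proof -
  interpret module R M by fact
  show ?thesis unfolding linear_extension_def
    by (rule M.add.finprod_mono_neutral_cong_left) (use assms in \<open>auto simp: free_module_simps\<close>)
qed

lemma linear_extension_hom:
  fixes \<phi> :: "'t \<Rightarrow> 'm" and M :: "('r, 'm) module"
  assumes "module R M" "\<And>t. \<phi> t \<in> carrier M"
  shows "linear_extension R M \<phi> \<in> mod_hom R (free_module R) M"
proof -
  interpret module R M by fact
  interpret F: module R "free_module R" by (rule free_module_module[OF R.is_cring])
  show ?thesis
  proof (rule mod_homI)
    fix f :: "'t \<Rightarrow> 'r" assume f: "f \<in> carrier (free_module R)"
    then show "linear_extension R M \<phi> f \<in> carrier M"
      unfolding linear_extension_def by (auto intro!: M.finsum_closed simp: free_module_simps assms)
    fix g :: "'t \<Rightarrow> 'r" assume g: "g \<in> carrier (free_module R)"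
    let ?T = "{t. f t \<noteq> \<zero>\<^bsub>R\<^esub>} \<union> {t. g t \<noteq> \<zero>\<^bsub>R\<^esub>}"
    have T: "finite ?T" using f g by (simp add: free_module_simps)
    have fc: "\<And>t. f t \<in> carrier R" "\<And>t. g t \<in> carrier R" using f g by (auto simp: free_module_simps)
    have "linear_extension R M \<phi> (f \<oplus>\<^bsub>free_module R\<^esub> g)
        = (\<Oplus>\<^bsub>M\<^esub>t\<in>?T. (f \<oplus>\<^bsub>free_module R\<^esub> g) t \<odot>\<^bsub>M\<^esub> \<phi> t)"
      by (rule linear_extension_superset[OF assms F.a_closed[OF f g] T])
         (use fc in \<open>auto simp: free_module_simps\<close>)
    also have "\<dots> = (\<Oplus>\<^bsub>M\<^esub>t\<in>?T. f t \<odot>\<^bsub>M\<^esub> \<phi> t \<oplus>\<^bsub>M\<^esub> g t \<odot>\<^bsub>M\<^esub> \<phi> t)"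
      by (rule M.finsum_cong') (use fc assms(2) in \<open>auto simp: free_module_simps smult_l_distr\<close>)
    also have "\<dots> = (\<Oplus>\<^bsub>M\<^esub>t\<in>?T. f t \<odot>\<^bsub>M\<^esub> \<phi> t) \<oplus>\<^bsub>M\<^esub> (\<Oplus>\<^bsub>M\<^esub>t\<in>?T. g t \<odot>\<^bsub>M\<^esub> \<phi> t)"
      by (rule M.finsum_addf) (use fc assms(2) in auto)
    also have "\<dots> = linear_extension R M \<phi> f \<oplus>\<^bsub>M\<^esub> linear_extension R M \<phi> g"
      using linear_extension_superset[OF assms f T] linear_extension_superset[OF assms g T] by auto
    finally show "linear_extension R M \<phi> (f \<oplus>\<^bsub>free_module R\<^esub> g) = \<dots>" .
  next
    fix r and f :: "'t \<Rightarrow> 'r" assume r: "r \<in> carrier R" and f: "f \<in> carrier (free_module R)"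
    let ?T = "{t. f t \<noteq> \<zero>\<^bsub>R\<^esub>}"
    have T: "finite ?T" using f by (simp add: free_module_simps)
    have fc: "\<And>t. f t \<in> carrier R" using f by (auto simp: free_module_simps)
    have "linear_extension R M \<phi> (r \<odot>\<^bsub>free_module R\<^esub> f)
        = (\<Oplus>\<^bsub>M\<^esub>t\<in>?T. (r \<odot>\<^bsub>free_module R\<^esub> f) t \<odot>\<^bsub>M\<^esub> \<phi> t)"
      by (rule linear_extension_superset[OF assms F.smult_closed[OF r f] T])
         (use fc r in \<open>auto simp: free_module_simps\<close>)
    also have "\<dots> = (\<Oplus>\<^bsub>M\<^esub>t\<in>?T. r \<odot>\<^bsub>M\<^esub> (f t \<odot>\<^bsub>M\<^esub> \<phi> t))"
      by (rule M.finsum_cong') (use fc r assms(2) in \<open>auto simp: free_module_simps smult_assoc1\<close>)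
    also have "\<dots> = r \<odot>\<^bsub>M\<^esub> linear_extension R M \<phi> f"
      unfolding linear_extension_def
      by (rule finsum_smult_ldistr[symmetric]) (use T r fc assms(2) in auto)
    finally show "linear_extension R M \<phi> (r \<odot>\<^bsub>free_module R\<^esub> f) = \<dots>" .
  qed
qed

lemma unit_vec_carrier:
  assumes "cring R" shows "unit_vec R t \<in> carrier (free_module R)"
proof -
  interpret cring R by fact
  show ?thesis by (simp add: unit_vec_def free_module_simps)
qed

lemma linear_extension_unit_vec:
  assumes "module R M" "\<And>t. \<phi> t \<in> carrier M"
  shows "linear_extension R M \<phi> (unit_vec R t) = \<phi> t"
proof -
  interpret module R M by fact
  have "linear_extension R M \<phi> (unit_vec R t) = (\<Oplus>\<^bsub>M\<^esub>s\<in>{t}. unit_vec R t s \<odot>\<^bsub>M\<^esub> \<phi> s)"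
    by (rule linear_extension_superset[OF assms unit_vec_carrier[OF R.is_cring]]) (auto simp: unit_vec_def)
  also have "\<dots> = \<phi> t"
    using assms(2)[of t] by (simp add: unit_vec_def)
  finally show ?thesis .
qed

lemma combination_carrier:
  assumes "cring R" "fst ` set l \<subseteq> carrier R"
  shows "combination R l \<in> carrier (free_module R)"
  using assms(2)
proof (induction l)
  interpret F: module R "free_module R :: ('a, 'c \<Rightarrow> 'a) module" by (rule free_module_module[OF assms(1)])
  { case Nil show ?case using F.M.zero_closed by (simp add: free_module_simps(2))
  next
    case (Cons p l)
    obtain c t where p: "p = (c, t)" by (cases p)
    have "(\<lambda>s. if s = t then c else \<zero>\<^bsub>R\<^esub>) \<in> carrier (free_module R)"
      using Cons.prems by (auto simp: p free_module_simps)
    from F.M.a_closed[OF this Cons.IH] Cons.prems show ?case by (simp add: p free_module_simps(3))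
  }
qed

lemma combination_surj:
  assumes "cring R" "f \<in> carrier (free_module R)"
  shows "\<exists>l. fst ` set l \<subseteq> carrier R \<and> combination R l = f"
proof -
  interpret cring R by fact
  have "\<exists>l. fst ` set l \<subseteq> carrier R \<and> combination R l = f"
    if "finite T" "{t. f t \<noteq> \<zero>\<^bsub>R\<^esub>} \<subseteq> T" "\<And>t. f t \<in> carrier R" for T f
    using that
  proof (induction T arbitrary: f)
    case empty
    then show ?case by (intro exI[of _ "[]"]) auto
  next
    case (insert x T)
    have "\<exists>l. fst ` set l \<subseteq> carrier R \<and> combination R l = f(x := \<zero>\<^bsub>R\<^esub>)"
      by (rule insert.IH) (use insert.prems in auto)
    then obtain l where l: "fst ` set l \<subseteq> carrier R" "combination R l = f(x := \<zero>\<^bsub>R\<^esub>)" by blast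
    show ?case
      by (rule exI[of _ "(f x, x) # l"]) (use l insert.prems in auto)
  qed
  then show ?thesis using assms(2) by (auto simp: free_module_simps)
qed

lemma kernel_cover:
  assumes "module R N" "h \<in> mod_hom R (free_module R) N"
  shows "kernel_cover R (\<lambda>f. h f = \<zero>\<^bsub>N\<^esub>) \<in> mod_hom R (free_module R) (free_module R)"
    and "kernel_cover R (\<lambda>f. h f = \<zero>\<^bsub>N\<^esub>) ` carrier (free_module R) = a_kernel (free_module R) N h"
proof -
  interpret N: module R N by fact
  let ?F = "free_module R :: ('a, ('a, 'd) res_basis \<Rightarrow> 'a) module"
  have mF: "module R ?F" by (rule free_module_module[OF N.R.is_cring])
  interpret F: module R ?F by (rule mF)
  define \<phi> where "\<phi> = (\<lambda>t :: ('a, 'd) res_basis. case t of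
        Elt x \<Rightarrow> \<zero>\<^bsub>?F\<^esub>
      | Syz l \<Rightarrow> if fst ` set l \<subseteq> carrier R \<and> h (combination R l) = \<zero>\<^bsub>N\<^esub>
                then combination R l else \<zero>\<^bsub>?F\<^esub>)"
  have k: "kernel_cover R (\<lambda>f. h f = \<zero>\<^bsub>N\<^esub>) = linear_extension R ?F \<phi>"
    by (simp add: kernel_cover_def \<phi>_def)
  have \<phi>: "\<phi> t \<in> carrier ?F" for t
    by (auto simp: \<phi>_def combination_carrier[OF N.R.is_cring] split: res_basis.splits)
  have h\<phi>: "h (\<phi> t) = \<zero>\<^bsub>N\<^esub>" for t
    using mod_hom_zero[OF mF assms] by (auto simp: \<phi>_def split: res_basis.splits)
  show 1: "kernel_cover R (\<lambda>f. h f = \<zero>\<^bsub>N\<^esub>) \<in> mod_hom R ?F ?F"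
    unfolding k by (rule linear_extension_hom[OF mF \<phi>])
  show "kernel_cover R (\<lambda>f. h f = \<zero>\<^bsub>N\<^esub>) ` carrier ?F = a_kernel ?F N h"
  proof (intro equalityI subsetI)
    fix y assume "y \<in> kernel_cover R (\<lambda>f. h f = \<zero>\<^bsub>N\<^esub>) ` carrier ?F"
    then obtain f where f: "f \<in> carrier ?F" "y = linear_extension R ?F \<phi> f" unfolding k by blast
    have fc: "\<And>t. f t \<in> carrier R" "finite {t. f t \<noteq> \<zero>\<^bsub>R\<^esub>}" using f by (auto simp: free_module_simps)
    have "h y = (\<Oplus>\<^bsub>N\<^esub>t\<in>{t. f t \<noteq> \<zero>\<^bsub>R\<^esub>}. h (f t \<odot>\<^bsub>?F\<^esub> \<phi> t))"
      unfolding f(2) linear_extension_def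
      by (rule mod_hom_finsum[OF mF assms]) (use fc \<phi> in auto)
    also have "\<dots> = (\<Oplus>\<^bsub>N\<^esub>t\<in>{t. f t \<noteq> \<zero>\<^bsub>R\<^esub>}. \<zero>\<^bsub>N\<^esub>)"
      by (rule N.M.finsum_cong') (use fc \<phi> h\<phi> mod_homD(3)[OF assms(2)] in auto)
    also have "\<dots> = \<zero>\<^bsub>N\<^esub>" by (rule N.M.finsum_zero)
    finally show "y \<in> a_kernel ?F N h" using mod_homD(1)[OF 1 f(1)] f(2) by (simp add: a_kernel_iff k)
  next
    fix y assume y: "y \<in> a_kernel ?F N h"
    then obtain l where l: "fst ` set l \<subseteq> carrier R" "combination R l = y"
      using combination_surj[OF N.R.is_cring] by (auto simp: a_kernel_iff)
    have "linear_extension R ?F \<phi> (unit_vec R (Syz l)) = y"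
      unfolding linear_extension_unit_vec[OF mF \<phi>] using y l by (simp add: \<phi>_def a_kernel_iff)
    then show "y \<in> kernel_cover R (\<lambda>f. h f = \<zero>\<^bsub>N\<^esub>) ` carrier ?F"
      unfolding k using unit_vec_carrier[OF N.R.is_cring] by (metis image_eqI)
  qed
qed

theorem free_resolution:
  fixes R :: "('r, 'k) ring_scheme" and N :: "('r, 'n) module"
  assumes "module R N"
  defines "F \<equiv> free_module R :: ('r, ('r, 'n) res_basis \<Rightarrow> 'r) module"
  shows "augmentation R N \<in> mod_hom R F N"
    and "augmentation R N ` carrier F = carrier N"
    and "res_diff R N n \<in> mod_hom R F F"
    and "res_diff R N 0 ` carrier F = a_kernel F N (augmentation R N)"
    and "res_diff R N (Suc n) ` carrier F = a_kernel F F (res_diff R N n)"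
proof -
  interpret N: module R N by fact
  have mF: "module R F" unfolding F_def by (rule free_module_module[OF N.R.is_cring])
  define \<phi> where "\<phi> = (\<lambda>t :: ('r, 'n) res_basis.
      case t of Elt x \<Rightarrow> if x \<in> carrier N then x else \<zero>\<^bsub>N\<^esub> | Syz l \<Rightarrow> \<zero>\<^bsub>N\<^esub>)"
  have aug: "augmentation R N = linear_extension R N \<phi>"
    by (simp add: augmentation_def \<phi>_def)
  have \<phi>: "\<phi> t \<in> carrier N" for t
    by (auto simp: \<phi>_def split: res_basis.splits)
  show 1: "augmentation R N \<in> mod_hom R F N"
    unfolding aug F_def by (rule linear_extension_hom[OF assms(1) \<phi>])
  show "augmentation R N ` carrier F = carrier N"
  proof (intro equalityI subsetI)
    fix x assume "x \<in> carrier N"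
    then have "augmentation R N (unit_vec R (Elt x)) = x"
      unfolding aug by (simp add: linear_extension_unit_vec[OF assms(1) \<phi>]) (simp add: \<phi>_def)
    then show "x \<in> augmentation R N ` carrier F"
      unfolding F_def using unit_vec_carrier[OF N.R.is_cring] by (metis image_eqI)
  qed (use mod_homD(1)[OF 1] in auto)
  show 2: "res_diff R N n \<in> mod_hom R F F" for n
  proof (induction n)
    case 0
    show ?case using kernel_cover(1)[OF assms(1) 1[unfolded F_def]] by (simp add: F_def)
  next
    case (Suc n)
    show ?case using kernel_cover(1)[OF mF[unfolded F_def] Suc[unfolded F_def]] by (simp add: F_def)
  qed
  show "res_diff R N 0 ` carrier F = a_kernel F N (augmentation R N)"
    using kernel_cover(2)[OF assms(1) 1[unfolded F_def]] by (simp add: F_def)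
  show "res_diff R N (Suc n) ` carrier F = a_kernel F F (res_diff R N n)"
    using kernel_cover(2)[OF mF[unfolded F_def] 2[unfolded F_def]] by (simp add: F_def)
qed


section \<open>Existence of injective resolutions\<close>

lemma module_hom_image:
  assumes "module R M" "carrier Q = \<pi> ` carrier M" "\<pi> \<zero>\<^bsub>M\<^esub> = \<zero>\<^bsub>Q\<^esub>"
    and "\<And>x y. x \<in> carrier M \<Longrightarrow> y \<in> carrier M \<Longrightarrow> \<pi> (x \<oplus>\<^bsub>M\<^esub> y) = \<pi> x \<oplus>\<^bsub>Q\<^esub> \<pi> y"
    and "\<And>r x. r \<in> carrier R \<Longrightarrow> x \<in> carrier M \<Longrightarrow> \<pi> (r \<odot>\<^bsub>M\<^esub> x) = r \<odot>\<^bsub>Q\<^esub> \<pi> x"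
  shows "module R Q" "\<pi> \<in> mod_hom R M Q"
proof -
  interpret module R M by fact
  note h = assms(2) assms(3)[symmetric] assms(4,5)[symmetric]
  show "module R Q"
  proof (rule moduleI)
    show "abelian_group Q"
    proof (rule abelian_groupI)
      fix x assume "x \<in> carrier Q"
      then obtain a where a: "a \<in> carrier M" "x = \<pi> a" by (auto simp: assms(2))
      show "\<exists>y\<in>carrier Q. y \<oplus>\<^bsub>Q\<^esub> x = \<zero>\<^bsub>Q\<^esub>"
        by (rule bexI[of _ "\<pi> (\<ominus>\<^bsub>M\<^esub> a)"]) (use a in \<open>auto simp: h M.l_neg\<close>)
    next
      fix x y assume "x \<in> carrier Q" "y \<in> carrier Q"
      then obtain a b where "a \<in> carrier M" "x = \<pi> a" "b \<in> carrier M" "y = \<pi> b" by (auto simp: assms(2))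
      then show "x \<oplus>\<^bsub>Q\<^esub> y = y \<oplus>\<^bsub>Q\<^esub> x" by (simp add: h M.a_comm)
    next
      fix x y z assume "x \<in> carrier Q" "y \<in> carrier Q" "z \<in> carrier Q"
      then obtain a b c where "a \<in> carrier M" "x = \<pi> a" "b \<in> carrier M" "y = \<pi> b" "c \<in> carrier M" "z = \<pi> c"
        by (auto simp: assms(2))
      then show "x \<oplus>\<^bsub>Q\<^esub> y \<oplus>\<^bsub>Q\<^esub> z = x \<oplus>\<^bsub>Q\<^esub> (y \<oplus>\<^bsub>Q\<^esub> z)" by (simp add: h M.a_assoc)
    qed (auto simp: h)
  qed (auto simp: h R.is_cring smult_l_distr smult_r_distr smult_assoc1)
  show "\<pi> \<in> mod_hom R M Q" by (rule mod_homI) (auto simp: h)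
qed

lemma quotient_module_facts:
  assumes "module R M" "submodule N R M"
  shows "module R (quotient_module M N)"
    and "(\<lambda>x. N +>\<^bsub>M\<^esub> x) \<in> mod_hom R M (quotient_module M N)"
    and "carrier (quotient_module M N) = (\<lambda>x. N +>\<^bsub>M\<^esub> x) ` carrier M"
    and "\<And>x. x \<in> carrier M \<Longrightarrow> N +>\<^bsub>M\<^esub> x = \<zero>\<^bsub>quotient_module M N\<^esub> \<longleftrightarrow> x \<in> N"
proof -
  interpret module R M by fact
  have sg: "subgroup N (add_monoid M)" using assms(2) by (simp add: submodule_def)
  interpret N: abelian_subgroup N M
    by (rule abelian_subgroupI3) (auto intro: additive_subgroupI sg M.abelian_group_axioms)
  have Nc: "N \<subseteq> carrier M" using submoduleE(1)[OF assms(2)] .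
  show c: "carrier (quotient_module M N) = (\<lambda>x. N +>\<^bsub>M\<^esub> x) ` carrier M"
    by (auto simp: quotient_module_def A_RCOSETS_def')
  have sm: "N +>\<^bsub>M\<^esub> r \<odot>\<^bsub>M\<^esub> x = r \<odot>\<^bsub>quotient_module M N\<^esub> (N +>\<^bsub>M\<^esub> x)"
    if r: "r \<in> carrier R" and x: "x \<in> carrier M" for r x
  proof -
    have "N +>\<^bsub>M\<^esub> r \<odot>\<^bsub>M\<^esub> y = N +>\<^bsub>M\<^esub> r \<odot>\<^bsub>M\<^esub> x" if y: "y \<in> N +>\<^bsub>M\<^esub> x" for y
    proof -
      obtain n where n: "n \<in> N" "y = n \<oplus>\<^bsub>M\<^esub> x" using y unfolding a_r_coset_def r_coset_def by auto
      then have "r \<odot>\<^bsub>M\<^esub> y = r \<odot>\<^bsub>M\<^esub> n \<oplus>\<^bsub>M\<^esub> r \<odot>\<^bsub>M\<^esub> x" using r x Nc by (auto simp: smult_r_distr)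
      moreover have "r \<odot>\<^bsub>M\<^esub> n \<in> N" using submoduleE(4)[OF assms(2) r n(1)] .
      ultimately have "r \<odot>\<^bsub>M\<^esub> y \<in> N +>\<^bsub>M\<^esub> r \<odot>\<^bsub>M\<^esub> x" unfolding a_r_coset_def r_coset_def by auto
      then show ?thesis using M.a_repr_independence[OF _ _ sg] r x by auto
    qed
    then have "(\<Union>y\<in>N +>\<^bsub>M\<^esub> x. N +>\<^bsub>M\<^esub> r \<odot>\<^bsub>M\<^esub> y) = (\<Union>y\<in>N +>\<^bsub>M\<^esub> x. N +>\<^bsub>M\<^esub> r \<odot>\<^bsub>M\<^esub> x)"
      by (rule SUP_cong[OF refl])
    also have "\<dots> = N +>\<^bsub>M\<^esub> r \<odot>\<^bsub>M\<^esub> x"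
      using N.a_rcos_self[OF x] by blast
    finally show ?thesis by (simp only: quotient_module_def module.simps)
  qed
  have z: "N +>\<^bsub>M\<^esub> \<zero>\<^bsub>M\<^esub> = \<zero>\<^bsub>quotient_module M N\<^esub>"
    using Nc by (simp add: quotient_module_def)
  have a: "N +>\<^bsub>M\<^esub> (x \<oplus>\<^bsub>M\<^esub> y) = (N +>\<^bsub>M\<^esub> x) \<oplus>\<^bsub>quotient_module M N\<^esub> (N +>\<^bsub>M\<^esub> y)"
    if "x \<in> carrier M" "y \<in> carrier M" for x y
    using N.a_rcos_sum[OF that] by (simp add: quotient_module_def)
  show "module R (quotient_module M N)" "(\<lambda>x. N +>\<^bsub>M\<^esub> x) \<in> mod_hom R M (quotient_module M N)"
    using module_hom_image[OF assms(1) c z a sm] by auto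
  show "N +>\<^bsub>M\<^esub> x = \<zero>\<^bsub>quotient_module M N\<^esub> \<longleftrightarrow> x \<in> N" if "x \<in> carrier M" for x
    using that M.a_coset_join1[OF _ that sg] M.a_coset_join2[OF that sg]
    by (auto simp: quotient_module_def)
qed

definition transport :: "('m \<Rightarrow> 'n) \<Rightarrow> ('r, 'm) module \<Rightarrow> ('r, 'n) module"
  where "transport h M = \<lparr>carrier = h ` carrier M, monoid.mult = undefined, one = undefined,
    ring.zero = h \<zero>\<^bsub>M\<^esub>,
    ring.add = (\<lambda>x y. h (inv_into (carrier M) h x \<oplus>\<^bsub>M\<^esub> inv_into (carrier M) h y)),
    smult = (\<lambda>r x. h (r \<odot>\<^bsub>M\<^esub> inv_into (carrier M) h x))\<rparr>"

lemma transport_facts: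
  assumes "module R M" "inj_on h (carrier M)"
  shows "module R (transport h M)"
    and "h \<in> mod_hom R M (transport h M)"
    and "carrier (transport h M) = h ` carrier M"
    and "inv_into (carrier M) h \<in> mod_hom R (transport h M) M"
proof -
  interpret module R M by fact
  show c: "carrier (transport h M) = h ` carrier M" by (simp add: transport_def)
  show "module R (transport h M)" and hom: "h \<in> mod_hom R M (transport h M)"
    by (rule module_hom_image[OF assms(1) c]; simp add: transport_def assms(2))+
  show "inv_into (carrier M) h \<in> mod_hom R (transport h M) M"
    by (rule mod_homI) (auto simp: c assms(2) simp flip: mod_homD(2,3)[OF hom])
qed

lemma mod_hom_inj_iff:
  assumes "module R M" "module R N" "f \<in> mod_hom R M N"
    and "\<And>x. x \<in> carrier M \<Longrightarrow> f x = \<zero>\<^bsub>N\<^esub> \<Longrightarrow> x = \<zero>\<^bsub>M\<^esub>"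
  shows "inj_on f (carrier M)"
proof (rule inj_onI)
  interpret M: module R M by fact
  interpret N: module R N by fact
  fix x y assume xy: "x \<in> carrier M" "y \<in> carrier M" "f x = f y"
  have "f (x \<oplus>\<^bsub>M\<^esub> \<ominus>\<^bsub>M\<^esub> y) = \<zero>\<^bsub>N\<^esub>"
    using xy mod_homD(1,2)[OF assms(3)] mod_hom_minus[OF assms(1-3)] by (simp add: N.r_neg)
  then have "x \<oplus>\<^bsub>M\<^esub> \<ominus>\<^bsub>M\<^esub> y = \<zero>\<^bsub>M\<^esub>" using assms(4) xy by simp
  then show "x = y" using xy M.minus_equality[of x "\<ominus>\<^bsub>M\<^esub> y"] by simp
qed

lemma submodule_image:
  assumes "module R M" "module R N" "f \<in> mod_hom R M N"
  shows "submodule (f ` carrier M) R N"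
proof -
  interpret M: module R M by fact
  interpret N: module R N by fact
  show ?thesis
    by (rule N.submoduleI)
       (auto simp: mod_homD(1)[OF assms(3)]
         simp flip: mod_hom_zero[OF assms(1-3)] mod_hom_minus[OF assms(1-3)] mod_homD(2,3)[OF assms(3)])
qed

subsection \<open>Abelian groups as modules over the integers\<close>

definition zmodule :: "('r, 'm) module \<Rightarrow> (int, 'm) module"
  where "zmodule M = \<lparr>carrier = carrier M, monoid.mult = undefined, one = undefined,
    ring.zero = \<zero>\<^bsub>M\<^esub>, ring.add = (\<oplus>\<^bsub>M\<^esub>), smult = (\<lambda>n x. [n] \<cdot>\<^bsub>M\<^esub> x)\<rparr>"

lemma zmodule_simps [simp]:
  "carrier (zmodule M) = carrier M" "\<zero>\<^bsub>zmodule M\<^esub> = \<zero>\<^bsub>M\<^esub>" "x \<oplus>\<^bsub>zmodule M\<^esub> y = x \<oplus>\<^bsub>M\<^esub> y"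
  by (simp_all add: zmodule_def)

lemma zmodule_module:
  assumes "abelian_group M"
  shows "module \<Z> (zmodule M)"
proof -
  interpret abelian_group M by fact
  show ?thesis
  proof (rule moduleI)
    show "abelian_group (zmodule M)"
      by (rule abelian_groupI) (auto simp: a_ac intro: l_neg a_inv_closed)
  qed (auto simp: zmodule_def int_is_cring add.int_pow_mult add.int_pow_mult_distrib a_comm add.int_pow_pow
      mult.commute)
qed

lemma additive_imp_zlinear:
  assumes "module \<Z> A" "module \<Z> C" "f \<in> carrier A \<rightarrow> carrier C"
    and "\<And>x y. x \<in> carrier A \<Longrightarrow> y \<in> carrier A \<Longrightarrow> f (x \<oplus>\<^bsub>A\<^esub> y) = f x \<oplus>\<^bsub>C\<^esub> f y"
  shows "f \<in> mod_hom \<Z> A C"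
proof (rule mod_homI)
  interpret A: module \<Z> A by fact
  interpret C: module \<Z> C by fact
  fix n :: int and x assume x: "x \<in> carrier A"
  have fx: "f x \<in> carrier C" using x assms(3) by auto
  have z: "f \<zero>\<^bsub>A\<^esub> = \<zero>\<^bsub>C\<^esub>"
    using assms(4)[of "\<zero>\<^bsub>A\<^esub>" "\<zero>\<^bsub>A\<^esub>"] assms(3) by (metis A.M.add.one_closed A.M.l_zero C.M.add.l_cancel_one' PiE)
  have step: "(m + 1) \<odot>\<^bsub>A\<^esub> x = m \<odot>\<^bsub>A\<^esub> x \<oplus>\<^bsub>A\<^esub> x" "(m + 1) \<odot>\<^bsub>C\<^esub> f x = m \<odot>\<^bsub>C\<^esub> f x \<oplus>\<^bsub>C\<^esub> f x" for m :: int
    using A.smult_l_distr[of m 1 x] C.smult_l_distr[of m 1 "f x"] A.smult_one[OF x] C.smult_one[OF fx] x fx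
    by simp_all
  have cl: "m \<odot>\<^bsub>A\<^esub> x \<in> carrier A" "m \<odot>\<^bsub>C\<^esub> f x \<in> carrier C" for m :: int
    using A.smult_closed[of m x] C.smult_closed[of m "f x"] x fx by auto
  show "f (n \<odot>\<^bsub>A\<^esub> x) = n \<odot>\<^bsub>C\<^esub> f x"
  proof (induction n rule: int_induct[where k = 0])
    case base
    then show ?case using A.smult_l_null[OF x] C.smult_l_null[OF fx] z by simp
  next
    case (step1 i)
    then show ?case using step assms(4)[OF cl(1) x] by simp
  next
    case (step2 i)
    have "f ((i - 1) \<odot>\<^bsub>A\<^esub> x) \<oplus>\<^bsub>C\<^esub> f x = (i - 1) \<odot>\<^bsub>C\<^esub> f x \<oplus>\<^bsub>C\<^esub> f x"
      using step[of "i - 1"] assms(4)[OF cl(1) x, of "i - 1"] step2 by simp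
    then show ?case
      using cl fx assms(3) by (metis C.M.add.r_cancel PiE)
  qed
qed (use assms in auto)

lemma divisible_extension:
  fixes B :: "(int, 'b) module" and D :: "(int, 'd) module"
  assumes "module \<Z> B" "module \<Z> D"
    and div: "\<And>n x. n > 0 \<Longrightarrow> x \<in> carrier D \<Longrightarrow> \<exists>y\<in>carrier D. n \<odot>\<^bsub>D\<^esub> y = x"
    and S0: "S0 \<subseteq> carrier B \<times> carrier D" "S0 \<noteq> {}"
      "\<And>b d b' d'. (b, d) \<in> S0 \<Longrightarrow> (b', d') \<in> S0 \<Longrightarrow> (b \<oplus>\<^bsub>B\<^esub> b', d \<oplus>\<^bsub>D\<^esub> d') \<in> S0"
      "\<And>n b d. (b, d) \<in> S0 \<Longrightarrow> (n \<odot>\<^bsub>B\<^esub> b, n \<odot>\<^bsub>D\<^esub> d) \<in> S0"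
      "\<And>d. (\<zero>\<^bsub>B\<^esub>, d) \<in> S0 \<Longrightarrow> d = \<zero>\<^bsub>D\<^esub>"
  shows "\<exists>g\<in>mod_hom \<Z> B D. \<forall>(b, d)\<in>S0. g b = d"
proof -
  interpret B: module \<Z> B by fact
  interpret D: module \<Z> D by fact
  note Bsm = B.smult_closed[simplified] and Dsm = D.smult_closed[simplified]
  define good where "good G \<longleftrightarrow> G \<subseteq> carrier B \<times> carrier D \<and>
      (\<forall>b d b' d'. (b, d) \<in> G \<longrightarrow> (b', d') \<in> G \<longrightarrow> (b \<oplus>\<^bsub>B\<^esub> b', d \<oplus>\<^bsub>D\<^esub> d') \<in> G) \<and>
      (\<forall>n b d. (b, d) \<in> G \<longrightarrow> (n \<odot>\<^bsub>B\<^esub> b, n \<odot>\<^bsub>D\<^esub> d) \<in> G) \<and>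
      (\<forall>d. (\<zero>\<^bsub>B\<^esub>, d) \<in> G \<longrightarrow> d = \<zero>\<^bsub>D\<^esub>)" for G
  let ?\<A> = "{G. good G \<and> S0 \<subseteq> G}"
  have ne: "S0 \<in> ?\<A>" using S0 unfolding good_def by blast
  have "\<exists>G\<in>?\<A>. \<forall>H\<in>?\<A>. G \<subseteq> H \<longrightarrow> H = G"
  proof (rule subset_Zorn_nonempty)
    show "?\<A> \<noteq> {}" using ne by blast
    fix C assume C: "C \<noteq> {}" "subset.chain ?\<A> C"
    have g: "good G" "S0 \<subseteq> G" if "G \<in> C" for G using C(2) that unfolding subset.chain_def by auto
    have two: "\<exists>H\<in>C. p \<in> H \<and> q \<in> H" if "p \<in> \<Union>C" "q \<in> \<Union>C" for p q
      using that C(2) unfolding subset_chain_def by blast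
    have "good (\<Union>C)"
      unfolding good_def
    proof (intro conjI allI impI)
      show "\<Union>C \<subseteq> carrier B \<times> carrier D" using g(1) unfolding good_def by blast
      show "(b \<oplus>\<^bsub>B\<^esub> b', d \<oplus>\<^bsub>D\<^esub> d') \<in> \<Union>C" if bd: "(b, d) \<in> \<Union>C" "(b', d') \<in> \<Union>C" for b d b' d'
      proof -
        obtain H where H: "H \<in> C" "(b, d) \<in> H" "(b', d') \<in> H" using two[OF bd] by blast
        then have "(b \<oplus>\<^bsub>B\<^esub> b', d \<oplus>\<^bsub>D\<^esub> d') \<in> H" using g(1)[OF H(1)] unfolding good_def by blast
        then show ?thesis using H(1) by blast
      qed
      show "(n \<odot>\<^bsub>B\<^esub> b, n \<odot>\<^bsub>D\<^esub> d) \<in> \<Union>C" if "(b, d) \<in> \<Union>C" for n b d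
        using that g(1) unfolding good_def by blast
      show "d = \<zero>\<^bsub>D\<^esub>" if "(\<zero>\<^bsub>B\<^esub>, d) \<in> \<Union>C" for d
        using that g(1) unfolding good_def by blast
    qed
    moreover have "S0 \<subseteq> \<Union>C" using C(1) g(2) by blast
    ultimately show "\<Union>C \<in> ?\<A>" by blast
  qed
  then obtain G where G: "good G" "S0 \<subseteq> G" and max: "\<And>H. good H \<Longrightarrow> G \<subseteq> H \<Longrightarrow> H = G"
    by (smt (verit, ccfv_threshold) mem_Collect_eq order_trans)
  have Gc: "b \<in> carrier B" "d \<in> carrier D" if "(b, d) \<in> G" for b d using G(1) that unfolding good_def by auto
  have Ga: "(b \<oplus>\<^bsub>B\<^esub> b', d \<oplus>\<^bsub>D\<^esub> d') \<in> G" if "(b, d) \<in> G" "(b', d') \<in> G" for b d b' d'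
    using G(1) that unfolding good_def by blast
  have Gs: "(n \<odot>\<^bsub>B\<^esub> b, n \<odot>\<^bsub>D\<^esub> d) \<in> G" if "(b, d) \<in> G" for n b d
    using G(1) that unfolding good_def by blast
  have Gz: "d = \<zero>\<^bsub>D\<^esub>" if "(\<zero>\<^bsub>B\<^esub>, d) \<in> G" for d using G(1) that unfolding good_def by blast
  have sub: "(-1) \<odot>\<^bsub>B\<^esub> x = \<ominus>\<^bsub>B\<^esub> x" if "x \<in> carrier B" for x
    using B.smult_l_minus[of 1 x] B.smult_one that by simp
  have subD: "(-1) \<odot>\<^bsub>D\<^esub> x = \<ominus>\<^bsub>D\<^esub> x" if "x \<in> carrier D" for x
    using D.smult_l_minus[of 1 x] D.smult_one that by simp
  have Gf: "d = d'" if "(b, d) \<in> G" "(b, d') \<in> G" for b d d'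
  proof -
    have "(b \<oplus>\<^bsub>B\<^esub> (-1) \<odot>\<^bsub>B\<^esub> b, d \<oplus>\<^bsub>D\<^esub> (-1) \<odot>\<^bsub>D\<^esub> d') \<in> G" using Ga Gs that by blast
    then have "d \<oplus>\<^bsub>D\<^esub> \<ominus>\<^bsub>D\<^esub> d' = \<zero>\<^bsub>D\<^esub>" using Gz Gc that sub subD by (simp add: B.M.r_neg)
    then show ?thesis using Gc that D.M.minus_equality[of d "\<ominus>\<^bsub>D\<^esub> d'"] by simp
  qed
  have "\<exists>d. (x, d) \<in> G" if x: "x \<in> carrier B" for x
  proof (rule ccontr)
    assume nx: "\<nexists>d. (x, d) \<in> G"
    define K where "K = {n :: nat. n > 0 \<and> (\<exists>d. (int n \<odot>\<^bsub>B\<^esub> x, d) \<in> G)}"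
    have Bmul: "(m + n) \<odot>\<^bsub>B\<^esub> x = m \<odot>\<^bsub>B\<^esub> x \<oplus>\<^bsub>B\<^esub> n \<odot>\<^bsub>B\<^esub> x" "(m * n) \<odot>\<^bsub>B\<^esub> x = m \<odot>\<^bsub>B\<^esub> (n \<odot>\<^bsub>B\<^esub> x)" for m n :: int
      using B.smult_l_distr[of m n x] B.smult_assoc1[of m n x] x by simp_all
    have Dmul: "(m + n) \<odot>\<^bsub>D\<^esub> y = m \<odot>\<^bsub>D\<^esub> y \<oplus>\<^bsub>D\<^esub> n \<odot>\<^bsub>D\<^esub> y" "(m * n) \<odot>\<^bsub>D\<^esub> y = m \<odot>\<^bsub>D\<^esub> (n \<odot>\<^bsub>D\<^esub> y)"
      if "y \<in> carrier D" for m n :: int and y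
      using D.smult_l_distr[of m n y] D.smult_assoc1[of m n y] that by simp_all
    have "\<exists>y\<in>carrier D. \<forall>n e. (n \<odot>\<^bsub>B\<^esub> x, e) \<in> G \<longrightarrow> n \<odot>\<^bsub>D\<^esub> y = e"
    proof (cases "K = {}")
      case True
      have n0: "n = 0" if ne: "(n \<odot>\<^bsub>B\<^esub> x, e) \<in> G" for n e
      proof (rule ccontr)
        assume "n \<noteq> 0"
        have "((- n) \<odot>\<^bsub>B\<^esub> x, (-1) \<odot>\<^bsub>D\<^esub> e) \<in> G" using Gs[OF ne, of "-1"] Bmul(2)[of "-1" n] by simp
        then have "\<exists>e. (int (nat \<bar>n\<bar>) \<odot>\<^bsub>B\<^esub> x, e) \<in> G" using ne by (cases "n > 0") (metis abs_of_pos int_nat_eq order_less_imp_le, metis abs_if int_nat_eq linorder_neqE_linordered_idom abs_ge_zero \<open>n \<noteq> 0\<close>)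
        then have "nat \<bar>n\<bar> \<in> K" using \<open>n \<noteq> 0\<close> unfolding K_def by simp
        then show False using True by blast
      qed
      have "n \<odot>\<^bsub>D\<^esub> \<zero>\<^bsub>D\<^esub> = e" if ne: "(n \<odot>\<^bsub>B\<^esub> x, e) \<in> G" for n e
      proof -
        have "n = 0" using n0[OF ne] .
        then have "(\<zero>\<^bsub>B\<^esub>, e) \<in> G" using ne B.smult_l_null[OF x] by simp
        then have "e = \<zero>\<^bsub>D\<^esub>" by (rule Gz)
        then show ?thesis using \<open>n = 0\<close> D.smult_l_null[OF D.M.zero_closed] by simp
      qed
      then show ?thesis using D.M.zero_closed by blast
    next
      case False
      define k where "k = (LEAST n. n \<in> K)"
      have k: "k \<in> K" unfolding k_def using False by (auto intro: LeastI)
      have kmin: "k \<le> m" if "m \<in> K" for m unfolding k_def using that by (rule Least_le)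
      obtain d where d: "(int k \<odot>\<^bsub>B\<^esub> x, d) \<in> G" using k unfolding K_def by blast
      obtain y where y: "y \<in> carrier D" "int k \<odot>\<^bsub>D\<^esub> y = d"
        using div[of "int k" d] k Gc(2)[OF d] unfolding K_def by fastforce
      have "n \<odot>\<^bsub>D\<^esub> y = e" if ne: "(n \<odot>\<^bsub>B\<^esub> x, e) \<in> G" for n e
      proof -
        define q r where "q = n div int k" and "r = n mod int k"
        have k0: "int k > 0" using k unfolding K_def by simp
        have nqr: "n = q * int k + r" by (simp add: q_def r_def)
        have qk: "((q * int k) \<odot>\<^bsub>B\<^esub> x, (q * int k) \<odot>\<^bsub>D\<^esub> y) \<in> G"
          using Gs[OF d, of q] Bmul(2)[of q "int k"] Dmul(2)[OF y(1), of q "int k"] y(2) by simp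
        have "r = 0"
        proof (rule ccontr)
          assume "r \<noteq> 0"
          have r: "0 \<le> r" "r < int k" using k0 by (auto simp: r_def)
          have "r \<odot>\<^bsub>B\<^esub> x = n \<odot>\<^bsub>B\<^esub> x \<oplus>\<^bsub>B\<^esub> (-1) \<odot>\<^bsub>B\<^esub> ((q * int k) \<odot>\<^bsub>B\<^esub> x)"
            using Bmul(1)[of n "- (q * int k)"] Bmul(2)[of "-1" "q * int k"] nqr by simp
          then have "\<exists>e. (r \<odot>\<^bsub>B\<^esub> x, e) \<in> G" using Ga[OF ne Gs[OF qk, of "-1"]] by metis
          then have "nat r \<in> K" using r \<open>r \<noteq> 0\<close> unfolding K_def by simp
          then show False using kmin[of "nat r"] r by linarith
        qed
        then have "n = q * int k" using nqr by simp
        then show ?thesis using Gf[OF qk] ne by metis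
      qed
      then show ?thesis using y(1) by blast
    qed
    then obtain y where y: "y \<in> carrier D" "\<And>n e. (n \<odot>\<^bsub>B\<^esub> x, e) \<in> G \<Longrightarrow> n \<odot>\<^bsub>D\<^esub> y = e" by blast
    define H where "H = {(b \<oplus>\<^bsub>B\<^esub> n \<odot>\<^bsub>B\<^esub> x, d \<oplus>\<^bsub>D\<^esub> n \<odot>\<^bsub>D\<^esub> y) | b d n. (b, d) \<in> G}"
    have HI: "(b \<oplus>\<^bsub>B\<^esub> n \<odot>\<^bsub>B\<^esub> x, d \<oplus>\<^bsub>D\<^esub> n \<odot>\<^bsub>D\<^esub> y) \<in> H" if "(b, d) \<in> G" for b d n
      using that unfolding H_def by blast
    have HE: "\<exists>b d n. p = b \<oplus>\<^bsub>B\<^esub> n \<odot>\<^bsub>B\<^esub> x \<and> q = d \<oplus>\<^bsub>D\<^esub> n \<odot>\<^bsub>D\<^esub> y \<and> (b, d) \<in> G" if "(p, q) \<in> H" for p q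
      using that unfolding H_def by blast
    have "good H"
      unfolding good_def
    proof (intro conjI allI impI)
      show "H \<subseteq> carrier B \<times> carrier D"
      proof
        fix p assume "p \<in> H"
        then obtain b d n where *: "p = (b \<oplus>\<^bsub>B\<^esub> n \<odot>\<^bsub>B\<^esub> x, d \<oplus>\<^bsub>D\<^esub> n \<odot>\<^bsub>D\<^esub> y)" "(b, d) \<in> G"
          unfolding H_def by blast
        show "p \<in> carrier B \<times> carrier D"
          using Gc[OF *(2)] Bsm[OF x, of n] Dsm[OF y(1), of n] *(1) by simp
      qed
    next
      fix p q p' q' assume "(p, q) \<in> H" "(p', q') \<in> H"
      then obtain b d n b' d' n' where *: "p = b \<oplus>\<^bsub>B\<^esub> n \<odot>\<^bsub>B\<^esub> x" "q = d \<oplus>\<^bsub>D\<^esub> n \<odot>\<^bsub>D\<^esub> y" "(b, d) \<in> G"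
        "p' = b' \<oplus>\<^bsub>B\<^esub> n' \<odot>\<^bsub>B\<^esub> x" "q' = d' \<oplus>\<^bsub>D\<^esub> n' \<odot>\<^bsub>D\<^esub> y" "(b', d') \<in> G" using HE by meson
      have "p \<oplus>\<^bsub>B\<^esub> p' = (b \<oplus>\<^bsub>B\<^esub> b') \<oplus>\<^bsub>B\<^esub> (n + n') \<odot>\<^bsub>B\<^esub> x"
        using Gc(1)[OF *(3)] Gc(1)[OF *(6)] Bsm[OF x] by (simp add: *(1,4) Bmul B.M.a_ac)
      moreover have "q \<oplus>\<^bsub>D\<^esub> q' = (d \<oplus>\<^bsub>D\<^esub> d') \<oplus>\<^bsub>D\<^esub> (n + n') \<odot>\<^bsub>D\<^esub> y"
        using Gc(2)[OF *(3)] Gc(2)[OF *(6)] Dsm[OF y(1)] by (simp add: *(2,5) Dmul[OF y(1)] D.M.a_ac)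
      ultimately show "(p \<oplus>\<^bsub>B\<^esub> p', q \<oplus>\<^bsub>D\<^esub> q') \<in> H" using HI[OF Ga[OF *(3,6)]] by simp
    next
      fix m p q assume "(p, q) \<in> H"
      then obtain b d n where *: "p = b \<oplus>\<^bsub>B\<^esub> n \<odot>\<^bsub>B\<^esub> x" "q = d \<oplus>\<^bsub>D\<^esub> n \<odot>\<^bsub>D\<^esub> y" "(b, d) \<in> G" using HE by meson
      have "m \<odot>\<^bsub>B\<^esub> p = m \<odot>\<^bsub>B\<^esub> b \<oplus>\<^bsub>B\<^esub> (m * n) \<odot>\<^bsub>B\<^esub> x"
        using B.smult_r_distr[of m b "n \<odot>\<^bsub>B\<^esub> x"] Gc(1)[OF *(3)] Bsm[OF x] by (simp add: *(1) Bmul)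
      moreover have "m \<odot>\<^bsub>D\<^esub> q = m \<odot>\<^bsub>D\<^esub> d \<oplus>\<^bsub>D\<^esub> (m * n) \<odot>\<^bsub>D\<^esub> y"
        using D.smult_r_distr[of m d "n \<odot>\<^bsub>D\<^esub> y"] Gc(2)[OF *(3)] Dsm[OF y(1)] by (simp add: *(2) Dmul[OF y(1)])
      ultimately show "(m \<odot>\<^bsub>B\<^esub> p, m \<odot>\<^bsub>D\<^esub> q) \<in> H" using HI[OF Gs[OF *(3)]] by simp
    next
      fix q assume "(\<zero>\<^bsub>B\<^esub>, q) \<in> H"
      then obtain b d n where *: "\<zero>\<^bsub>B\<^esub> = b \<oplus>\<^bsub>B\<^esub> n \<odot>\<^bsub>B\<^esub> x" "q = d \<oplus>\<^bsub>D\<^esub> n \<odot>\<^bsub>D\<^esub> y" "(b, d) \<in> G" using HE by meson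
      have b: "b \<in> carrier B" "d \<in> carrier D" using Gc *(3) by auto
      have "b = \<ominus>\<^bsub>B\<^esub> (n \<odot>\<^bsub>B\<^esub> x)" using *(1) b Bsm[OF x] by (metis B.M.minus_equality)
      also have "\<dots> = (- n) \<odot>\<^bsub>B\<^esub> x" using Bmul(2)[of "-1" n] sub[OF Bsm[OF x]] by simp
      finally have "(- n) \<odot>\<^bsub>D\<^esub> y = d" using y(2) *(3) by blast
      then have "q = (- n + n) \<odot>\<^bsub>D\<^esub> y" using Dmul(1)[OF y(1), of "-n" n] *(2) by simp
      then show "q = \<zero>\<^bsub>D\<^esub>" using D.smult_l_null[OF y(1)] by simp
    qed
    moreover have "G \<subseteq> H"
    proof
      fix p assume p: "p \<in> G"
      obtain b d where bd: "p = (b, d)" by (cases p)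
      show "p \<in> H" using HI[of b d 0] p Gc[of b d] B.smult_l_null[OF x] D.smult_l_null[OF y(1)] by (simp add: bd)
    qed
    ultimately have "H = G" by (rule max)
    obtain b d where bd: "(b, d) \<in> G" using G(2) S0(2) by auto
    then have "(\<zero>\<^bsub>B\<^esub>, \<zero>\<^bsub>D\<^esub>) \<in> G"
      using Gs[OF bd, of 0] Gc[OF bd] B.smult_l_null D.smult_l_null by simp
    then have "(x, y) \<in> H" using HI[of "\<zero>\<^bsub>B\<^esub>" "\<zero>\<^bsub>D\<^esub>" 1] x y(1) B.smult_one D.smult_one by simp
    then show False using \<open>H = G\<close> nx by blast
  qed
  then obtain g where g: "\<And>x. x \<in> carrier B \<Longrightarrow> (x, g x) \<in> G" by metis
  have "g \<in> mod_hom \<Z> B D"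
  proof (rule mod_homI)
    show "g x \<in> carrier D" if "x \<in> carrier B" for x using g[OF that] Gc by blast
    show "g (x \<oplus>\<^bsub>B\<^esub> y) = g x \<oplus>\<^bsub>D\<^esub> g y" if "x \<in> carrier B" "y \<in> carrier B" for x y
      using Gf[OF g Ga[OF g g]] that by simp
    show "g (n \<odot>\<^bsub>B\<^esub> x) = n \<odot>\<^bsub>D\<^esub> g x" if "x \<in> carrier B" for n x
      using Gf[OF g Gs[OF g]] that Bsm by simp
  qed
  moreover have "\<forall>(b, d)\<in>S0. g b = d"
  proof clarify
    fix b d assume "(b, d) \<in> S0"
    then have bd: "(b, d) \<in> G" using G(2) by blast
    show "g b = d" using Gf[OF g[OF Gc(1)[OF bd]] bd] .
  qed
  ultimately show ?thesis by blast
qed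

subsection \<open>Divisible groups\<close>

definition divisible :: "(int, 'd) module \<Rightarrow> bool"
  where "divisible D \<longleftrightarrow> module \<Z> D \<and>
    (\<forall>n>0. \<forall>x\<in>carrier D. \<exists>y\<in>carrier D. n \<odot>\<^bsub>D\<^esub> y = x)"

definition ratvec :: "(int, 'x \<Rightarrow> rat) module"
  where "ratvec = \<lparr>carrier = {f. finite {x. f x \<noteq> 0}}, monoid.mult = undefined, one = undefined,
    ring.zero = (\<lambda>x. 0), ring.add = (\<lambda>f g x. f x + g x), smult = (\<lambda>n f x. of_int n * f x)\<rparr>"

lemma ratvec_simps:
  "carrier ratvec = {f. finite {x. f x \<noteq> 0}}" "\<zero>\<^bsub>ratvec\<^esub> = (\<lambda>x. 0)"
  "f \<oplus>\<^bsub>ratvec\<^esub> g = (\<lambda>x. f x + g x)" "n \<odot>\<^bsub>ratvec\<^esub> f = (\<lambda>x. of_int n * f x)"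
  by (simp_all add: ratvec_def)

lemma ratvec_module: "module \<Z> (ratvec :: (int, 'x \<Rightarrow> rat) module)"
proof (rule moduleI)
  have fa: "finite {x. f x + g x \<noteq> 0}" if "finite {x. f x \<noteq> 0}" "finite {x. g x \<noteq> 0}" for f g :: "'x \<Rightarrow> rat"
    by (rule finite_subset[of _ "{x. f x \<noteq> 0} \<union> {x. g x \<noteq> 0}"]) (use that in auto)
  show "abelian_group (ratvec :: (int, 'x \<Rightarrow> rat) module)"
  proof (rule abelian_groupI)
    fix f :: "'x \<Rightarrow> rat" assume f: "f \<in> carrier ratvec"
    show "\<exists>y\<in>carrier ratvec. y \<oplus>\<^bsub>ratvec\<^esub> f = \<zero>\<^bsub>ratvec\<^esub>"
      by (rule bexI[of _ "\<lambda>x. - f x"]) (use f in \<open>auto simp: ratvec_simps\<close>)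
  qed (auto simp: ratvec_simps fa add_ac)
qed (auto simp: ratvec_simps int_is_cring algebra_simps)

fun ratsum :: "(rat \<times> 'x) list \<Rightarrow> 'x \<Rightarrow> rat"
  where "ratsum [] = (\<lambda>x. 0)"
  | "ratsum ((q, y) # l) = (\<lambda>x. (if x = y then q else 0) + ratsum l x)"

lemma ratsum_surj:
  assumes "finite {x. f x \<noteq> 0}"
  shows "\<exists>l. ratsum l = f"
proof -
  have "\<exists>l. ratsum l = f" if "finite T" "{x. f x \<noteq> 0} \<subseteq> T" for T f
    using that
  proof (induction T arbitrary: f)
    case empty
    then show ?case by (intro exI[of _ "[]"]) auto
  next
    case (insert y T)
    have "\<exists>l. ratsum l = f(y := 0)" by (rule insert.IH) (use insert.prems in auto)
    then obtain l where "ratsum l = f(y := 0)" by blast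
    then show ?case by (intro exI[of _ "(f y, y) # l"]) auto
  qed
  then show ?thesis using assms by blast
qed

lemma divisible_transport:
  assumes "divisible D" "inj_on h (carrier D)"
  shows "divisible (transport h D)"
  unfolding divisible_def
proof (intro conjI allI ballI impI)
  have m: "module \<Z> D" using assms(1) by (simp add: divisible_def)
  note t = transport_facts[OF m assms(2)]
  show "module \<Z> (transport h D)" by (rule t)
  fix n :: int and x assume n: "n > 0" and "x \<in> carrier (transport h D)"
  then obtain a where a: "a \<in> carrier D" "x = h a" by (auto simp: t)
  then obtain b where b: "b \<in> carrier D" "n \<odot>\<^bsub>D\<^esub> b = a" using assms(1) n unfolding divisible_def by blast
  show "\<exists>y\<in>carrier (transport h D). n \<odot>\<^bsub>transport h D\<^esub> y = x"
    by (rule bexI[of _ "h b"]) (use a b mod_homD(1,3)[OF t(2)] in auto)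
qed

text \<open>
  The divisible group is the quotient of the rational vector space on \<open>X\<close> by the relations that
  hold in \<open>X\<close> between integral combinations of elements.
\<close>

lemma divisible_embedding:
  fixes X :: "('r, 'x) module"
  assumes "abelian_group X"
  shows "\<exists>(D :: (int, (rat \<times> 'x) list) module) i. divisible D \<and> i \<in> carrier X \<rightarrow> carrier D \<and>
    (\<forall>x\<in>carrier X. \<forall>y\<in>carrier X. i (x \<oplus>\<^bsub>X\<^esub> y) = i x \<oplus>\<^bsub>D\<^esub> i y) \<and> inj_on i (carrier X)"
proof -
  interpret X: abelian_group X by fact
  let ?Z = "zmodule X" and ?F = "free_module \<Z> :: (int, 'x \<Rightarrow> int) module"
  let ?V = "ratvec :: (int, 'x \<Rightarrow> rat) module"
  have mZ: "module \<Z> ?Z" by (rule zmodule_module[OF assms])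
  have mF: "module \<Z> ?F" by (rule free_module_module[OF int_is_cring])
  have mV: "module \<Z> ?V" by (rule ratvec_module)
  interpret F: module \<Z> ?F by (rule mF)
  interpret V: module \<Z> ?V by (rule mV)
  interpret Z: module \<Z> ?Z by (rule mZ)
  define \<phi> where "\<phi> = (\<lambda>x. if x \<in> carrier X then x else \<zero>\<^bsub>X\<^esub>)"
  have \<phi>: "\<phi> x \<in> carrier ?Z" for x by (simp add: \<phi>_def)
  define \<sigma> where "\<sigma> = linear_extension \<Z> ?Z \<phi>"
  have \<sigma>: "\<sigma> \<in> mod_hom \<Z> ?F ?Z" unfolding \<sigma>_def by (rule linear_extension_hom[OF mZ \<phi>])
  have \<sigma>1: "\<sigma> (unit_vec \<Z> x) = x" if "x \<in> carrier X" for x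
    unfolding \<sigma>_def linear_extension_unit_vec[OF mZ \<phi>] using that by (simp add: \<phi>_def)
  have u: "unit_vec \<Z> x \<in> carrier ?F" for x by (rule unit_vec_carrier[OF int_is_cring])
  define \<rho> where "\<rho> = (\<lambda>(f :: 'x \<Rightarrow> int) x. rat_of_int (f x))"
  have \<rho>: "\<rho> \<in> mod_hom \<Z> ?F ?V"
    by (rule mod_homI) (auto simp: \<rho>_def free_module_simps ratvec_simps)
  have \<rho>_inj: "f = g" if "\<rho> f = \<rho> g" for f g
    using that by (auto simp: \<rho>_def fun_eq_iff)
  define K where "K = \<rho> ` a_kernel ?F ?Z \<sigma>"
  have K: "submodule K \<Z> ?V"
  proof (rule V.submoduleI)
    show "K \<subseteq> carrier ?V" using mod_homD(1)[OF \<rho>] by (auto simp: K_def a_kernel_iff)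
    have "\<zero>\<^bsub>?F\<^esub> \<in> a_kernel ?F ?Z \<sigma>" using mod_hom_zero[OF mF mZ \<sigma>] by (simp add: a_kernel_iff)
    then show "\<zero>\<^bsub>?V\<^esub> \<in> K" unfolding K_def mod_hom_zero[OF mF mV \<rho>, symmetric] by (rule imageI)
  next
    fix k assume "k \<in> K"
    then obtain f where f: "f \<in> carrier ?F" "\<sigma> f = \<zero>\<^bsub>X\<^esub>" "k = \<rho> f" by (auto simp: K_def a_kernel_iff)
    have "\<sigma> (\<ominus>\<^bsub>?F\<^esub> f) = \<zero>\<^bsub>X\<^esub>"
      unfolding mod_hom_minus[OF mF mZ \<sigma> f(1)] using f(2) Z.M.minus_equality[of "\<zero>\<^bsub>?Z\<^esub>" "\<zero>\<^bsub>?Z\<^esub>"]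
      by simp
    then show "\<ominus>\<^bsub>?V\<^esub> k \<in> K"
      unfolding f(3) mod_hom_minus[OF mF mV \<rho> f(1), symmetric] K_def
      using f(1) by (auto simp: a_kernel_iff intro!: imageI)
  next
    fix k l assume "k \<in> K" "l \<in> K"
    then obtain f g where f: "f \<in> carrier ?F" "\<sigma> f = \<zero>\<^bsub>X\<^esub>" "k = \<rho> f"
      and g: "g \<in> carrier ?F" "\<sigma> g = \<zero>\<^bsub>X\<^esub>" "l = \<rho> g" by (auto simp: K_def a_kernel_iff)
    then show "k \<oplus>\<^bsub>?V\<^esub> l \<in> K"
      unfolding f(3) g(3) mod_homD(2)[OF \<rho> f(1) g(1), symmetric] K_def
      by (auto simp: a_kernel_iff mod_homD(2)[OF \<sigma>] intro!: imageI)
  next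
    fix n k assume "k \<in> K"
    then obtain f where f: "f \<in> carrier ?F" "\<sigma> f = \<zero>\<^bsub>X\<^esub>" "k = \<rho> f" by (auto simp: K_def a_kernel_iff)
    have "\<sigma> (n \<odot>\<^bsub>?F\<^esub> f) = \<zero>\<^bsub>X\<^esub>"
      using mod_homD(3)[OF \<sigma> int_Zcarr f(1)] f(2) module.smult_r_null[OF mZ int_Zcarr] by simp
    then show "n \<odot>\<^bsub>?V\<^esub> k \<in> K"
      unfolding f(3) mod_homD(3)[OF \<rho> int_Zcarr f(1), symmetric] K_def
      using F.smult_closed[OF UNIV_I f(1)] by (auto simp: a_kernel_iff intro!: imageI)
  qed
  let ?D = "quotient_module ?V K"
  note q = quotient_module_facts[OF mV K]
  define \<pi> where "\<pi> = (\<lambda>f. K +>\<^bsub>?V\<^esub> f)"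
  have \<pi>: "\<pi> \<in> mod_hom \<Z> ?V ?D" "carrier ?D = \<pi> ` carrier ?V"
    "\<And>f. f \<in> carrier ?V \<Longrightarrow> \<pi> f = \<zero>\<^bsub>?D\<^esub> \<longleftrightarrow> f \<in> K"
    unfolding \<pi>_def by (rule q)+
  have \<pi>\<rho>: "(\<lambda>f. \<pi> (\<rho> f)) \<in> mod_hom \<Z> ?F ?D" by (rule mod_hom_compose[OF \<rho> \<pi>(1)])
  have ker: "\<pi> (\<rho> f) = \<zero>\<^bsub>?D\<^esub> \<longleftrightarrow> \<sigma> f = \<zero>\<^bsub>X\<^esub>" if f: "f \<in> carrier ?F" for f
  proof -
    have "\<rho> f \<in> K \<longleftrightarrow> \<sigma> f = \<zero>\<^bsub>X\<^esub>"
      using f by (auto simp: K_def a_kernel_iff dest!: \<rho>_inj)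
    then show ?thesis using \<pi>(3)[OF mod_homD(1)[OF \<rho> f]] by simp
  qed
  have eq: "\<pi> (\<rho> f) = \<pi> (\<rho> g) \<longleftrightarrow> \<sigma> f = \<sigma> g" if f: "f \<in> carrier ?F" and g: "g \<in> carrier ?F" for f g
  proof -
    have diff: "h f = h g \<longleftrightarrow> h (f \<oplus>\<^bsub>?F\<^esub> \<ominus>\<^bsub>?F\<^esub> g) = \<zero>\<^bsub>C\<^esub>"
      if "module \<Z> C" "h \<in> mod_hom \<Z> ?F C" for C :: "(int, 'c) module" and h
    proof -
      interpret C: module \<Z> C by fact
      have hf: "h f \<in> carrier C" "h g \<in> carrier C" using mod_homD(1)[OF that(2)] f g by auto
      have "h (f \<oplus>\<^bsub>?F\<^esub> \<ominus>\<^bsub>?F\<^esub> g) = h f \<oplus>\<^bsub>C\<^esub> \<ominus>\<^bsub>C\<^esub> h g"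
        using mod_homD(2)[OF that(2) f F.M.a_inv_closed[OF g]] mod_hom_minus[OF mF that g] by simp
      then show ?thesis using hf C.M.minus_equality[of "h f" "\<ominus>\<^bsub>C\<^esub> h g"] by (auto simp: C.M.r_neg)
    qed
    show ?thesis
      using diff[OF q(1) \<pi>\<rho>] diff[OF mZ \<sigma>] ker[OF F.M.a_closed[OF f F.M.a_inv_closed[OF g]]] by simp
  qed
  define i where "i = (\<lambda>x. \<pi> (\<rho> (unit_vec \<Z> x)))"
  have i_cl: "i x \<in> carrier ?D" for x unfolding i_def using mod_homD(1)[OF \<pi>\<rho> u] by simp
  have i_add: "i (x \<oplus>\<^bsub>X\<^esub> y) = i x \<oplus>\<^bsub>?D\<^esub> i y" if "x \<in> carrier X" "y \<in> carrier X" for x y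
    unfolding i_def mod_homD(2)[OF \<pi>\<rho> u u, symmetric]
    using that by (subst eq) (auto simp: u mod_homD(2)[OF \<sigma> u u] \<sigma>1)
  have i_inj: "inj_on i (carrier X)"
    by (rule inj_onI) (simp add: i_def eq u \<sigma>1)
  have div: "divisible ?D"
    unfolding divisible_def
  proof (intro conjI allI ballI impI)
    show "module \<Z> ?D" by (rule q)
    fix n :: int and x assume n: "n > 0" and "x \<in> carrier ?D"
    then obtain f where f: "f \<in> carrier ?V" "x = \<pi> f" using \<pi>(2) by auto
    define g where "g = (\<lambda>x. f x / of_int n)"
    have g: "g \<in> carrier ?V" "n \<odot>\<^bsub>?V\<^esub> g = f" using f n by (auto simp: g_def ratvec_simps)
    show "\<exists>y\<in>carrier ?D. n \<odot>\<^bsub>?D\<^esub> y = x"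
      by (rule bexI[of _ "\<pi> g"]) (use g f mod_homD(1,3)[OF \<pi>(1)] in \<open>auto simp flip: mod_homD(3)[OF \<pi>(1)]\<close>)
  qed
  define e where "e = (\<lambda>C. SOME l. ratsum l \<in> carrier ?V \<and> \<pi> (ratsum l) = C)"
  have e: "\<pi> (ratsum (e C)) = C" if C: "C \<in> carrier ?D" for C
  proof -
    obtain f where f: "f \<in> carrier ?V" "C = \<pi> f" using C \<pi>(2) by auto
    obtain l where "ratsum l = f" using ratsum_surj[of f] f(1) by (auto simp: ratvec_simps)
    then have "\<exists>l. ratsum l \<in> carrier ?V \<and> \<pi> (ratsum l) = C" using f by auto
    from someI_ex[OF this] show ?thesis unfolding e_def by blast
  qed
  have e_inj: "inj_on e (carrier ?D)" by (rule inj_onI) (metis e)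
  note t = transport_facts[OF q(1) e_inj]
  show ?thesis
    by (intro exI[of _ "transport e ?D"] exI[of _ "\<lambda>x. e (i x)"] conjI divisible_transport[OF div e_inj])
       (use i_cl i_add i_inj e_inj mod_homD(1,2)[OF t(2)] in \<open>auto simp: inj_on_def\<close>)
qed

subsection \<open>Coinduced modules\<close>

definition coinduced :: "('r, 'k) ring_scheme \<Rightarrow> (int, 'd) module \<Rightarrow> ('r, 'r \<Rightarrow> 'd) module"
  where "coinduced R D = \<lparr>carrier = {\<phi> \<in> carrier R \<rightarrow>\<^sub>E carrier D.
      \<forall>r\<in>carrier R. \<forall>s\<in>carrier R. \<phi> (r \<oplus>\<^bsub>R\<^esub> s) = \<phi> r \<oplus>\<^bsub>D\<^esub> \<phi> s},
    monoid.mult = undefined, one = undefined, ring.zero = (\<lambda>r\<in>carrier R. \<zero>\<^bsub>D\<^esub>),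
    ring.add = (\<lambda>\<phi> \<psi>. \<lambda>r\<in>carrier R. \<phi> r \<oplus>\<^bsub>D\<^esub> \<psi> r),
    smult = (\<lambda>s \<phi>. \<lambda>r\<in>carrier R. \<phi> (r \<otimes>\<^bsub>R\<^esub> s))\<rparr>"

lemma coinduced_simps:
  "carrier (coinduced R D) = {\<phi> \<in> carrier R \<rightarrow>\<^sub>E carrier D.
      \<forall>r\<in>carrier R. \<forall>s\<in>carrier R. \<phi> (r \<oplus>\<^bsub>R\<^esub> s) = \<phi> r \<oplus>\<^bsub>D\<^esub> \<phi> s}"
  "\<zero>\<^bsub>coinduced R D\<^esub> = (\<lambda>r\<in>carrier R. \<zero>\<^bsub>D\<^esub>)"
  "\<phi> \<oplus>\<^bsub>coinduced R D\<^esub> \<psi> = (\<lambda>r\<in>carrier R. \<phi> r \<oplus>\<^bsub>D\<^esub> \<psi> r)"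
  "s \<odot>\<^bsub>coinduced R D\<^esub> \<phi> = (\<lambda>r\<in>carrier R. \<phi> (r \<otimes>\<^bsub>R\<^esub> s))"
  by (simp_all add: coinduced_def)

lemma coinduced_eqI:
  assumes "\<phi> \<in> carrier (coinduced R D)" "\<psi> \<in> carrier (coinduced R D)"
    and "\<And>r. r \<in> carrier R \<Longrightarrow> \<phi> r = \<psi> r"
  shows "\<phi> = \<psi>"
  using assms by (auto simp: coinduced_simps intro: PiE_ext)

lemma coinducedD:
  assumes "\<phi> \<in> carrier (coinduced R D)" "r \<in> carrier R"
  shows "\<phi> r \<in> carrier D" "s \<in> carrier R \<Longrightarrow> \<phi> (r \<oplus>\<^bsub>R\<^esub> s) = \<phi> r \<oplus>\<^bsub>D\<^esub> \<phi> s"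
  using assms by (auto simp: coinduced_simps)

lemma coinduced_module:
  assumes "cring R" "abelian_group D"
  shows "module R (coinduced R D)"
proof -
  interpret R: cring R by fact
  interpret D: abelian_group D by fact
  note d = coinducedD
  have cl: "(\<lambda>r\<in>carrier R. \<phi> r \<oplus>\<^bsub>D\<^esub> \<psi> r) \<in> carrier (coinduced R D)"
    if "\<phi> \<in> carrier (coinduced R D)" "\<psi> \<in> carrier (coinduced R D)" for \<phi> \<psi>
    unfolding coinduced_simps using d[OF that(1)] d[OF that(2)] by (auto simp: D.a_ac)
  have cs: "(\<lambda>r\<in>carrier R. \<phi> (r \<otimes>\<^bsub>R\<^esub> s)) \<in> carrier (coinduced R D)"
    if "\<phi> \<in> carrier (coinduced R D)" "s \<in> carrier R" for \<phi> s
    unfolding coinduced_simps using d[OF that(1)] that(2) by (auto simp: R.l_distr)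
  have cm: "(\<lambda>r\<in>carrier R. \<ominus>\<^bsub>D\<^esub> \<phi> r) \<in> carrier (coinduced R D)"
    if "\<phi> \<in> carrier (coinduced R D)" for \<phi>
    unfolding coinduced_simps using d[OF that] by (auto simp: D.minus_add)
  have cz: "(\<lambda>r\<in>carrier R. \<zero>\<^bsub>D\<^esub>) \<in> carrier (coinduced R D)"
    unfolding coinduced_simps by auto
  show ?thesis
  proof (rule moduleI)
    show "abelian_group (coinduced R D)"
    proof (rule abelian_groupI)
      fix \<phi> assume \<phi>: "\<phi> \<in> carrier (coinduced R D)"
      show "\<exists>\<psi>\<in>carrier (coinduced R D). \<psi> \<oplus>\<^bsub>coinduced R D\<^esub> \<phi> = \<zero>\<^bsub>coinduced R D\<^esub>"
        by (rule bexI[OF _ cm[OF \<phi>]])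
           (use d(1)[OF \<phi>] in \<open>auto simp: coinduced_simps(2,3) D.l_neg intro!: restrict_ext\<close>)
      show "\<zero>\<^bsub>coinduced R D\<^esub> \<oplus>\<^bsub>coinduced R D\<^esub> \<phi> = \<phi>"
        by (rule coinduced_eqI[OF _ \<phi>]) (use cl[OF cz \<phi>] d(1)[OF \<phi>] in \<open>auto simp: coinduced_simps(2,3)\<close>)
    next
      fix \<phi> \<psi> assume \<phi>: "\<phi> \<in> carrier (coinduced R D)" and \<psi>: "\<psi> \<in> carrier (coinduced R D)"
      show "\<phi> \<oplus>\<^bsub>coinduced R D\<^esub> \<psi> \<in> carrier (coinduced R D)"
        unfolding coinduced_simps(3) by (rule cl[OF \<phi> \<psi>])
      show "\<phi> \<oplus>\<^bsub>coinduced R D\<^esub> \<psi> = \<psi> \<oplus>\<^bsub>coinduced R D\<^esub> \<phi>"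
        unfolding coinduced_simps(3) by (rule restrict_ext) (use d(1)[OF \<phi>] d(1)[OF \<psi>] in \<open>simp add: D.a_comm\<close>)
      fix \<chi> assume \<chi>: "\<chi> \<in> carrier (coinduced R D)"
      show "\<phi> \<oplus>\<^bsub>coinduced R D\<^esub> \<psi> \<oplus>\<^bsub>coinduced R D\<^esub> \<chi> = \<phi> \<oplus>\<^bsub>coinduced R D\<^esub> (\<psi> \<oplus>\<^bsub>coinduced R D\<^esub> \<chi>)"
        unfolding coinduced_simps(3)
        by (rule restrict_ext) (use d(1)[OF \<phi>] d(1)[OF \<psi>] d(1)[OF \<chi>] in \<open>simp add: D.a_assoc\<close>)
    next
      show "\<zero>\<^bsub>coinduced R D\<^esub> \<in> carrier (coinduced R D)"
        unfolding coinduced_simps(2) by (rule cz)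
    qed
  next
    fix a \<phi> assume a: "a \<in> carrier R" and \<phi>: "\<phi> \<in> carrier (coinduced R D)"
    show "a \<odot>\<^bsub>coinduced R D\<^esub> \<phi> \<in> carrier (coinduced R D)"
      unfolding coinduced_simps(4) by (rule cs[OF \<phi> a])
    fix b assume b: "b \<in> carrier R"
    show "(a \<oplus>\<^bsub>R\<^esub> b) \<odot>\<^bsub>coinduced R D\<^esub> \<phi> = a \<odot>\<^bsub>coinduced R D\<^esub> \<phi> \<oplus>\<^bsub>coinduced R D\<^esub> b \<odot>\<^bsub>coinduced R D\<^esub> \<phi>"
      unfolding coinduced_simps(3,4)
      by (rule restrict_ext) (use a b d(2)[OF \<phi>] in \<open>simp add: R.r_distr\<close>)
    show "a \<otimes>\<^bsub>R\<^esub> b \<odot>\<^bsub>coinduced R D\<^esub> \<phi> = a \<odot>\<^bsub>coinduced R D\<^esub> (b \<odot>\<^bsub>coinduced R D\<^esub> \<phi>)"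
      unfolding coinduced_simps(4)
      by (rule restrict_ext) (use a b in \<open>simp add: R.m_assoc\<close>)
  next
    fix a \<phi> \<psi> assume a: "a \<in> carrier R" and \<phi>: "\<phi> \<in> carrier (coinduced R D)" and \<psi>: "\<psi> \<in> carrier (coinduced R D)"
    show "a \<odot>\<^bsub>coinduced R D\<^esub> (\<phi> \<oplus>\<^bsub>coinduced R D\<^esub> \<psi>) = a \<odot>\<^bsub>coinduced R D\<^esub> \<phi> \<oplus>\<^bsub>coinduced R D\<^esub> a \<odot>\<^bsub>coinduced R D\<^esub> \<psi>"
      unfolding coinduced_simps(3,4)
      by (rule restrict_ext) (use a in simp)
  next
    fix \<phi> assume \<phi>: "\<phi> \<in> carrier (coinduced R D)"
    show "\<one>\<^bsub>R\<^esub> \<odot>\<^bsub>coinduced R D\<^esub> \<phi> = \<phi>"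
      by (rule coinduced_eqI[OF _ \<phi>]) (use cs[OF \<phi> R.one_closed] in \<open>auto simp: coinduced_simps(4)\<close>)
  qed (rule assms)
qed

lemma coinduced_lifting:
  fixes A B :: "('r, 'b) module"
  assumes R: "cring R" and D: "divisible D" and A: "module R A" and B: "module R B"
    and j: "j \<in> mod_hom R A B" "inj_on j (carrier A)" and f: "f \<in> mod_hom R A (coinduced R D)"
  shows "\<exists>g\<in>mod_hom R B (coinduced R D). \<forall>x\<in>carrier A. g (j x) = f x"
proof -
  have mD: "module \<Z> D" using D by (simp add: divisible_def)
  interpret R: cring R by fact
  interpret D: module \<Z> D by (rule mD)
  interpret A: module R A by fact
  interpret B: module R B by fact
  have zA: "module \<Z> (zmodule A)" and zB: "module \<Z> (zmodule B)"
    by (rule zmodule_module, rule A.M.abelian_group_axioms, rule zmodule_module, rule B.M.abelian_group_axioms)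
  define e where "e x = f x \<one>\<^bsub>R\<^esub>" for x
  have f_cl: "f x \<in> carrier (coinduced R D)" if "x \<in> carrier A" for x using mod_homD(1)[OF f that] .
  have e: "e \<in> mod_hom \<Z> (zmodule A) D"
    by (rule additive_imp_zlinear[OF zA mD])
       (auto simp: e_def coinducedD[OF f_cl] mod_homD(2)[OF f] coinduced_simps(3))
  have jz: "j \<in> mod_hom \<Z> (zmodule A) (zmodule B)"
    by (rule additive_imp_zlinear[OF zA zB]) (auto simp: mod_homD[OF j(1)])
  define S where "S = (\<lambda>a. (j a, e a)) ` carrier A"
  have "\<exists>g\<in>mod_hom \<Z> (zmodule B) D. \<forall>(b, d)\<in>S. g b = d"
  proof (rule divisible_extension[OF zB mD])
    show "\<exists>y\<in>carrier D. n \<odot>\<^bsub>D\<^esub> y = x" if "n > 0" "x \<in> carrier D" for n x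
      using D that unfolding divisible_def by blast
    show "S \<subseteq> carrier (zmodule B) \<times> carrier D"
      using mod_homD(1)[OF jz] mod_homD(1)[OF e] by (auto simp: S_def)
    show "S \<noteq> {}" using A.M.zero_closed by (auto simp: S_def)
    show "(b \<oplus>\<^bsub>zmodule B\<^esub> b', d \<oplus>\<^bsub>D\<^esub> d') \<in> S" if bd: "(b, d) \<in> S" "(b', d') \<in> S" for b d b' d'
    proof -
      obtain a a' where a: "a \<in> carrier A" "b = j a" "d = e a" "a' \<in> carrier A" "b' = j a'" "d' = e a'"
        using bd by (auto simp: S_def)
      have "(b \<oplus>\<^bsub>zmodule B\<^esub> b', d \<oplus>\<^bsub>D\<^esub> d') = (j (a \<oplus>\<^bsub>A\<^esub> a'), e (a \<oplus>\<^bsub>A\<^esub> a'))"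
        using a mod_homD(2)[OF jz] mod_homD(2)[OF e] by simp
      then show ?thesis using a by (auto simp: S_def)
    qed
    show "(n \<odot>\<^bsub>zmodule B\<^esub> b, n \<odot>\<^bsub>D\<^esub> d) \<in> S" if bd: "(b, d) \<in> S" for n b d
    proof -
      obtain a where a: "a \<in> carrier A" "b = j a" "d = e a"
        using bd by (auto simp: S_def)
      have "(n \<odot>\<^bsub>zmodule B\<^esub> b, n \<odot>\<^bsub>D\<^esub> d) = (j (n \<odot>\<^bsub>zmodule A\<^esub> a), e (n \<odot>\<^bsub>zmodule A\<^esub> a))"
        using a mod_homD(3)[OF jz int_Zcarr] mod_homD(3)[OF e int_Zcarr] by simp
      moreover have "n \<odot>\<^bsub>zmodule A\<^esub> a \<in> carrier A"
        using module.smult_closed[OF zA int_Zcarr, of a n] a by simp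
      ultimately show ?thesis by (auto simp: S_def)
    qed
    show "d = \<zero>\<^bsub>D\<^esub>" if d: "(\<zero>\<^bsub>zmodule B\<^esub>, d) \<in> S" for d
    proof -
      obtain a where a: "a \<in> carrier A" "\<zero>\<^bsub>B\<^esub> = j a" "d = e a" using d by (auto simp: S_def)
      have "a = \<zero>\<^bsub>A\<^esub>"
        using inj_onD[OF j(2), of a "\<zero>\<^bsub>A\<^esub>"] mod_hom_zero[OF A B j(1)] a by simp
      then show ?thesis using mod_hom_zero[OF zA mD e] a by simp
    qed
  qed
  then obtain g where g: "g \<in> mod_hom \<Z> (zmodule B) D" "\<And>x. x \<in> carrier A \<Longrightarrow> g (j x) = e x"
    unfolding S_def by auto
  have g': "g b \<in> carrier D" "b' \<in> carrier B \<Longrightarrow> g (b \<oplus>\<^bsub>B\<^esub> b') = g b \<oplus>\<^bsub>D\<^esub> g b'" if "b \<in> carrier B" for b b'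
    using mod_homD(1,2)[OF g(1)] that by auto
  define h where "h b = (\<lambda>r\<in>carrier R. g (r \<odot>\<^bsub>B\<^esub> b))" for b
  have h: "h \<in> mod_hom R B (coinduced R D)"
  proof (rule mod_homI)
    show "h b \<in> carrier (coinduced R D)" if "b \<in> carrier B" for b
      using that g' by (auto simp: h_def coinduced_simps B.smult_l_distr)
    show "h (b \<oplus>\<^bsub>B\<^esub> b') = h b \<oplus>\<^bsub>coinduced R D\<^esub> h b'" if "b \<in> carrier B" "b' \<in> carrier B" for b b'
      unfolding h_def coinduced_simps(3) by (rule restrict_ext) (use that g' in \<open>simp add: B.smult_r_distr\<close>)
    show "h (r \<odot>\<^bsub>B\<^esub> b) = r \<odot>\<^bsub>coinduced R D\<^esub> h b" if "r \<in> carrier R" "b \<in> carrier B" for r b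
      unfolding h_def coinduced_simps(4) by (rule restrict_ext) (use that in \<open>simp add: B.smult_assoc1\<close>)
  qed
  have "h (j x) = f x" if x: "x \<in> carrier A" for x
  proof (rule coinduced_eqI)
    show "h (j x) \<in> carrier (coinduced R D)" using mod_homD(1)[OF h mod_homD(1)[OF j(1) x]] .
    show "f x \<in> carrier (coinduced R D)" by (rule f_cl[OF x])
    fix r assume r: "r \<in> carrier R"
    have "h (j x) r = g (j (r \<odot>\<^bsub>A\<^esub> x))" using r x by (simp add: h_def mod_homD(3)[OF j(1)])
    also have "\<dots> = f x r" using r x mod_homD(3)[OF f] by (simp add: g(2) e_def coinduced_simps(4))
    finally show "h (j x) r = f x r" .
  qed
  then show ?thesis using h by blast
qed

subsection \<open>Construction of the resolution\<close>

lemma injective_embedding: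
  fixes R :: "('r, 'k) ring_scheme" and X :: "('r, ('r, 'm) inj_type) module"
  assumes X: "module R X"
  shows "\<exists>(E :: ('r, ('r, 'm) inj_type) module) \<epsilon>.
    injective_module R E \<and> \<epsilon> \<in> mod_hom R X E \<and> inj_on \<epsilon> (carrier X)"
proof -
  interpret X: module R X by fact
  obtain D :: "(int, (rat \<times> ('r, 'm) inj_type) list) module" and i where
    D: "divisible D" and i: "i \<in> carrier X \<rightarrow> carrier D"
      "\<And>x y. x \<in> carrier X \<Longrightarrow> y \<in> carrier X \<Longrightarrow> i (x \<oplus>\<^bsub>X\<^esub> y) = i x \<oplus>\<^bsub>D\<^esub> i y" "inj_on i (carrier X)"
    using divisible_embedding[OF X.M.abelian_group_axioms] by blast
  have aD: "abelian_group D" using D by (simp add: divisible_def module_def)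
  let ?J = "coinduced R D"
  have mJ: "module R ?J" by (rule coinduced_module[OF X.R.is_cring aD])
  define h :: "('r \<Rightarrow> (rat \<times> ('r, 'm) inj_type) list) \<Rightarrow> ('r, 'm) inj_type"
    where "h \<phi> = Fun_On (\<lambda>r. Formal_Sum (\<phi> r))" for \<phi>
  have h: "inj_on h (carrier ?J)" by (rule inj_onI) (auto simp: h_def fun_eq_iff)
  note t = transport_facts[OF mJ h]
  let ?E = "transport h ?J"
  have "injective_module R ?E"
    unfolding injective_module_def
  proof (intro conjI allI impI; (elim conjE)?)
    show "module R ?E" by (rule t)
    fix A B :: "('r, 'r + ('r, 'm) inj_type) module" and j f
    assume *: "module R A" "module R B" "j \<in> mod_hom R A B" "inj_on j (carrier A)" "f \<in> mod_hom R A ?E"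
    obtain g where g: "g \<in> mod_hom R B ?J" "\<forall>x\<in>carrier A. g (j x) = inv_into (carrier ?J) h (f x)"
      using coinduced_lifting[OF X.R.is_cring D *(1-4) mod_hom_compose[OF *(5) t(4)]] by blast
    show "\<exists>g\<in>mod_hom R B ?E. \<forall>x\<in>carrier A. g (j x) = f x"
    proof (rule bexI[OF _ mod_hom_compose[OF g(1) t(2)]], rule ballI)
      fix x assume x: "x \<in> carrier A"
      show "h (g (j x)) = f x"
        using g(2) x mod_homD(1)[OF *(5) x] by (simp add: t(3) f_inv_into_f)
    qed
  qed
  moreover
  define \<epsilon> where "\<epsilon> x = (\<lambda>r\<in>carrier R. i (r \<odot>\<^bsub>X\<^esub> x))" for x
  have \<epsilon>: "\<epsilon> \<in> mod_hom R X ?J"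
  proof (rule mod_homI)
    show "\<epsilon> x \<in> carrier ?J" if "x \<in> carrier X" for x
      using that i(1,2) by (auto simp: \<epsilon>_def coinduced_simps X.smult_l_distr)
    show "\<epsilon> (x \<oplus>\<^bsub>X\<^esub> y) = \<epsilon> x \<oplus>\<^bsub>?J\<^esub> \<epsilon> y" if "x \<in> carrier X" "y \<in> carrier X" for x y
      unfolding \<epsilon>_def coinduced_simps(3) by (rule restrict_ext) (use that i(2) in \<open>simp add: X.smult_r_distr\<close>)
    show "\<epsilon> (r \<odot>\<^bsub>X\<^esub> x) = r \<odot>\<^bsub>?J\<^esub> \<epsilon> x" if "r \<in> carrier R" "x \<in> carrier X" for r x
      unfolding \<epsilon>_def coinduced_simps(4) by (rule restrict_ext) (use that in \<open>simp add: X.smult_assoc1\<close>)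
  qed
  have "(\<lambda>x. h (\<epsilon> x)) \<in> mod_hom R X ?E" by (rule mod_hom_compose[OF \<epsilon> t(2)])
  moreover have "inj_on (\<lambda>x. h (\<epsilon> x)) (carrier X)"
  proof (rule inj_onI)
    fix x y assume xy: "x \<in> carrier X" "y \<in> carrier X" "h (\<epsilon> x) = h (\<epsilon> y)"
    then have "\<epsilon> x = \<epsilon> y" using inj_onD[OF h] mod_homD(1)[OF \<epsilon>] by blast
    then have "\<epsilon> x \<one>\<^bsub>R\<^esub> = \<epsilon> y \<one>\<^bsub>R\<^esub>" by simp
    then show "x = y" using xy inj_onD[OF i(3)] by (simp add: \<epsilon>_def)
  qed
  ultimately show ?thesis by blast
qed

lemma injective_cokernel:
  fixes R :: "('r, 'k) ring_scheme" and X :: "('r, ('r, 'm) inj_type) module"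
  assumes X: "module R X"
  shows "\<exists>(E :: ('r, ('r, 'm) inj_type) module) \<epsilon> (Y :: ('r, ('r, 'm) inj_type) module) \<pi>.
    injective_module R E \<and> \<epsilon> \<in> mod_hom R X E \<and> inj_on \<epsilon> (carrier X) \<and> module R Y \<and>
    \<pi> \<in> mod_hom R E Y \<and> \<pi> ` carrier E = carrier Y \<and> a_kernel E Y \<pi> = \<epsilon> ` carrier X"
proof -
  obtain E :: "('r, ('r, 'm) inj_type) module" and \<epsilon> where
    E: "injective_module R E" and \<epsilon>: "\<epsilon> \<in> mod_hom R X E" "inj_on \<epsilon> (carrier X)"
    using injective_embedding[OF X] by blast
  have mE: "module R E" using E by (simp add: injective_module_def)
  let ?N = "\<epsilon> ` carrier X"
  have N: "submodule ?N R E" by (rule submodule_image[OF X mE \<epsilon>(1)])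
  let ?Q = "quotient_module E ?N"
  note q = quotient_module_facts[OF mE N]
  define h where "h C = inv_into (carrier E) (\<lambda>x. ?N +>\<^bsub>E\<^esub> x) C" for C
  have h: "inj_on h (carrier ?Q)"
    unfolding h_def q(3) by (rule inj_on_inv_into) simp
  note t = transport_facts[OF q(1) h]
  interpret Q: module R ?Q by (rule q(1))
  have hz: "h C = h \<zero>\<^bsub>?Q\<^esub> \<longleftrightarrow> C = \<zero>\<^bsub>?Q\<^esub>" if "C \<in> carrier ?Q" for C
    using inj_onD[OF h _ that Q.M.zero_closed] by blast
  define \<pi> where "\<pi> x = h (?N +>\<^bsub>E\<^esub> x)" for x
  have "\<pi> \<in> mod_hom R E (transport h ?Q)"
    using mod_hom_compose[OF q(2) t(2)] by (simp add: \<pi>_def[abs_def])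
  moreover have "\<pi> ` carrier E = carrier (transport h ?Q)"
    unfolding t(3) q(3) \<pi>_def by (simp add: image_image)
  moreover have "a_kernel E (transport h ?Q) \<pi> = ?N"
  proof -
    have "\<zero>\<^bsub>transport h ?Q\<^esub> = h \<zero>\<^bsub>?Q\<^esub>" using mod_hom_zero[OF q(1) t(1,2)] by simp
    then show ?thesis
      using hz mod_homD(1)[OF q(2)] q(4) unfolding \<pi>_def
      by (auto simp: a_kernel_iff mod_homD(1)[OF \<epsilon>(1)])
  qed
  ultimately show ?thesis using E \<epsilon> t(1) by blast
qed

theorem injective_resolution_exists:
  fixes R :: "('r, 'k) ring_scheme" and M :: "('r, 'm) module"
  assumes M: "module R M"
  shows "\<exists>(I :: nat \<Rightarrow> ('r, ('r, 'm) inj_type) module) \<epsilon> d. injective_resolution R M I \<epsilon> d"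
proof -
  have "inj_on (Base :: 'm \<Rightarrow> ('r, 'm) inj_type) (carrier M)" by (rule inj_onI) simp
  note t = transport_facts[OF M this]
  let ?P = "\<lambda>X (E :: ('r, ('r, 'm) inj_type) module) \<epsilon> (Y :: ('r, ('r, 'm) inj_type) module) \<pi>.
    injective_module R E \<and> \<epsilon> \<in> mod_hom R X E \<and> inj_on \<epsilon> (carrier X) \<and> module R Y \<and>
    \<pi> \<in> mod_hom R E Y \<and> \<pi> ` carrier E = carrier Y \<and> a_kernel E Y \<pi> = \<epsilon> ` carrier X"
  have "\<forall>X :: ('r, ('r, 'm) inj_type) module. \<exists>E \<epsilon> Y \<pi>. module R X \<longrightarrow> ?P X E \<epsilon> Y \<pi>"
    by (meson injective_cokernel)
  then have "\<exists>E \<epsilon> Y \<pi>. \<forall>X :: ('r, ('r, 'm) inj_type) module. module R X \<longrightarrow> ?P X (E X) (\<epsilon> X) (Y X) (\<pi> X)"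
    unfolding choice_iff .
  then obtain E \<epsilon> Y \<pi>
    where P0: "\<forall>X :: ('r, ('r, 'm) inj_type) module. module R X \<longrightarrow> ?P X (E X) (\<epsilon> X) (Y X) (\<pi> X)"
    by (elim exE) (rule that)
  have P: "?P X (E X) (\<epsilon> X) (Y X) (\<pi> X)" if "module R X" for X :: "('r, ('r, 'm) inj_type) module"
    by (rule mp[OF spec[OF P0, of X] that])
  define X where "X n = (Y ^^ n) (transport Base M)" for n
  have XS: "X (Suc n) = Y (X n)" for n by (simp add: X_def)
  have mX: "module R (X n)" for n
    by (induction n) (use t(1) P in \<open>auto simp: X_def\<close>)
  define I where "I n = E (X n)" for n
  define d where "d n x = \<epsilon> (X (Suc n)) (\<pi> (X n) x)" for n x
  define \<eta> where "\<eta> x = \<epsilon> (X 0) (Base x)" for x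
  have X0: "carrier (X 0) = Base ` carrier M" by (simp add: X_def t(3))
  have mE: "module R (E (X n))" for n using P[OF mX] unfolding injective_module_def by blast
  have ker: "a_kernel (I n) (I (Suc n)) (d n) = \<epsilon> (X n) ` carrier (X n)" for n
  proof -
    have z: "\<epsilon> (X (Suc n)) y = \<zero>\<^bsub>E (X (Suc n))\<^esub> \<longleftrightarrow> y = \<zero>\<^bsub>X (Suc n)\<^esub>" if y: "y \<in> carrier (X (Suc n))" for y
    proof -
      interpret XS: module R "X (Suc n)" by (rule mX)
      have p: "\<epsilon> (X (Suc n)) \<in> mod_hom R (X (Suc n)) (E (X (Suc n)))"
        "inj_on (\<epsilon> (X (Suc n))) (carrier (X (Suc n)))" using P[OF mX[of "Suc n"]] by blast+
      show ?thesis
        using mod_hom_zero[OF mX mE p(1)] inj_onD[OF p(2) _ y XS.M.zero_closed] by auto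
    qed
    have pc: "\<pi> (X n) x \<in> carrier (X (Suc n))" if "x \<in> carrier (I n)" for x
      using P[OF mX[of n]] that unfolding XS I_def by (auto dest: mod_homD(1))
    have "a_kernel (I n) (I (Suc n)) (d n) = a_kernel (E (X n)) (Y (X n)) (\<pi> (X n))"
    proof (rule Set.set_eqI)
      fix x
      show "x \<in> a_kernel (I n) (I (Suc n)) (d n) \<longleftrightarrow> x \<in> a_kernel (E (X n)) (Y (X n)) (\<pi> (X n))"
        using z[OF pc, of x] unfolding a_kernel_iff d_def I_def XS by blast
    qed
    then show ?thesis using P[OF mX[of n]] by simp
  qed
  have "injective_resolution R M I \<eta> d"
    unfolding injective_resolution_def
  proof (intro conjI allI)
    show "injective_module R (I n)" for n using P[OF mX] unfolding I_def by blast
    have \<epsilon>0: "\<epsilon> (X 0) \<in> mod_hom R (transport Base M) (I 0)" "inj_on (\<epsilon> (X 0)) (carrier (X 0))"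
      using P[OF mX[of 0]] by (auto simp: I_def X_def)
    show "\<eta> \<in> mod_hom R M (I 0)"
      using mod_hom_compose[OF t(2) \<epsilon>0(1)] by (simp add: \<eta>_def[abs_def])
    show "inj_on \<eta> (carrier M)"
      using \<epsilon>0(2) unfolding X0 by (auto simp: inj_on_def \<eta>_def)
    show "d n \<in> mod_hom R (I n) (I (Suc n))" for n
    proof -
      have "\<pi> (X n) \<in> mod_hom R (I n) (X (Suc n))" using P[OF mX[of n]] by (simp add: I_def XS)
      moreover have "\<epsilon> (X (Suc n)) \<in> mod_hom R (X (Suc n)) (I (Suc n))"
        using P[OF mX[of "Suc n"]] by (simp add: I_def)
      ultimately show ?thesis using mod_hom_compose by (fastforce simp: d_def[abs_def])
    qed
    show "\<eta> ` carrier M = a_kernel (I 0) (I 1) (d 0)"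
      using ker[of 0] by (simp add: X0 \<eta>_def image_image)
    show "d n ` carrier (I n) = a_kernel (I (Suc n)) (I (Suc (Suc n))) (d (Suc n))" for n
    proof -
      have "\<pi> (X n) ` carrier (I n) = carrier (X (Suc n))" using P[OF mX[of n]] by (simp add: I_def XS)
      then have "d n ` carrier (I n) = \<epsilon> (X (Suc n)) ` carrier (X (Suc n))"
        unfolding d_def by (metis image_image)
      then show ?thesis using ker[of "Suc n"] by simp
    qed
  qed
  then show ?thesis by blast
qed

theorem chosen_injective_resolution:
  assumes "module R M" "chosen_injective_resolution R M = (I, d)"
  shows "\<exists>\<epsilon>. injective_resolution R M I \<epsilon> d"
proof -
  have "\<exists>p. case p of (I, d) \<Rightarrow> \<exists>\<epsilon>. injective_resolution R M
      (I :: nat \<Rightarrow> ('a, ('a, 'c) inj_type) module) \<epsilon> d"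
    using injective_resolution_exists[OF assms(1)] by auto
  from someI_ex[OF this] show ?thesis
    using assms(2) unfolding chosen_injective_resolution_def by simp
qed

end

(*
  Write E^j(X) for Ext^j(R/a, X) and G for the a-torsion functor, and let I be an injective resolution
  of M. Put K^n = ker(I^n -> I^(n+1)), J^n = G(I^n), Z^n = ker(J^n -> J^(n+1)) = G(K^n),
  B^n = im(J^(n-1) -> J^n) and H^n = Z^n/B^n. Instead of the Grothendieck spectral sequence, four
  kinds of short exact sequences suffice.

  Over a Noetherian ring G preserves injectivity, so E^j(I^n) = E^j(J^n) = 0 for j > 0. Induction along
  B^n -> Z^n -> H^n and Z^n -> J^n -> B^(n+1) shows that E^j(B^n) is finitely generated for j > 0 and
  n <= t. Dimension shifting along K^n -> I^n -> K^(n+1) transfers finite generation from E^(t+1)(M) to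
  E^1(K^t). As K^t/Z^t is torsion-free, E^0(K^t/Z^t) = 0, so E^1(Z^t) embeds into E^1(K^t). Finally
  E^1(Z^t) -> E^1(H^t) -> E^2(B^t) is exact.
*)
theory Submission
  imports Defs
begin

section \<open>Submodules and linear relations\<close>

text \<open>The free module of the resolution has infinite rank, so Hom(F, X) is far from finitely
  generated even for small X. Finite generation therefore makes sense only for cocycles modulo
  coboundaries, and it is transferred along fragments of the long exact Ext sequence, each verified
  on cochains. A connecting map is no function on cochains because it depends on a choice of lift;
  hence linear relations take the place of maps.

  A second obstacle is typing: M, the I^n, the coset modules H^n and F have different element types,
  whereas \<open>injective_module\<close> tests lifting in a single type. Baer's criterion removes
  this dependence, and injectives enter only through \<open>baer_module\<close>.

  The degrees are forced. Hom(R/a, J^n) need not be finitely generated, so B^n is controlled in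
  positive degrees only. Passing from B^(n+1) back to B^n raises the degree by one, so all degrees
  are treated at once. The degree t+1 in the hypothesis is 1 plus the t dimension shifts that lead
  from K^0, a copy of M, to K^t.\<close>

lemma (in abelian_group) minus_eq_zero_imp_eq:
  assumes "x \<in> carrier G" "y \<in> carrier G" "x \<ominus> y = \<zero>"
  shows "x = y"
  using assms minus_equality[of x "\<ominus> y"] by (simp add: a_minus_def)

lemma (in abelian_group) minus_add_cancel:
  assumes "x \<in> carrier G" "y \<in> carrier G"
  shows "(x \<ominus> y) \<oplus> y = x"
  using assms by (simp add: a_minus_def a_assoc l_neg)

lemma (in module) smult_minus_one: "x \<in> carrier M \<Longrightarrow> (\<ominus> \<one>) \<odot>\<^bsub>M\<^esub> x = \<ominus>\<^bsub>M\<^esub> x"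
  by (simp add: smult_l_minus)

lemma (in module) submodule_closedI:
  assumes "H \<subseteq> carrier M" "\<zero>\<^bsub>M\<^esub> \<in> H"
    and "\<And>x y. x \<in> H \<Longrightarrow> y \<in> H \<Longrightarrow> x \<oplus>\<^bsub>M\<^esub> y \<in> H"
    and smult: "\<And>r x. r \<in> carrier R \<Longrightarrow> x \<in> H \<Longrightarrow> r \<odot>\<^bsub>M\<^esub> x \<in> H"
  shows "submodule H R M"
proof (rule submoduleI)
  show "\<ominus>\<^bsub>M\<^esub> x \<in> H" if "x \<in> H" for x
    using smult[of "\<ominus> \<one>" x] smult_minus_one[of x] that assms(1) by auto
qed (use assms in auto)

lemma (in module) submoduleD:
  assumes "submodule H R M"
  shows "H \<subseteq> carrier M" "\<zero>\<^bsub>M\<^esub> \<in> H"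
    and "x \<in> H \<Longrightarrow> y \<in> H \<Longrightarrow> x \<oplus>\<^bsub>M\<^esub> y \<in> H"
    and "r \<in> carrier R \<Longrightarrow> x \<in> H \<Longrightarrow> r \<odot>\<^bsub>M\<^esub> x \<in> H"
    and "x \<in> H \<Longrightarrow> y \<in> H \<Longrightarrow> x \<ominus>\<^bsub>M\<^esub> y \<in> H"
  using submoduleE[OF assms] subgroup.one_closed[OF submodule.axioms(1)[OF assms]]
  by (auto simp: a_minus_def)

lemma (in module) submodule_Inter:
  assumes "\<H> \<noteq> {}" "\<And>H. H \<in> \<H> \<Longrightarrow> submodule H R M"
  shows "submodule (\<Inter>\<H>) R M"
proof (rule submodule_closedI)
  show "\<Inter>\<H> \<subseteq> carrier M" using assms submoduleD(1) by blast
qed (use submoduleD(2-4)[OF assms(2)] in auto)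

lemma module_span_props:
  assumes M: "module R M" and "A \<subseteq> carrier M"
  shows "submodule (module_span R M A) R M" "A \<subseteq> module_span R M A"
proof -
  interpret M: module R M by fact
  show "submodule (module_span R M A) R M"
    unfolding module_span_def by (rule M.submodule_Inter) (use assms(2) M.carrier_is_submodule in auto)
  show "A \<subseteq> module_span R M A" unfolding module_span_def by auto
qed

lemma module_span_minimal: "submodule H R M \<Longrightarrow> A \<subseteq> H \<Longrightarrow> module_span R M A \<subseteq> H"
  unfolding module_span_def by auto

lemma submodule_vimage:
  assumes M: "module R M" and "module R N" "f \<in> mod_hom R M N" "submodule H R N"
  shows "submodule {x \<in> carrier M. f x \<in> H} R M"
proof -
  interpret M: module R M by fact
  interpret N: module R N by fact
  show ?thesis
    by (rule M.submodule_closedI)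
      (use mod_homD[OF assms(3)] mod_hom_zero[OF M assms(2,3)] N.submoduleD[OF assms(4)] in auto)
qed

lemma kernel_submodule:
  assumes M: "module R M" and "module R N" "f \<in> mod_hom R M N"
  shows "submodule (a_kernel M N f) R M"
proof -
  interpret M: module R M by fact
  interpret N: module R N by fact
  have "submodule {\<zero>\<^bsub>N\<^esub>} R N" by (rule N.submodule_closedI) auto
  from submodule_vimage[OF M assms(2,3) this] show ?thesis by (simp add: a_kernel_def kernel_def)
qed

text \<open>Isolating the coefficient of one generator is what allows induction on the number of
  generators in \<open>domain_generators\<close>.\<close>

lemma module_span_insert:
  assumes M: "module R M" and "a \<in> carrier M" "X \<subseteq> carrier M" "y \<in> module_span R M (insert a X)"
  shows "\<exists>r\<in>carrier R. \<exists>s\<in>module_span R M X. y = r \<odot>\<^bsub>M\<^esub> a \<oplus>\<^bsub>M\<^esub> s"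
proof -
  interpret M: module R M by fact
  note sp = module_span_props[OF M assms(3)] and sD = M.submoduleD[OF module_span_props(1)[OF M assms(3)]]
  let ?H = "{r \<odot>\<^bsub>M\<^esub> a \<oplus>\<^bsub>M\<^esub> s | r s. r \<in> carrier R \<and> s \<in> module_span R M X}"
  have H: "submodule ?H R M"
  proof (rule M.submodule_closedI)
    show "?H \<subseteq> carrier M" using sD(1) assms(2) by auto
    show "\<zero>\<^bsub>M\<^esub> \<in> ?H"
      using sD(2) assms(2) by (auto intro!: exI[of _ "\<zero>\<^bsub>R\<^esub>"] exI[of _ "\<zero>\<^bsub>M\<^esub>"])
  next
    fix x y assume "x \<in> ?H" "y \<in> ?H"
    then obtain r s r' s' where *: "x = r \<odot>\<^bsub>M\<^esub> a \<oplus>\<^bsub>M\<^esub> s" "y = r' \<odot>\<^bsub>M\<^esub> a \<oplus>\<^bsub>M\<^esub> s'" "r \<in> carrier R" "r' \<in> carrier R"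
      "s \<in> module_span R M X" "s' \<in> module_span R M X" by blast
    moreover have "s \<in> carrier M" "s' \<in> carrier M" using * sD(1) by auto
    ultimately have "x \<oplus>\<^bsub>M\<^esub> y = (r \<oplus>\<^bsub>R\<^esub> r') \<odot>\<^bsub>M\<^esub> a \<oplus>\<^bsub>M\<^esub> (s \<oplus>\<^bsub>M\<^esub> s')"
      using assms(2) by (simp add: M.smult_l_distr M.M.a_ac)
    then show "x \<oplus>\<^bsub>M\<^esub> y \<in> ?H" using * sD(3) by blast
  next
    fix t x assume t: "t \<in> carrier R" and "x \<in> ?H"
    then obtain r s where *: "x = r \<odot>\<^bsub>M\<^esub> a \<oplus>\<^bsub>M\<^esub> s" "r \<in> carrier R" "s \<in> module_span R M X" by blast
    moreover have "s \<in> carrier M" using * sD(1) by auto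
    ultimately have "t \<odot>\<^bsub>M\<^esub> x = (t \<otimes>\<^bsub>R\<^esub> r) \<odot>\<^bsub>M\<^esub> a \<oplus>\<^bsub>M\<^esub> t \<odot>\<^bsub>M\<^esub> s"
      using assms(2) t by (simp add: M.smult_r_distr M.smult_assoc1)
    then show "t \<odot>\<^bsub>M\<^esub> x \<in> ?H" using * t sD(4) by blast
  qed
  have "insert a X \<subseteq> ?H"
  proof
    fix x assume "x \<in> insert a X"
    then consider "x = a" | "x \<in> X" by blast
    then show "x \<in> ?H"
    proof cases
      case 1
      then show ?thesis using assms(2) sD(2) by (auto intro!: exI[of _ "\<one>\<^bsub>R\<^esub>"] exI[of _ "\<zero>\<^bsub>M\<^esub>"])
    next
      case 2
      then show ?thesis using assms(2,3) sp(2) by (auto intro!: exI[of _ "\<zero>\<^bsub>R\<^esub>"] exI[of _ x])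
    qed
  qed
  from module_span_minimal[OF H this] assms(4) show ?thesis by blast
qed

text \<open>A submodule of the product of \<open>M\<close> and \<open>N\<close>. One encoding serves
  three purposes: graphs of linear maps, partial linear maps ordered by inclusion (for Zorn's
  lemma), and the multi-valued connecting map on cochains.\<close>

definition linear_relation :: "('r, 'k) ring_scheme \<Rightarrow> ('r, 'm) module \<Rightarrow> ('r, 'n) module \<Rightarrow> ('m \<times> 'n) set \<Rightarrow> bool"
  where "linear_relation R M N \<rho> \<longleftrightarrow> \<rho> \<subseteq> carrier M \<times> carrier N \<and> (\<zero>\<^bsub>M\<^esub>, \<zero>\<^bsub>N\<^esub>) \<in> \<rho> \<and>
    (\<forall>x y x' y'. (x, y) \<in> \<rho> \<longrightarrow> (x', y') \<in> \<rho> \<longrightarrow> (x \<oplus>\<^bsub>M\<^esub> x', y \<oplus>\<^bsub>N\<^esub> y') \<in> \<rho>) \<and>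
    (\<forall>r\<in>carrier R. \<forall>x y. (x, y) \<in> \<rho> \<longrightarrow> (r \<odot>\<^bsub>M\<^esub> x, r \<odot>\<^bsub>N\<^esub> y) \<in> \<rho>)"

lemma linear_relationI:
  assumes "\<And>x y. (x, y) \<in> \<rho> \<Longrightarrow> x \<in> carrier M \<and> y \<in> carrier N" "(\<zero>\<^bsub>M\<^esub>, \<zero>\<^bsub>N\<^esub>) \<in> \<rho>"
    and "\<And>x y x' y'. (x, y) \<in> \<rho> \<Longrightarrow> (x', y') \<in> \<rho> \<Longrightarrow> (x \<oplus>\<^bsub>M\<^esub> x', y \<oplus>\<^bsub>N\<^esub> y') \<in> \<rho>"
    and "\<And>r x y. r \<in> carrier R \<Longrightarrow> (x, y) \<in> \<rho> \<Longrightarrow> (r \<odot>\<^bsub>M\<^esub> x, r \<odot>\<^bsub>N\<^esub> y) \<in> \<rho>"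
  shows "linear_relation R M N \<rho>"
  using assms unfolding linear_relation_def by auto

lemma linear_relationD:
  assumes "linear_relation R M N \<rho>"
  shows "(x, y) \<in> \<rho> \<Longrightarrow> x \<in> carrier M" "(x, y) \<in> \<rho> \<Longrightarrow> y \<in> carrier N"
    and "(\<zero>\<^bsub>M\<^esub>, \<zero>\<^bsub>N\<^esub>) \<in> \<rho>"
    and "(x, y) \<in> \<rho> \<Longrightarrow> (x', y') \<in> \<rho> \<Longrightarrow> (x \<oplus>\<^bsub>M\<^esub> x', y \<oplus>\<^bsub>N\<^esub> y') \<in> \<rho>"
    and "r \<in> carrier R \<Longrightarrow> (x, y) \<in> \<rho> \<Longrightarrow> (r \<odot>\<^bsub>M\<^esub> x, r \<odot>\<^bsub>N\<^esub> y) \<in> \<rho>"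
  using assms unfolding linear_relation_def by auto

lemma linear_relation_diff:
  assumes "module R M" "module R N" "linear_relation R M N \<rho>" "(x, y) \<in> \<rho>" "(x', y') \<in> \<rho>"
  shows "(x \<ominus>\<^bsub>M\<^esub> x', y \<ominus>\<^bsub>N\<^esub> y') \<in> \<rho>"
proof -
  interpret M: module R M by fact
  interpret N: module R N by fact
  note D = linear_relationD[OF assms(3)]
  have "((\<ominus>\<^bsub>R\<^esub> \<one>\<^bsub>R\<^esub>) \<odot>\<^bsub>M\<^esub> x', (\<ominus>\<^bsub>R\<^esub> \<one>\<^bsub>R\<^esub>) \<odot>\<^bsub>N\<^esub> y') \<in> \<rho>" by (rule D(5)) (use assms in auto)
  then show ?thesis
    using D(4)[OF assms(4)] D(1,2)[OF assms(5)]
    by (simp add: M.smult_minus_one N.smult_minus_one a_minus_def)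
qed

text \<open>Two values of \<open>x\<close> differ by a value of zero, so being the graph of a
  partial linear map is a condition at zero alone.\<close>

lemma linear_relation_single_valued:
  assumes "module R M" "module R N" "linear_relation R M N \<rho>"
    and "\<And>y. (\<zero>\<^bsub>M\<^esub>, y) \<in> \<rho> \<Longrightarrow> y = \<zero>\<^bsub>N\<^esub>" "(x, y) \<in> \<rho>" "(x, y') \<in> \<rho>"
  shows "y = y'"
proof -
  interpret M: module R M by fact
  interpret N: module R N by fact
  note D = linear_relationD[OF assms(3)]
  have "y \<ominus>\<^bsub>N\<^esub> y' = \<zero>\<^bsub>N\<^esub>"
    using linear_relation_diff[OF assms(1-3,5,6)] assms(4) D(1)[OF assms(5)]
    by (simp add: a_minus_def M.r_neg)
  then show ?thesis using D(2)[OF assms(5)] D(2)[OF assms(6)] N.M.minus_eq_zero_imp_eq by blast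
qed

section \<open>Finite generation modulo a submodule\<close>

lemma (in cring) cring_idealI:
  assumes "I \<subseteq> carrier R" "\<zero> \<in> I" "\<And>x y. x \<in> I \<Longrightarrow> y \<in> I \<Longrightarrow> x \<oplus> y \<in> I"
    and l: "\<And>r x. r \<in> carrier R \<Longrightarrow> x \<in> I \<Longrightarrow> r \<otimes> x \<in> I"
  shows "ideal I R"
proof (rule idealI[OF ring_axioms])
  show "subgroup I (add_monoid R)"
  proof (rule add.subgroupI)
    show "\<ominus> x \<in> I" if "x \<in> I" for x
      using l[of "\<ominus> \<one>" x] that assms(1) l_minus[of \<one> x] by auto
  qed (use assms in auto)
  show "x \<otimes> a \<in> I" if "a \<in> I" "x \<in> carrier R" for a x using l that by auto
  then show "a \<otimes> x \<in> I" if "a \<in> I" "x \<in> carrier R" for a x using m_comm[of a x] that assms(1) by auto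
qed

text \<open>For submodules \<open>B\<close> of \<open>Z\<close> this is finite generation of Z/B
  (see \<open>fg_module_quotient_iff\<close>), phrased without cosets so that cocycles can be
  handled directly. The test submodules \<open>H\<close> range over all of \<open>M\<close> and need
  not lie in \<open>Z\<close>.\<close>

definition fg_modulo :: "('r, 'k) ring_scheme \<Rightarrow> ('r, 'm) module \<Rightarrow> 'm set \<Rightarrow> 'm set \<Rightarrow> bool"
  where "fg_modulo R M Z B \<longleftrightarrow> (\<exists>A. finite A \<and> A \<subseteq> Z \<and>
    (\<forall>H. submodule H R M \<and> A \<subseteq> H \<and> B \<subseteq> H \<longrightarrow> Z \<subseteq> H))"

lemma fg_modulo_self: "Z \<subseteq> B \<Longrightarrow> fg_modulo R M Z B"
  unfolding fg_modulo_def by (rule exI[of _ "{}"]) auto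

text \<open>The Noetherian core: a submodule of a finitely generated module is finitely generated,
  pulled back along a relation and taken modulo \<open>B\<close>. As for Hilbert's basis theorem,
  the coefficients that the values of \<rho> can have at a new generator form a finitely generated
  ideal. Finitely many elements realise its generators; correcting by them leaves values that avoid
  this generator, and the induction hypothesis covers those.\<close>

lemma domain_generators:
  assumes noeth: "noetherian_ring R" and Q: "module R Q" and S: "module R S" and B: "submodule B R S"
    and "finite A" "A \<subseteq> carrier S" "linear_relation R Q S \<rho>" "Range \<rho> \<subseteq> module_span R S (A \<union> B)"
  shows "\<exists>A'. finite A' \<and> A' \<subseteq> Domain \<rho> \<and>
    (\<forall>H. submodule H R Q \<and> A' \<subseteq> H \<and> {x. \<exists>y\<in>B. (x, y) \<in> \<rho>} \<subseteq> H \<longrightarrow> Domain \<rho> \<subseteq> H)"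
  using assms(5-)
proof (induction A arbitrary: \<rho>)
  case empty
  have "Range \<rho> \<subseteq> B" using empty.prems(3) module_span_minimal[OF B order_refl] by auto
  then show ?case by (intro exI[of _ "{}"]) blast
next
  case (insert a A)
  interpret Q: module R Q by fact
  interpret S: module R S by fact
  interpret noetherian_ring R by fact
  let ?T = "module_span R S (A \<union> B)"
  have AB: "A \<union> B \<subseteq> carrier S" and a: "a \<in> carrier S" using insert.prems(1) S.submoduleD(1)[OF B] by auto
  note sD = S.submoduleD[OF module_span_props(1)[OF S AB]]
  note D = linear_relationD[OF insert.prems(2)]
  \<comment> \<open>A coefficient of \<open>z\<close> at \<open>a\<close> is not unique, since both
    the value of \<open>z\<close> and its expansion may vary; hence a relation instead of a
    function.\<close>
  define coef where "coef z r \<longleftrightarrow> r \<in> carrier R \<and> (\<exists>w. (z, w) \<in> \<rho> \<and> (\<exists>s\<in>?T. w = r \<odot>\<^bsub>S\<^esub> a \<oplus>\<^bsub>S\<^esub> s))" for z r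
  have coef_add: "coef (z \<oplus>\<^bsub>Q\<^esub> z') (r \<oplus>\<^bsub>R\<^esub> r')" if "coef z r" "coef z' r'" for z z' r r'
  proof -
    obtain s s' where *: "(z, r \<odot>\<^bsub>S\<^esub> a \<oplus>\<^bsub>S\<^esub> s) \<in> \<rho>" "(z', r' \<odot>\<^bsub>S\<^esub> a \<oplus>\<^bsub>S\<^esub> s') \<in> \<rho>" "s \<in> ?T" "s' \<in> ?T"
      and r: "r \<in> carrier R" "r' \<in> carrier R" using \<open>coef z r\<close> \<open>coef z' r'\<close> unfolding coef_def by blast
    have c: "s \<in> carrier S" "s' \<in> carrier S" using *(3,4) sD(1) by auto
    have "(r \<odot>\<^bsub>S\<^esub> a \<oplus>\<^bsub>S\<^esub> s) \<oplus>\<^bsub>S\<^esub> (r' \<odot>\<^bsub>S\<^esub> a \<oplus>\<^bsub>S\<^esub> s') = (r \<oplus>\<^bsub>R\<^esub> r') \<odot>\<^bsub>S\<^esub> a \<oplus>\<^bsub>S\<^esub> (s \<oplus>\<^bsub>S\<^esub> s')"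
      using a r c by (simp add: S.smult_l_distr S.M.a_ac)
    then show ?thesis unfolding coef_def using D(4)[OF *(1,2)] sD(3)[OF *(3,4)] r Q.R.a_closed by metis
  qed
  have coef_smult: "coef (t \<odot>\<^bsub>Q\<^esub> z) (t \<otimes>\<^bsub>R\<^esub> r)" if "coef z r" and t: "t \<in> carrier R" for z r t
  proof -
    obtain s where *: "(z, r \<odot>\<^bsub>S\<^esub> a \<oplus>\<^bsub>S\<^esub> s) \<in> \<rho>" "s \<in> ?T" and r: "r \<in> carrier R"
      using \<open>coef z r\<close> unfolding coef_def by blast
    have "t \<odot>\<^bsub>S\<^esub> (r \<odot>\<^bsub>S\<^esub> a \<oplus>\<^bsub>S\<^esub> s) = (t \<otimes>\<^bsub>R\<^esub> r) \<odot>\<^bsub>S\<^esub> a \<oplus>\<^bsub>S\<^esub> t \<odot>\<^bsub>S\<^esub> s"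
      using a r t *(2) sD(1) by (auto simp: S.smult_r_distr S.smult_assoc1)
    then show ?thesis unfolding coef_def using D(5)[OF t *(1)] sD(4)[OF t *(2)] r t Q.R.m_closed by metis
  qed
  have coef_zero: "coef \<zero>\<^bsub>Q\<^esub> \<zero>\<^bsub>R\<^esub>" unfolding coef_def
    using D(3) a sD(2) by (auto intro!: exI[of _ "\<zero>\<^bsub>S\<^esub>"] bexI[of _ "\<zero>\<^bsub>S\<^esub>"])
  have coef_carrier: "z \<in> carrier Q" "r \<in> carrier R" if "coef z r" for z r using that D(1) unfolding coef_def by auto
  have coef_ex: "\<exists>r. coef z r" if z: "z \<in> Domain \<rho>" for z
  proof -
    obtain w where w: "(z, w) \<in> \<rho>" using z by blast
    then have "w \<in> module_span R S (insert a (A \<union> B))" using insert.prems(3) by auto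
    from module_span_insert[OF S a AB this] w show ?thesis unfolding coef_def by blast
  qed
  let ?I = "{r. \<exists>z. coef z r}"
  have "ideal ?I R"
    by (rule Q.R.cring_idealI) (use coef_carrier in blast, use coef_zero in blast, use coef_add in blast, use coef_smult in blast)
  then obtain G where G: "G \<subseteq> carrier R" "finite G" "?I = Idl\<^bsub>R\<^esub> G" using finetely_gen by blast
  have "\<forall>g\<in>G. \<exists>z. coef z g" using Q.R.genideal_self[OF G(1)] G(3) by blast
  then obtain \<zeta> where \<zeta>: "\<And>g. g \<in> G \<Longrightarrow> coef (\<zeta> g) g" by metis
  \<comment> \<open>The part of \<rho> whose values can be written without \<open>a\<close>; the
    induction hypothesis applies to it.\<close>
  let ?\<rho> = "\<rho> \<inter> (carrier Q \<times> ?T)"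
  have lin: "linear_relation R Q S ?\<rho>"
    by (rule linear_relationI) (use D sD(2,3,4) in auto)
  have AS: "A \<subseteq> carrier S" and ran: "Range ?\<rho> \<subseteq> ?T" using AB by auto
  from insert.IH[OF AS lin ran] obtain A' where A': "finite A'" "A' \<subseteq> Domain ?\<rho>"
    "\<And>H. submodule H R Q \<Longrightarrow> A' \<subseteq> H \<Longrightarrow> {x. \<exists>y\<in>B. (x, y) \<in> ?\<rho>} \<subseteq> H \<Longrightarrow> Domain ?\<rho> \<subseteq> H" by auto
  show ?case
  proof (intro exI[of _ "A' \<union> \<zeta> ` G"] conjI allI impI)
    show "finite (A' \<union> \<zeta> ` G)" using A'(1) G(2) by simp
    show "A' \<union> \<zeta> ` G \<subseteq> Domain \<rho>" using A'(2) \<zeta> unfolding coef_def by blast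
    fix H assume "submodule H R Q \<and> A' \<union> \<zeta> ` G \<subseteq> H \<and> {x. \<exists>y\<in>B. (x, y) \<in> \<rho>} \<subseteq> H"
    then have H: "submodule H R Q" "A' \<subseteq> H" "\<zeta> ` G \<subseteq> H" "{x. \<exists>y\<in>B. (x, y) \<in> \<rho>} \<subseteq> H" by auto
    note HD = Q.submoduleD[OF H(1)]
    have H0: "Domain ?\<rho> \<subseteq> H" using A'(3)[OF H(1,2)] H(4) by auto
    \<comment> \<open>The coefficients attained inside \<open>H\<close> form an ideal containing the
      generators \<open>G\<close>, so every coefficient is attained inside \<open>H\<close>.\<close>
    have "ideal {r. \<exists>z\<in>H. coef z r} R"
    proof (rule Q.R.cring_idealI)
      show "\<zero>\<^bsub>R\<^esub> \<in> {r. \<exists>z\<in>H. coef z r}" using coef_zero HD(2) by blast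
      show "x \<oplus>\<^bsub>R\<^esub> y \<in> {r. \<exists>z\<in>H. coef z r}"
        if "x \<in> {r. \<exists>z\<in>H. coef z r}" "y \<in> {r. \<exists>z\<in>H. coef z r}" for x y
        using that coef_add HD(3) by blast
      show "r \<otimes>\<^bsub>R\<^esub> x \<in> {r. \<exists>z\<in>H. coef z r}" if "r \<in> carrier R" "x \<in> {r. \<exists>z\<in>H. coef z r}" for r x
        using that coef_smult HD(4) by blast
    qed (use coef_carrier in blast)
    then have IH: "?I \<subseteq> {r. \<exists>z\<in>H. coef z r}"
      unfolding G(3) by (rule Q.R.genideal_minimal) (use \<zeta> H(3) in blast)
    show "Domain \<rho> \<subseteq> H"
    proof
      fix z assume z: "z \<in> Domain \<rho>"
      obtain r where r: "coef z r" using coef_ex[OF z] by blast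
      \<comment> \<open>Since \<open>z\<close> and \<open>z'\<close> share the coefficient
        \<open>r\<close>, the terms in \<open>a\<close> cancel in the difference of their values,
        and z - z' lies in the domain of the smaller relation.\<close>
      then obtain z' where z': "z' \<in> H" "coef z' r" using IH by blast
      obtain s s' where *: "(z, r \<odot>\<^bsub>S\<^esub> a \<oplus>\<^bsub>S\<^esub> s) \<in> \<rho>" "(z', r \<odot>\<^bsub>S\<^esub> a \<oplus>\<^bsub>S\<^esub> s') \<in> \<rho>" "s \<in> ?T" "s' \<in> ?T"
        and rc: "r \<in> carrier R" using r z'(2) unfolding coef_def by blast
      have c: "s \<in> carrier S" "s' \<in> carrier S" "r \<odot>\<^bsub>S\<^esub> a \<in> carrier S" using *(3,4) sD(1) rc a by auto
      have "(r \<odot>\<^bsub>S\<^esub> a \<oplus>\<^bsub>S\<^esub> s) \<ominus>\<^bsub>S\<^esub> (r \<odot>\<^bsub>S\<^esub> a \<oplus>\<^bsub>S\<^esub> s')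
          = (r \<odot>\<^bsub>S\<^esub> a \<oplus>\<^bsub>S\<^esub> \<ominus>\<^bsub>S\<^esub> (r \<odot>\<^bsub>S\<^esub> a)) \<oplus>\<^bsub>S\<^esub> (s \<oplus>\<^bsub>S\<^esub> \<ominus>\<^bsub>S\<^esub> s')"
        using c by (simp add: a_minus_def S.M.minus_add S.M.a_ac del: S.M.r_neg)
      also have "\<dots> = s \<ominus>\<^bsub>S\<^esub> s'" using c by (simp add: S.M.r_neg a_minus_def)
      finally have "(z \<ominus>\<^bsub>Q\<^esub> z', s \<ominus>\<^bsub>S\<^esub> s') \<in> \<rho>"
        using linear_relation_diff[OF Q S insert.prems(2) *(1,2)] by simp
      then have "(z \<ominus>\<^bsub>Q\<^esub> z', s \<ominus>\<^bsub>S\<^esub> s') \<in> ?\<rho>" using sD(5)[OF *(3,4)] D(1) by auto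
      then have "(z \<ominus>\<^bsub>Q\<^esub> z') \<oplus>\<^bsub>Q\<^esub> z' \<in> H" using H0 z'(1) HD(3) by blast
      then show "z \<in> H" using D(1)[OF *(1)] D(1)[OF *(2)] by (simp add: Q.M.minus_add_cancel)
    qed
  qed
qed

text \<open>A linear relation \<open>\<rho>\<close> is allowed in place of a map, so that this covers connecting maps.\<close>

lemma fg_modulo_exact:
  assumes noeth: "noetherian_ring R" and P: "module R P" and Q: "module R Q" and S: "module R S"
    and fg: "fg_modulo R P Z1 B1" "fg_modulo R S Z3 B3"
    and sub: "submodule Z2 R Q" "submodule B2 R Q" "submodule B3 R S" "submodule Z3 R S"
    and \<rho>: "linear_relation R Q S \<rho>" "\<And>z. z \<in> Z2 \<Longrightarrow> \<exists>w\<in>Z3. (z, w) \<in> \<rho>"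
    and \<beta>: "\<beta> \<in> mod_hom R P Q" "\<beta> ` Z1 \<subseteq> Z2" "\<beta> ` B1 \<subseteq> B2" "Z1 \<subseteq> carrier P" "B1 \<subseteq> Z1"
    and exact: "\<And>z w. z \<in> Z2 \<Longrightarrow> w \<in> B3 \<Longrightarrow> (z, w) \<in> \<rho> \<Longrightarrow> \<exists>y\<in>Z1. \<exists>b\<in>B2. z = \<beta> y \<oplus>\<^bsub>Q\<^esub> b"
  shows "fg_modulo R Q Z2 B2"
proof -
  interpret P: module R P by fact
  interpret Q: module R Q by fact
  interpret S: module R S by fact
  \<comment> \<open>Cutting down to \<open>Z2\<close> and \<open>Z3\<close> makes the domain exactly
    \<open>Z2\<close> while the values stay in the span of finitely many elements and
    \<open>B3\<close>.\<close>
  let ?\<rho> = "\<rho> \<inter> (Z2 \<times> Z3)"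
  note D = linear_relationD[OF \<rho>(1)]
  have lin: "linear_relation R Q S ?\<rho>"
    by (rule linear_relationI) (use D Q.submoduleD[OF sub(1)] S.submoduleD[OF sub(4)] in auto)
  obtain A3 where A3: "finite A3" "A3 \<subseteq> Z3"
    "\<And>H. submodule H R S \<Longrightarrow> A3 \<subseteq> H \<Longrightarrow> B3 \<subseteq> H \<Longrightarrow> Z3 \<subseteq> H" using fg(2) unfolding fg_modulo_def by auto
  have c3: "A3 \<subseteq> carrier S" "B3 \<subseteq> carrier S" using A3(2) S.submoduleD(1)[OF sub(4)] S.submoduleD(1)[OF sub(3)] by auto
  have "Z3 \<subseteq> module_span R S (A3 \<union> B3)"
    by (rule A3(3)) (use module_span_props[OF S, of "A3 \<union> B3"] c3 in auto)
  then have "Range ?\<rho> \<subseteq> module_span R S (A3 \<union> B3)" by auto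
  from domain_generators[OF noeth Q S sub(3) A3(1) c3(1) lin this]
  obtain A' where A': "finite A'" "A' \<subseteq> Domain ?\<rho>"
    "\<And>H. submodule H R Q \<Longrightarrow> A' \<subseteq> H \<Longrightarrow> {x. \<exists>y\<in>B3. (x, y) \<in> ?\<rho>} \<subseteq> H \<Longrightarrow> Domain ?\<rho> \<subseteq> H" by auto
  have dom: "Domain ?\<rho> = Z2" using \<rho>(2) by auto
  obtain A1 where A1: "finite A1" "A1 \<subseteq> Z1"
    "\<And>H. submodule H R P \<Longrightarrow> A1 \<subseteq> H \<Longrightarrow> B1 \<subseteq> H \<Longrightarrow> Z1 \<subseteq> H" using fg(1) unfolding fg_modulo_def by auto
  show ?thesis unfolding fg_modulo_def
  proof (intro exI[of _ "A' \<union> \<beta> ` A1"] conjI allI impI)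
    show "finite (A' \<union> \<beta> ` A1)" using A'(1) A1(1) by simp
    show "A' \<union> \<beta> ` A1 \<subseteq> Z2" using A'(2) A1(2) \<beta>(2) dom by blast
    fix H assume "submodule H R Q \<and> A' \<union> \<beta> ` A1 \<subseteq> H \<and> B2 \<subseteq> H"
    then have H: "submodule H R Q" "A' \<subseteq> H" "\<beta> ` A1 \<subseteq> H" "B2 \<subseteq> H" by auto
    \<comment> \<open>Testing the generation of \<open>Z1\<close> on the preimage of
      \<open>H\<close> replaces generators by their images under \<beta>. Exactness then places the
      part of \<open>Z2\<close> with values in \<open>B3\<close> inside \<open>H\<close>.\<close>
    have "Z1 \<subseteq> {x \<in> carrier P. \<beta> x \<in> H}"
      by (rule A1(3)[OF submodule_vimage[OF P Q \<beta>(1) H(1)]]) (use H A1(2) \<beta>(3-5) in auto)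
    then have "{x. \<exists>y\<in>B3. (x, y) \<in> ?\<rho>} \<subseteq> H"
      using exact Q.submoduleD(3)[OF H(1)] H(4) by blast
    then show "Z2 \<subseteq> H" using A'(3)[OF H(1,2)] dom by blast
  qed
qed

text \<open>Submodules of Z/B correspond to submodules between \<open>B\<close> and
  \<open>Z\<close>, so generating sets can be pushed forward and lifted along the
  projection.\<close>

lemma fg_module_quotient_iff:
  assumes M: "module R M" and Z: "submodule Z R M" and B: "submodule B R M" and BZ: "B \<subseteq> Z"
  shows "fg_module R (quotient_module (M\<lparr>carrier := Z\<rparr>) B) \<longleftrightarrow> fg_modulo R M Z B"
proof -
  interpret M: module R M by fact
  let ?Z = "M\<lparr>carrier := Z\<rparr>"
  have mZ: "module R ?Z" by (rule submodule.submodule_is_module[OF Z M])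
  interpret Z: module R ?Z by (rule mZ)
  have subZ: "submodule H R ?Z \<longleftrightarrow> submodule H R M \<and> H \<subseteq> Z" for H
  proof
    assume "submodule H R ?Z"
    from Z.submoduleD[OF this] show "submodule H R M \<and> H \<subseteq> Z"
      using M.submoduleD(1)[OF Z] by (auto intro!: M.submodule_closedI)
  next
    assume "submodule H R M \<and> H \<subseteq> Z"
    then show "submodule H R ?Z" using M.submoduleD[of H] by (auto intro!: Z.submodule_closedI)
  qed
  let ?Q = "quotient_module ?Z B"
  define \<pi> where "\<pi> x = B +>\<^bsub>?Z\<^esub> x" for x
  have "submodule B R ?Z" using B BZ subZ by blast
  note q = quotient_module_facts[OF mZ this, folded \<pi>_def]
  have q2: "\<pi> \<in> mod_hom R ?Z ?Q" using q(2) by (simp add: \<pi>_def[abs_def])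
  interpret Q: module R ?Q by (rule q(1))
  have ker: "x \<ominus>\<^bsub>M\<^esub> y \<in> B" if "x \<in> Z" "y \<in> Z" "\<pi> x = \<pi> y" for x y
  proof -
    have y': "\<ominus>\<^bsub>M\<^esub> y \<in> Z" using M.submoduleE(3)[OF Z] that by simp
    \<comment> \<open>\<open>a_inv\<close> is defined through the carrier, so negation in
      \<open>M\<close> and in \<open>?Z\<close> are different terms. Multiplication by -1 is the
      same in both.\<close>
    have e: "\<ominus>\<^bsub>M\<^esub> y = (\<ominus>\<^bsub>R\<^esub> \<one>\<^bsub>R\<^esub>) \<odot>\<^bsub>?Z\<^esub> y"
      using M.smult_minus_one[of y] that M.submoduleD(1)[OF Z] by auto
    have "\<pi> (x \<oplus>\<^bsub>?Z\<^esub> \<ominus>\<^bsub>M\<^esub> y) = \<pi> x \<oplus>\<^bsub>?Q\<^esub> \<pi> (\<ominus>\<^bsub>M\<^esub> y)" using mod_homD(2)[OF q2] that y' by simp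
    also have "\<pi> (\<ominus>\<^bsub>M\<^esub> y) = (\<ominus>\<^bsub>R\<^esub> \<one>\<^bsub>R\<^esub>) \<odot>\<^bsub>?Q\<^esub> \<pi> y" unfolding e by (rule mod_homD(3)[OF q2]) (use that in auto)
    also have "\<dots> = \<ominus>\<^bsub>?Q\<^esub> \<pi> y" by (rule Q.smult_minus_one) (use mod_homD(1)[OF q2] that in auto)
    also have "\<pi> x \<oplus>\<^bsub>?Q\<^esub> \<ominus>\<^bsub>?Q\<^esub> \<pi> y = \<zero>\<^bsub>?Q\<^esub>" using that mod_homD(1)[OF q2] by (simp add: Q.M.r_neg)
    finally show ?thesis using q(4)[of "x \<oplus>\<^bsub>?Z\<^esub> \<ominus>\<^bsub>M\<^esub> y"] M.submoduleD(3)[OF Z that(1) y'] by (simp add: a_minus_def)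
  qed
  show ?thesis
  proof
    assume "fg_module R ?Q"
    then obtain A where A: "finite A" "A \<subseteq> carrier ?Q" "module_span R ?Q A = carrier ?Q"
      unfolding fg_module_def by blast
    have "A \<subseteq> \<pi> ` Z" using A(2) by (simp add: q(3))
    from finite_subset_image[OF A(1) this] obtain A' where A': "finite A'" "A' \<subseteq> Z" "\<pi> ` A' = A"
      by auto
    show "fg_modulo R M Z B" unfolding fg_modulo_def
    proof (intro exI[of _ A'] conjI allI impI A')
      fix H assume H: "submodule H R M \<and> A' \<subseteq> H \<and> B \<subseteq> H"
      \<comment> \<open>Since \<open>H\<close> may leave \<open>Z\<close>, the projection can only
        be applied to its intersection with \<open>Z\<close>.\<close>
      have "submodule (H \<inter> Z) R ?Z"
        unfolding subZ using M.submodule_Inter[of "{H, Z}"] H Z by auto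
      then have mH: "module R (?Z\<lparr>carrier := H \<inter> Z\<rparr>)" by (rule submodule.submodule_is_module[OF _ mZ])
      have "\<pi> \<in> mod_hom R (?Z\<lparr>carrier := H \<inter> Z\<rparr>) ?Q" using mod_homD[OF q2] by (intro mod_homI) auto
      from submodule_image[OF mH q(1) this] have "submodule (\<pi> ` (H \<inter> Z)) R ?Q" by simp
      moreover have "A \<subseteq> \<pi> ` (H \<inter> Z)" using H A' by blast
      ultimately have sub: "carrier ?Q \<subseteq> \<pi> ` (H \<inter> Z)" unfolding A(3)[symmetric] by (rule module_span_minimal)
      show "Z \<subseteq> H"
      proof
        fix z assume z: "z \<in> Z"
        then have "\<pi> z \<in> carrier ?Q" using mod_homD(1)[OF q2] by simp
        then obtain h where h: "h \<in> H" "h \<in> Z" "\<pi> z = \<pi> h" using sub by blast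
        have "z \<ominus>\<^bsub>M\<^esub> h \<in> H" using ker[OF z h(2,3)] H by blast
        then have "(z \<ominus>\<^bsub>M\<^esub> h) \<oplus>\<^bsub>M\<^esub> h \<in> H" using M.submoduleD(3) H h(1) by blast
        moreover have "z \<in> carrier M" "h \<in> carrier M" using z h M.submoduleD(1)[OF Z] by auto
        ultimately show "z \<in> H" by (simp add: M.M.minus_add_cancel)
      qed
    qed
  next
    assume "fg_modulo R M Z B"
    then obtain A where A: "finite A" "A \<subseteq> Z" "\<And>H. submodule H R M \<Longrightarrow> A \<subseteq> H \<Longrightarrow> B \<subseteq> H \<Longrightarrow> Z \<subseteq> H"
      unfolding fg_modulo_def by auto
    have piA: "\<pi> ` A \<subseteq> carrier ?Q" using A(2) mod_homD(1)[OF q2] by auto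
    note sp = module_span_props[OF q(1) piA]
    have "submodule {x \<in> carrier ?Z. \<pi> x \<in> module_span R ?Q (\<pi> ` A)} R ?Z"
      by (rule submodule_vimage[OF mZ q(1) q2 sp(1)])
    then have "submodule {x \<in> Z. \<pi> x \<in> module_span R ?Q (\<pi> ` A)} R M" unfolding subZ by simp
    moreover have "B \<subseteq> {x \<in> Z. \<pi> x \<in> module_span R ?Q (\<pi> ` A)}"
    proof
      fix b assume b: "b \<in> B"
      then have "\<pi> b = \<zero>\<^bsub>?Q\<^esub>" using BZ q(4)[of b] by auto
      then show "b \<in> {x \<in> Z. \<pi> x \<in> module_span R ?Q (\<pi> ` A)}"
        using b BZ Q.submoduleD(2)[OF sp(1)] by auto
    qed
    moreover have "A \<subseteq> {x \<in> Z. \<pi> x \<in> module_span R ?Q (\<pi> ` A)}" using A(2) sp(2) by auto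
    ultimately have "Z \<subseteq> {x \<in> Z. \<pi> x \<in> module_span R ?Q (\<pi> ` A)}" by (intro A(3))
    then have "carrier ?Q \<subseteq> module_span R ?Q (\<pi> ` A)" unfolding q(3) by auto
    then show "fg_module R ?Q" unfolding fg_module_def
      using piA A(1) Q.submoduleD(1)[OF sp(1)] by (intro exI[of _ "\<pi> ` A"]) auto
  qed
qed

section \<open>Modules of homomorphisms\<close>

lemma mod_hom_add:
  assumes "module R M" "module R N" "f \<in> mod_hom R M N" "g \<in> mod_hom R M N"
  shows "(\<lambda>x. f x \<oplus>\<^bsub>N\<^esub> g x) \<in> mod_hom R M N"
proof -
  interpret N: module R N by fact
  note f = mod_homD[OF assms(3)] and g = mod_homD[OF assms(4)]
  show ?thesis by (rule mod_homI) (use f g in \<open>simp_all add: N.smult_r_distr N.M.a_ac\<close>)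
qed

lemma mod_hom_smult:
  assumes "module R M" "module R N" "f \<in> mod_hom R M N" "r \<in> carrier R"
  shows "(\<lambda>x. r \<odot>\<^bsub>N\<^esub> f x) \<in> mod_hom R M N"
proof -
  interpret N: module R N by fact
  note f = mod_homD[OF assms(3)]
  show ?thesis
    by (rule mod_homI)
      (use f assms(4) in \<open>simp_all add: N.smult_r_distr N.R.m_comm flip: N.smult_assoc1\<close>)
qed

lemma mod_hom_const_zero:
  assumes "module R N" shows "(\<lambda>x. \<zero>\<^bsub>N\<^esub>) \<in> mod_hom R M N"
proof -
  interpret N: module R N by fact
  show ?thesis by (rule mod_homI) auto
qed

lemma mod_hom_cong:
  assumes "module R M" "f \<in> mod_hom R M N" "\<And>x. x \<in> carrier M \<Longrightarrow> g x = f x"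
  shows "g \<in> mod_hom R M N"
proof -
  interpret M: module R M by fact
  show ?thesis by (rule mod_homI) (use mod_homD[OF assms(2)] in \<open>simp_all add: assms(3)\<close>)
qed

lemma mod_hom_diff:
  assumes "module R M" "module R N" "f \<in> mod_hom R M N" "g \<in> mod_hom R M N"
  shows "(\<lambda>x. f x \<ominus>\<^bsub>N\<^esub> g x) \<in> mod_hom R M N"
proof -
  interpret N: module R N by fact
  have "(\<lambda>x. f x \<oplus>\<^bsub>N\<^esub> (\<ominus>\<^bsub>R\<^esub> \<one>\<^bsub>R\<^esub>) \<odot>\<^bsub>N\<^esub> g x) \<in> mod_hom R M N"
    by (intro mod_hom_add mod_hom_smult assms) auto
  then show ?thesis
    by (rule mod_hom_cong[OF assms(1)])
      (use mod_homD(1)[OF assms(4)] in \<open>simp add: N.smult_minus_one a_minus_def\<close>)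
qed

lemma hom_module_simps:
  "g \<in> carrier (hom_module R M N) \<longleftrightarrow> g \<in> mod_hom R M N \<and> g \<in> extensional (carrier M)"
  "\<zero>\<^bsub>hom_module R M N\<^esub> = (\<lambda>x\<in>carrier M. \<zero>\<^bsub>N\<^esub>)"
  "f \<oplus>\<^bsub>hom_module R M N\<^esub> g = (\<lambda>x\<in>carrier M. f x \<oplus>\<^bsub>N\<^esub> g x)"
  "r \<odot>\<^bsub>hom_module R M N\<^esub> f = (\<lambda>x\<in>carrier M. r \<odot>\<^bsub>N\<^esub> f x)"
  by (auto simp: hom_module_def)

lemma hom_module_restrict:
  assumes "module R M" "f \<in> mod_hom R M N"
  shows "restrict f (carrier M) \<in> carrier (hom_module R M N)"
  using mod_hom_cong[OF assms] by (simp add: hom_module_simps)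

lemma hom_module_eqI:
  assumes "f \<in> carrier (hom_module R M N)" "g \<in> carrier (hom_module R M N)"
    and "\<And>x. x \<in> carrier M \<Longrightarrow> f x = g x"
  shows "f = g"
  using assms by (auto simp: hom_module_simps intro: extensionalityI)

lemma hom_module_module:
  assumes M: "module R M" and N: "module R N"
  shows "module R (hom_module R M N)"
proof -
  interpret N: module R N by fact
  let ?H = "hom_module R M N"
  have val: "f x \<in> carrier N" if "f \<in> carrier ?H" "x \<in> carrier M" for f x
    using mod_homD(1) that by (fastforce simp: hom_module_simps)
  have add: "f \<oplus>\<^bsub>?H\<^esub> g \<in> carrier ?H" if "f \<in> carrier ?H" "g \<in> carrier ?H" for f g
    unfolding hom_module_simps(3)
    by (rule hom_module_restrict[OF M mod_hom_add[OF M N]]) (use that in \<open>auto simp: hom_module_simps(1)\<close>)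
  have smult: "r \<odot>\<^bsub>?H\<^esub> f \<in> carrier ?H" if "r \<in> carrier R" "f \<in> carrier ?H" for r f
    unfolding hom_module_simps(4)
    by (rule hom_module_restrict[OF M mod_hom_smult[OF M N]]) (use that in \<open>auto simp: hom_module_simps(1)\<close>)
  have zero: "\<zero>\<^bsub>?H\<^esub> \<in> carrier ?H"
    unfolding hom_module_simps(2) by (rule hom_module_restrict[OF M mod_hom_const_zero[OF N]])
  show ?thesis
  proof (rule moduleI)
    show "abelian_group ?H"
    proof (rule abelian_groupI)
      fix f assume f: "f \<in> carrier ?H"
      show "\<exists>g\<in>carrier ?H. g \<oplus>\<^bsub>?H\<^esub> f = \<zero>\<^bsub>?H\<^esub>"
      proof (rule bexI[of _ "(\<ominus>\<^bsub>R\<^esub> \<one>\<^bsub>R\<^esub>) \<odot>\<^bsub>?H\<^esub> f"])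
        show "((\<ominus>\<^bsub>R\<^esub> \<one>\<^bsub>R\<^esub>) \<odot>\<^bsub>?H\<^esub> f) \<oplus>\<^bsub>?H\<^esub> f = \<zero>\<^bsub>?H\<^esub>"
          unfolding hom_module_simps
          by (rule restrict_ext) (use val[OF f] in \<open>simp add: N.smult_minus_one N.M.l_neg\<close>)
      qed (rule smult[OF _ f], simp)
      show "\<zero>\<^bsub>?H\<^esub> \<oplus>\<^bsub>?H\<^esub> f = f"
        by (rule hom_module_eqI[OF add[OF zero f] f]) (use val[OF f] in \<open>simp add: hom_module_simps\<close>)
    next
      fix f g assume fg: "f \<in> carrier ?H" "g \<in> carrier ?H"
      show "f \<oplus>\<^bsub>?H\<^esub> g = g \<oplus>\<^bsub>?H\<^esub> f"
        unfolding hom_module_simps by (rule restrict_ext) (use val fg in \<open>simp add: N.M.a_comm\<close>)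
      fix h assume h: "h \<in> carrier ?H"
      show "f \<oplus>\<^bsub>?H\<^esub> g \<oplus>\<^bsub>?H\<^esub> h = f \<oplus>\<^bsub>?H\<^esub> (g \<oplus>\<^bsub>?H\<^esub> h)"
        unfolding hom_module_simps by (rule restrict_ext) (use val fg h in \<open>simp add: N.M.a_assoc\<close>)
    qed (use add zero in auto)
  next
    fix r f assume r: "r \<in> carrier R" and f: "f \<in> carrier ?H"
    fix s assume s: "s \<in> carrier R"
    show "(r \<oplus>\<^bsub>R\<^esub> s) \<odot>\<^bsub>?H\<^esub> f = r \<odot>\<^bsub>?H\<^esub> f \<oplus>\<^bsub>?H\<^esub> s \<odot>\<^bsub>?H\<^esub> f"
      unfolding hom_module_simps by (rule restrict_ext) (use val[OF f] r s in \<open>simp add: N.smult_l_distr\<close>)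
    show "(r \<otimes>\<^bsub>R\<^esub> s) \<odot>\<^bsub>?H\<^esub> f = r \<odot>\<^bsub>?H\<^esub> (s \<odot>\<^bsub>?H\<^esub> f)"
      unfolding hom_module_simps by (rule restrict_ext) (use val[OF f] r s in \<open>simp add: N.smult_assoc1\<close>)
  next
    fix r f g assume "r \<in> carrier R" "f \<in> carrier ?H" "g \<in> carrier ?H"
    then show "r \<odot>\<^bsub>?H\<^esub> (f \<oplus>\<^bsub>?H\<^esub> g) = r \<odot>\<^bsub>?H\<^esub> f \<oplus>\<^bsub>?H\<^esub> r \<odot>\<^bsub>?H\<^esub> g"
      unfolding hom_module_simps(3,4) by (intro restrict_ext) (use val in \<open>simp add: N.smult_r_distr\<close>)
  next
    fix f assume f: "f \<in> carrier ?H"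
    show "\<one>\<^bsub>R\<^esub> \<odot>\<^bsub>?H\<^esub> f = f"
      by (rule hom_module_eqI[OF smult[OF _ f] f]) (use val[OF f] in \<open>simp_all add: hom_module_simps\<close>)
  qed (use smult N.R.is_cring in auto)
qed

lemma hom_module_postcompose:
  assumes "module R M" "module R X" "module R Y" "f \<in> mod_hom R X Y"
  shows "(\<lambda>g. \<lambda>x\<in>carrier M. f (g x)) \<in> mod_hom R (hom_module R M X) (hom_module R M Y)"
proof (rule mod_homI)
  fix g assume g: "g \<in> carrier (hom_module R M X)"
  then have gh: "g \<in> mod_hom R M X" by (simp add: hom_module_simps)
  show "(\<lambda>x\<in>carrier M. f (g x)) \<in> carrier (hom_module R M Y)"
    by (rule hom_module_restrict[OF assms(1) mod_hom_compose[OF gh assms(4)]])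
  show "(\<lambda>x\<in>carrier M. f ((r \<odot>\<^bsub>hom_module R M X\<^esub> g) x)) = r \<odot>\<^bsub>hom_module R M Y\<^esub> (\<lambda>x\<in>carrier M. f (g x))"
    if "r \<in> carrier R" for r
    unfolding hom_module_simps
    by (rule restrict_ext) (use that mod_homD(1)[OF gh] mod_homD(3)[OF assms(4)] in simp)
  fix h assume h: "h \<in> carrier (hom_module R M X)"
  then have hh: "h \<in> mod_hom R M X" by (simp add: hom_module_simps)
  show "(\<lambda>x\<in>carrier M. f ((g \<oplus>\<^bsub>hom_module R M X\<^esub> h) x))
      = (\<lambda>x\<in>carrier M. f (g x)) \<oplus>\<^bsub>hom_module R M Y\<^esub> (\<lambda>x\<in>carrier M. f (h x))"
    unfolding hom_module_simps
    by (rule restrict_ext) (use mod_homD(1)[OF gh] mod_homD(1)[OF hh] mod_homD(2)[OF assms(4)] in simp)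
qed

lemma linear_relation_graph:
  assumes "module R M" "module R N" "f \<in> mod_hom R M N"
  shows "linear_relation R M N {(x, f x) | x. x \<in> carrier M}"
proof -
  interpret M: module R M by fact
  show ?thesis
    by (rule linear_relationI) (use mod_homD[OF assms(3)] mod_hom_zero[OF assms] in auto)
qed

section \<open>Homomorphisms from a free module\<close>

text \<open>Every element of the free module is \<open>combination R l\<close> for some list
  \<open>l\<close>, which turns the comparison into an induction on lists.\<close>

lemma free_module_hom_eqI:
  fixes f g :: "('t \<Rightarrow> 'r) \<Rightarrow> 'x" and X :: "('r, 'x) module"
  assumes X: "module R X" and f: "f \<in> mod_hom R (free_module R) X" and g: "g \<in> mod_hom R (free_module R) X"
    and unit: "\<And>t. f (unit_vec R t) = g (unit_vec R t)" and x: "x \<in> carrier (free_module R)"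
  shows "f x = g x"
proof -
  interpret X: module R X by fact
  have mF: "module R (free_module R :: ('r, 't \<Rightarrow> 'r) module)" by (rule free_module_module[OF X.R.is_cring])
  interpret F: module R "free_module R :: ('r, 't \<Rightarrow> 'r) module" by (rule mF)
  note f' = mod_homD[OF f] and g' = mod_homD[OF g]
  note u = unit_vec_carrier[OF X.R.is_cring]
  obtain l where l: "fst ` set l \<subseteq> carrier R" "combination R l = x"
    using combination_surj[OF X.R.is_cring x] by blast
  have "f (combination R l) = g (combination R l)" using l(1)
  proof (induction l)
    case Nil
    show ?case using mod_hom_zero[OF mF X f] mod_hom_zero[OF mF X g] by (simp add: free_module_simps(2))
  next
    case (Cons p l)
    obtain c t where p: "p = (c, t)" by (cases p)
    have c: "c \<in> carrier R" and l: "combination R l \<in> carrier (free_module R)"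
      using Cons.prems combination_carrier[OF X.R.is_cring] by (auto simp: p)
    have IH: "f (combination R l) = g (combination R l)" using Cons by (simp add: p)
    note cu = F.smult_closed[OF c u]
    have "combination R (p # l) = c \<odot>\<^bsub>free_module R\<^esub> unit_vec R t \<oplus>\<^bsub>free_module R\<^esub> combination R l"
      using c by (auto simp: p free_module_simps unit_vec_def fun_eq_iff)
    then show ?case
      by (simp only: f'(2)[OF cu l] g'(2)[OF cu l] f'(3)[OF c u] g'(3)[OF c u] unit IH)
  qed
  then show ?thesis using l(2) by simp
qed

text \<open>Projectivity of the free module: preimages are chosen for the images of the unit vectors
  and extended linearly.\<close>

lemma free_module_lift:
  fixes z :: "('t \<Rightarrow> 'r) \<Rightarrow> 'y" and X :: "('r, 'x) module" and Y :: "('r, 'y) module"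
  assumes X: "module R X" and Y: "module R Y" and p: "p \<in> mod_hom R X Y" "p ` carrier X = carrier Y"
    and z: "z \<in> mod_hom R (free_module R) Y"
  shows "\<exists>u\<in>mod_hom R (free_module R) X. \<forall>x\<in>carrier (free_module R). p (u x) = z x"
proof -
  interpret X: module R X by fact
  note u = unit_vec_carrier[OF X.R.is_cring]
  have "\<exists>b. b \<in> carrier X \<and> p b = z (unit_vec R t)" for t
    using mod_homD(1)[OF z u, of t] p(2) by (metis imageE)
  then obtain \<phi> where \<phi>: "\<And>t. \<phi> t \<in> carrier X" "\<And>t. p (\<phi> t) = z (unit_vec R t)" by metis
  have l: "linear_extension R X \<phi> \<in> mod_hom R (free_module R) X" by (rule linear_extension_hom[OF X \<phi>(1)])
  have "p (linear_extension R X \<phi> x) = z x" if "x \<in> carrier (free_module R)" for x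
    by (rule free_module_hom_eqI[OF Y mod_hom_compose[OF l p(1)] z _ that])
       (simp add: linear_extension_unit_vec[OF X \<phi>(1)] \<phi>(2))
  then show ?thesis using l by blast
qed

section \<open>Short exact sequences between modules of different element types\<close>

definition short_exact :: "('r, 'k) ring_scheme \<Rightarrow> ('r, 'a) module \<Rightarrow> ('a \<Rightarrow> 'b) \<Rightarrow> ('r, 'b) module \<Rightarrow>
    ('b \<Rightarrow> 'c) \<Rightarrow> ('r, 'c) module \<Rightarrow> bool"
  where "short_exact R A i B p C \<longleftrightarrow> module R A \<and> module R B \<and> module R C \<and>
    i \<in> mod_hom R A B \<and> inj_on i (carrier A) \<and> p \<in> mod_hom R B C \<and> p ` carrier B = carrier C \<and>
    i ` carrier A = a_kernel B C p"

lemma short_exactD: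
  assumes "short_exact R A i B p C"
  shows "module R A" "module R B" "module R C" "i \<in> mod_hom R A B" "inj_on i (carrier A)"
    "p \<in> mod_hom R B C" "p ` carrier B = carrier C"
    and "a \<in> carrier A \<Longrightarrow> p (i a) = \<zero>\<^bsub>C\<^esub>"
proof -
  show "p (i a) = \<zero>\<^bsub>C\<^esub>" if a: "a \<in> carrier A"
  proof -
    have "i a \<in> a_kernel B C p" using assms a unfolding short_exact_def by blast
    then show ?thesis by (simp add: a_kernel_iff)
  qed
qed (use assms in \<open>simp_all add: short_exact_def\<close>)

text \<open>The universal property of \<open>i\<close> as the kernel of \<open>p\<close>. It carries
  cochains with values in \<open>B\<close> back to \<open>A\<close>.\<close>

lemma short_exact_factor:
  assumes ses: "short_exact R A i B p C" and M: "module R M"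
    and f: "f \<in> mod_hom R M B" "\<And>x. x \<in> carrier M \<Longrightarrow> p (f x) = \<zero>\<^bsub>C\<^esub>"
  shows "\<exists>g\<in>mod_hom R M A. \<forall>x\<in>carrier M. i (g x) = f x"
proof -
  note s = short_exactD[OF ses]
  have im: "i ` carrier A = a_kernel B C p" using ses by (simp add: short_exact_def)
  interpret A: module R A by (rule s(1))
  interpret M: module R M by (rule M)
  define g where "g x = inv_into (carrier A) i (f x)" for x
  have fx: "f x \<in> i ` carrier A" if "x \<in> carrier M" for x
    using that f mod_homD(1)[OF f(1)] unfolding im a_kernel_iff by simp
  have g: "g x \<in> carrier A" "i (g x) = f x" if "x \<in> carrier M" for x
    unfolding g_def using fx[OF that] by (simp_all add: inv_into_into f_inv_into_f)
  note inj = inj_onD[OF s(5)]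
  have "g \<in> mod_hom R M A"
  proof (rule mod_homI)
    fix x assume x: "x \<in> carrier M"
    show "g x \<in> carrier A" using g x by simp
    show "g (x \<oplus>\<^bsub>M\<^esub> y) = g x \<oplus>\<^bsub>A\<^esub> g y" if y: "y \<in> carrier M" for y
      by (rule inj) (use g x y mod_homD(2)[OF s(4)] mod_homD(2)[OF f(1)] in simp_all)
    show "g (r \<odot>\<^bsub>M\<^esub> x) = r \<odot>\<^bsub>A\<^esub> g x" if r: "r \<in> carrier R" for r
      by (rule inj) (use g x r mod_homD(3)[OF s(4)] mod_homD(3)[OF f(1)] in simp_all)
  qed
  then show ?thesis using g by blast
qed

section \<open>Cocycles and coboundaries for Ext\<close>

text \<open>\<open>res_diff R N n\<close> goes from degree n+1 to degree n, so cocycles of degree n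
  are killed by precomposition with index n, while coboundaries of degree n arise by precomposition
  with index n-1.\<close>

definition ext_cocycles :: "('r, 'k) ring_scheme \<Rightarrow> nat \<Rightarrow> ('r, 'n) module \<Rightarrow> ('r, 'x) module \<Rightarrow>
    ((('r, 'n) res_basis \<Rightarrow> 'r) \<Rightarrow> 'x) set"
  where "ext_cocycles R n N X = {g \<in> carrier (hom_module R (free_module R) X).
    \<forall>x\<in>carrier (free_module R). g (res_diff R N n x) = \<zero>\<^bsub>X\<^esub>}"

definition ext_coboundaries :: "('r, 'k) ring_scheme \<Rightarrow> nat \<Rightarrow> ('r, 'n) module \<Rightarrow> ('r, 'x) module \<Rightarrow>
    ((('r, 'n) res_basis \<Rightarrow> 'r) \<Rightarrow> 'x) set"
  where "ext_coboundaries R n N X = {g \<in> carrier (hom_module R (free_module R) X).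
    \<exists>h\<in>mod_hom R (free_module R) X. \<forall>x\<in>carrier (free_module R).
      g x = (case n of 0 \<Rightarrow> \<zero>\<^bsub>X\<^esub> | Suc k \<Rightarrow> h (res_diff R N k x))}"

context
  fixes R :: "('r, 'k) ring_scheme" and N :: "('r, 'n) module" and F :: "('r, ('r, 'n) res_basis \<Rightarrow> 'r) module"
  assumes N: "module R N"
  defines "F \<equiv> free_module R"
begin

lemma free_module_F: "module R F"
proof -
  interpret N: module R N by (rule N)
  show ?thesis unfolding F_def by (rule free_module_module[OF N.R.is_cring])
qed

lemma res_diff_hom: "res_diff R N n \<in> mod_hom R F F"
  unfolding F_def by (rule free_resolution(3)[OF N])

lemma res_diff_closed: "x \<in> carrier F \<Longrightarrow> res_diff R N n x \<in> carrier F"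
  by (rule mod_homD(1)[OF res_diff_hom])

lemma res_diff_res_diff: "x \<in> carrier F \<Longrightarrow> res_diff R N n (res_diff R N (Suc n) x) = \<zero>\<^bsub>F\<^esub>"
  using free_resolution(5)[OF N, of n] unfolding F_def[symmetric] by (metis a_kernel_iff image_eqI)

lemma ext_cocyclesD:
  assumes "g \<in> ext_cocycles R n N X"
  shows "g \<in> carrier (hom_module R F X)" "g \<in> mod_hom R F X"
    and "x \<in> carrier F \<Longrightarrow> g (res_diff R N n x) = \<zero>\<^bsub>X\<^esub>"
  using assms unfolding ext_cocycles_def F_def by (auto simp: hom_module_simps)

lemma ext_cocycles_restrict:
  assumes "g \<in> mod_hom R F X" "\<And>x. x \<in> carrier F \<Longrightarrow> g (res_diff R N n x) = \<zero>\<^bsub>X\<^esub>"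
  shows "restrict g (carrier F) \<in> ext_cocycles R n N X"
  using hom_module_restrict[OF free_module_F assms(1)] assms(2) res_diff_closed
  unfolding ext_cocycles_def F_def by simp

lemma submodule_ext_cocycles:
  assumes X: "module R X"
  shows "submodule (ext_cocycles R n N X) R (hom_module R F X)"
proof -
  interpret H: module R "hom_module R F X" by (rule hom_module_module[OF free_module_F X])
  interpret X: module R X by (rule X)
  show ?thesis
  proof (rule H.submodule_closedI)
    show "ext_cocycles R n N X \<subseteq> carrier (hom_module R F X)" using ext_cocyclesD(1) by blast
    show "\<zero>\<^bsub>hom_module R F X\<^esub> \<in> ext_cocycles R n N X"
      unfolding hom_module_simps by (rule ext_cocycles_restrict[OF mod_hom_const_zero[OF X]]) simp
  next
    fix f g assume f: "f \<in> ext_cocycles R n N X" and g: "g \<in> ext_cocycles R n N X"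
    show "f \<oplus>\<^bsub>hom_module R F X\<^esub> g \<in> ext_cocycles R n N X"
      unfolding hom_module_simps
      by (rule ext_cocycles_restrict[OF mod_hom_add[OF free_module_F X]])
         (use ext_cocyclesD[OF f] ext_cocyclesD[OF g] in simp_all)
  next
    fix r f assume r: "r \<in> carrier R" and f: "f \<in> ext_cocycles R n N X"
    show "r \<odot>\<^bsub>hom_module R F X\<^esub> f \<in> ext_cocycles R n N X"
      unfolding hom_module_simps
      by (rule ext_cocycles_restrict[OF mod_hom_smult[OF free_module_F X]])
         (use ext_cocyclesD[OF f] r in simp_all)
  qed
qed

lemma ext_coboundaries_restrict:
  assumes h: "h \<in> mod_hom R F X"
  shows "(\<lambda>x\<in>carrier F. h (res_diff R N k x)) \<in> ext_coboundaries R (Suc k) N X"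
  using hom_module_restrict[OF free_module_F mod_hom_compose[OF res_diff_hom h, of k]] h
  unfolding ext_coboundaries_def F_def by auto

lemma ext_coboundaries_SucD:
  assumes "g \<in> ext_coboundaries R (Suc k) N X"
  shows "g \<in> carrier (hom_module R F X)"
    "\<exists>h\<in>mod_hom R F X. \<forall>x\<in>carrier F. g x = h (res_diff R N k x)"
  using assms unfolding ext_coboundaries_def F_def by auto

lemma ext_coboundaries_0:
  assumes X: "module R X"
  shows "ext_coboundaries R 0 N X = {\<zero>\<^bsub>hom_module R F X\<^esub>}"
proof -
  interpret H: module R "hom_module R F X" by (rule hom_module_module[OF free_module_F X])
  note z = H.M.zero_closed
  have "g = \<zero>\<^bsub>hom_module R F X\<^esub>" if g: "g \<in> carrier (hom_module R F X)" "\<forall>x\<in>carrier F. g x = \<zero>\<^bsub>X\<^esub>" for g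
    by (rule hom_module_eqI[OF g(1) z]) (use g(2) in \<open>simp add: hom_module_simps\<close>)
  moreover have "\<forall>x\<in>carrier F. \<zero>\<^bsub>hom_module R F X\<^esub> x = \<zero>\<^bsub>X\<^esub>" by (simp add: hom_module_simps(2))
  moreover have "\<exists>h. h \<in> mod_hom R F X" using mod_hom_const_zero[OF X] by blast
  ultimately show ?thesis
    using z unfolding ext_coboundaries_def F_def[symmetric] nat.case by blast
qed

lemma ext_coboundaries_Suc:
  assumes X: "module R X"
  shows "ext_coboundaries R (Suc k) N X = (\<lambda>g. \<lambda>x\<in>carrier F. g (res_diff R N k x)) ` carrier (hom_module R F X)"
proof (intro equalityI subsetI)
  fix g assume g: "g \<in> ext_coboundaries R (Suc k) N X"
  then obtain h where h: "h \<in> mod_hom R F X" "\<forall>x\<in>carrier F. g x = h (res_diff R N k x)"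
    using ext_coboundaries_SucD(2) by blast
  have "g = (\<lambda>x\<in>carrier F. restrict h (carrier F) (res_diff R N k x))"
    using ext_coboundaries_SucD(1)[OF g] h(2) res_diff_closed
    by (auto simp: hom_module_simps extensional_def fun_eq_iff)
  then show "g \<in> (\<lambda>g. \<lambda>x\<in>carrier F. g (res_diff R N k x)) ` carrier (hom_module R F X)"
    using hom_module_restrict[OF free_module_F h(1)] by blast
next
  fix g assume "g \<in> (\<lambda>g. \<lambda>x\<in>carrier F. g (res_diff R N k x)) ` carrier (hom_module R F X)"
  then show "g \<in> ext_coboundaries R (Suc k) N X"
    using ext_coboundaries_restrict by (auto simp: hom_module_simps(1))
qed

lemma ext_coboundaries_subset:
  assumes X: "module R X"
  shows "ext_coboundaries R n N X \<subseteq> ext_cocycles R n N X"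
proof (cases n)
  case 0
  interpret H: module R "hom_module R F X" by (rule hom_module_module[OF free_module_F X])
  show ?thesis using H.submoduleD(2)[OF submodule_ext_cocycles[OF X]] by (simp add: 0 ext_coboundaries_0[OF X])
next
  case (Suc k)
  show ?thesis
  proof
    fix g assume g: "g \<in> ext_coboundaries R n N X"
    then obtain h where h: "h \<in> mod_hom R F X" "\<forall>x\<in>carrier F. g x = h (res_diff R N k x)"
      using ext_coboundaries_SucD(2) unfolding Suc by blast
    have "g (res_diff R N n x) = \<zero>\<^bsub>X\<^esub>" if "x \<in> carrier F" for x
      using that h(2) res_diff_closed res_diff_res_diff[OF that, of k] mod_hom_zero[OF free_module_F X h(1)]
      by (simp add: Suc del: res_diff.simps)
    then show "g \<in> ext_cocycles R n N X"
      using ext_coboundaries_SucD(1)[of g k X] g unfolding Suc ext_cocycles_def F_def by blast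
  qed
qed

lemma submodule_ext_coboundaries:
  assumes X: "module R X"
  shows "submodule (ext_coboundaries R n N X) R (hom_module R F X)"
proof (cases n)
  case 0
  interpret H: module R "hom_module R F X" by (rule hom_module_module[OF free_module_F X])
  show ?thesis unfolding 0 ext_coboundaries_0[OF X] by (rule H.submodule_closedI) auto
next
  case (Suc k)
  interpret H: module R "hom_module R F X" by (rule hom_module_module[OF free_module_F X])
  have "(\<lambda>g. \<lambda>x\<in>carrier F. g (res_diff R N k x)) \<in> mod_hom R (hom_module R F X) (hom_module R F X)"
  proof (rule mod_homI)
    fix g assume g: "g \<in> carrier (hom_module R F X)"
    then have "g \<in> mod_hom R F X" by (simp add: hom_module_simps(1))
    then show "(\<lambda>x\<in>carrier F. g (res_diff R N k x)) \<in> carrier (hom_module R F X)"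
      by (rule hom_module_restrict[OF free_module_F mod_hom_compose[OF res_diff_hom]])
    show "(\<lambda>x\<in>carrier F. (r \<odot>\<^bsub>hom_module R F X\<^esub> g) (res_diff R N k x))
        = r \<odot>\<^bsub>hom_module R F X\<^esub> (\<lambda>x\<in>carrier F. g (res_diff R N k x))" for r
      unfolding hom_module_simps by (rule restrict_ext) (simp add: res_diff_closed)
    fix h
    show "(\<lambda>x\<in>carrier F. (g \<oplus>\<^bsub>hom_module R F X\<^esub> h) (res_diff R N k x))
        = (\<lambda>x\<in>carrier F. g (res_diff R N k x)) \<oplus>\<^bsub>hom_module R F X\<^esub> (\<lambda>x\<in>carrier F. h (res_diff R N k x))"
      unfolding hom_module_simps by (rule restrict_ext) (simp add: res_diff_closed)
  qed
  from submodule_image[OF H.module_axioms H.module_axioms this]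
  show ?thesis unfolding Suc ext_coboundaries_Suc[OF X] .
qed

text \<open>The passage from the coset module \<open>Ext\<close> to cochains: \<open>compose\<close>
  with the differential has the cocycles as kernel and the coboundaries as image. All later
  arguments on finite generation of Ext take place in Hom(F, X).\<close>

lemma fg_Ext_iff:
  assumes X: "module R X"
  shows "fg_module R (Ext R n N X) \<longleftrightarrow>
    fg_modulo R (hom_module R F X) (ext_cocycles R n N X) (ext_coboundaries R n N X)"
proof -
  let ?H = "hom_module R F X"
  have mH: "module R ?H" by (rule hom_module_module[OF free_module_F X])
  have "a_kernel ?H ?H (\<lambda>g. compose (carrier F) g (res_diff R N n)) = ext_cocycles R n N X"
  proof (rule Set.set_eqI)
    fix g
    have "(\<lambda>x\<in>carrier F. g (res_diff R N n x)) = (\<lambda>x\<in>carrier F. \<zero>\<^bsub>X\<^esub>) \<longleftrightarrow>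
        (\<forall>x\<in>carrier F. g (res_diff R N n x) = \<zero>\<^bsub>X\<^esub>)"
      by (auto simp: restrict_def fun_eq_iff)
    then show "g \<in> a_kernel ?H ?H (\<lambda>g. compose (carrier F) g (res_diff R N n)) \<longleftrightarrow> g \<in> ext_cocycles R n N X"
      unfolding a_kernel_iff ext_cocycles_def hom_module_simps(2) compose_def F_def by blast
  qed
  moreover have "(case n of 0 \<Rightarrow> {\<zero>\<^bsub>?H\<^esub>} | Suc k \<Rightarrow>
      (\<lambda>g. compose (carrier F) g (res_diff R N k)) ` carrier ?H) = ext_coboundaries R n N X"
    by (cases n) (simp_all add: ext_coboundaries_0[OF X] ext_coboundaries_Suc[OF X] compose_def)
  ultimately have "Ext R n N X = quotient_module (?H\<lparr>carrier := ext_cocycles R n N X\<rparr>) (ext_coboundaries R n N X)"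
    unfolding Ext_def cohomology_def F_def by simp
  then show ?thesis
    using fg_module_quotient_iff[OF mH submodule_ext_cocycles[OF X] submodule_ext_coboundaries[OF X]
      ext_coboundaries_subset[OF X]] by simp
qed

lemma ext_coboundaries_postcompose:
  assumes X: "module R X" and Y: "module R Y" and f: "f \<in> mod_hom R X Y" and g: "g \<in> ext_coboundaries R n N X"
  shows "(\<lambda>x\<in>carrier F. f (g x)) \<in> ext_coboundaries R n N Y"
proof (cases n)
  case 0
  then show ?thesis
    using g mod_hom_zero[OF X Y f] by (simp add: ext_coboundaries_0 X Y hom_module_simps(2) cong: restrict_cong)
next
  case (Suc k)
  then obtain h where h: "h \<in> mod_hom R F X" "\<forall>x\<in>carrier F. g x = h (res_diff R N k x)"
    using ext_coboundaries_SucD(2) g by blast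
  have "(\<lambda>x\<in>carrier F. f (g x)) = (\<lambda>x\<in>carrier F. f (h (res_diff R N k x)))" using h(2) by (intro restrict_ext) simp
  then show ?thesis using ext_coboundaries_restrict[OF mod_hom_compose[OF h(1) f]] by (simp add: Suc)
qed

lemma ext_cocycles_postcompose:
  assumes X: "module R X" and Y: "module R Y" and f: "f \<in> mod_hom R X Y" and g: "g \<in> ext_cocycles R n N X"
  shows "(\<lambda>x\<in>carrier F. f (g x)) \<in> ext_cocycles R n N Y"
  by (rule ext_cocycles_restrict[OF mod_hom_compose[OF ext_cocyclesD(2)[OF g] f]])
     (simp add: ext_cocyclesD(3)[OF g] mod_hom_zero[OF X Y f])

text \<open>In positive degree the cochain whose coboundary is \<open>w\<close> lifts because F is
  free, and the coboundary of the lift lifts \<open>w\<close>. In degree 0 all coboundaries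
  vanish.\<close>

lemma ext_coboundaries_lift:
  assumes X: "module R X" and Y: "module R Y" and p: "p \<in> mod_hom R X Y" "p ` carrier X = carrier Y"
    and w: "w \<in> ext_coboundaries R n N Y"
  shows "\<exists>b\<in>ext_coboundaries R n N X. \<forall>x\<in>carrier F. p (b x) = w x"
proof (cases n)
  case 0
  then show ?thesis using w mod_hom_zero[OF X Y p(1)] by (simp add: ext_coboundaries_0 X Y hom_module_simps(2))
next
  case (Suc k)
  then obtain h where h: "h \<in> mod_hom R F Y" "\<forall>x\<in>carrier F. w x = h (res_diff R N k x)"
    using ext_coboundaries_SucD(2) w by blast
  obtain u where u: "u \<in> mod_hom R F X" "\<forall>x\<in>carrier F. p (u x) = h x"
    using free_module_lift[OF X Y p h(1)[unfolded F_def]] unfolding F_def by blast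
  show ?thesis unfolding Suc
    by (rule bexI[OF _ ext_coboundaries_restrict[OF u(1)]]) (use u(2) h(2) res_diff_closed in simp)
qed

section \<open>Finite generation along the long exact sequence for Ext\<close>

lemma Ext_fg_trivial:
  assumes "module R X" "ext_cocycles R n N X \<subseteq> ext_coboundaries R n N X"
  shows "fg_module R (Ext R n N X)"
  using assms(2) by (simp add: fg_Ext_iff[OF assms(1)] fg_modulo_self)

text \<open>Exactness of Ext^n(N,A) -> Ext^n(N,B) -> Ext^n(N,C), combined with
  \<open>fg_modulo_exact\<close> for the graph of composition with \<open>p\<close>.\<close>

lemma Ext_fg_middle:
  assumes noeth: "noetherian_ring R" and ses: "short_exact R A i B p C"
    and fg: "fg_module R (Ext R n N A)" "fg_module R (Ext R n N C)"
  shows "fg_module R (Ext R n N B)"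
proof -
  note s = short_exactD[OF ses]
  interpret A: module R A by (rule s(1))
  interpret B: module R B by (rule s(2))
  interpret C: module R C by (rule s(3))
  let ?\<beta> = "\<lambda>y. \<lambda>x\<in>carrier F. i (y x)" and ?\<alpha> = "\<lambda>z. \<lambda>x\<in>carrier F. p (z x)"
  interpret HB: module R "hom_module R F B" by (rule hom_module_module[OF free_module_F s(2)])
  note \<beta> = hom_module_postcompose[OF free_module_F s(1,2,4)]
    and \<alpha> = hom_module_postcompose[OF free_module_F s(2,3,6)]
  note fg' = fg[unfolded fg_Ext_iff[OF s(1)] fg_Ext_iff[OF s(3)]]
  show ?thesis unfolding fg_Ext_iff[OF s(2)]
  proof (rule fg_modulo_exact[OF noeth _ _ _ fg' submodule_ext_cocycles[OF s(2)] submodule_ext_coboundaries[OF s(2)]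
        submodule_ext_coboundaries[OF s(3)] submodule_ext_cocycles[OF s(3)] linear_relation_graph[OF _ _ \<alpha>] _ \<beta>])
    show "?\<beta> ` ext_cocycles R n N A \<subseteq> ext_cocycles R n N B"
      using ext_cocycles_postcompose[OF s(1,2,4)] by blast
    show "?\<beta> ` ext_coboundaries R n N A \<subseteq> ext_coboundaries R n N B"
      using ext_coboundaries_postcompose[OF s(1,2,4)] by blast
    show "ext_cocycles R n N A \<subseteq> carrier (hom_module R F A)" using ext_cocyclesD(1) by blast
    show "ext_coboundaries R n N A \<subseteq> ext_cocycles R n N A" by (rule ext_coboundaries_subset[OF s(1)])
    show "\<exists>w\<in>ext_cocycles R n N C. (z, w) \<in> {(z, ?\<alpha> z) |z. z \<in> carrier (hom_module R F B)}"
      if "z \<in> ext_cocycles R n N B" for z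
      using ext_cocycles_postcompose[OF s(2,3,6) that] ext_cocyclesD(1)[OF that] by blast
  next
    fix z w assume z: "z \<in> ext_cocycles R n N B" and w: "w \<in> ext_coboundaries R n N C"
      and "(z, w) \<in> {(z, ?\<alpha> z) |z. z \<in> carrier (hom_module R F B)}"
    then have wz: "w = ?\<alpha> z" by blast
    \<comment> \<open>The image of \<open>z\<close> is only a coboundary. Subtracting a coboundary
      \<open>b\<close> above it makes the difference vanish under \<open>p\<close> exactly, so that
      it factors through \<open>A\<close>.\<close>
    obtain b where b: "b \<in> ext_coboundaries R n N B" "\<forall>x\<in>carrier F. p (b x) = w x"
      using ext_coboundaries_lift[OF s(2,3,6,7) w] by blast
    have bc: "b \<in> ext_cocycles R n N B" using b(1) ext_coboundaries_subset[OF s(2)] by blast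
    note zD = ext_cocyclesD[OF z] and bD = ext_cocyclesD[OF bc]
    let ?d = "\<lambda>x. z x \<ominus>\<^bsub>B\<^esub> b x"
    have d: "?d \<in> mod_hom R F B" by (rule mod_hom_diff[OF free_module_F s(2) zD(2) bD(2)])
    have pd: "p (?d x) = \<zero>\<^bsub>C\<^esub>" if x: "x \<in> carrier F" for x
    proof -
      have c: "z x \<in> carrier B" "b x \<in> carrier B" using mod_homD(1)[OF zD(2) x] mod_homD(1)[OF bD(2) x] by auto
      have "p (?d x) = p (z x) \<ominus>\<^bsub>C\<^esub> p (b x)"
        using c mod_homD(2)[OF s(6)] mod_hom_minus[OF s(2,3,6)] by (simp add: a_minus_def)
      also have "p (b x) = p (z x)" using b(2) wz x by simp
      finally show ?thesis using mod_homD(1)[OF s(6) c(1)] by (simp add: a_minus_def C.M.r_neg)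
    qed
    obtain y where y: "y \<in> mod_hom R F A" "\<forall>x\<in>carrier F. i (y x) = ?d x"
      using short_exact_factor[OF ses free_module_F d pd] by blast
    \<comment> \<open>The cocycle condition is tested after applying the injective \<open>i\<close>,
      where it is inherited from \<open>z\<close> and \<open>b\<close>.\<close>
    have yc: "restrict y (carrier F) \<in> ext_cocycles R n N A"
    proof (rule ext_cocycles_restrict[OF y(1)])
      fix x assume x: "x \<in> carrier F"
      have "i (y (res_diff R N n x)) = i \<zero>\<^bsub>A\<^esub>"
        using y(2) res_diff_closed[OF x] zD(3)[OF x] bD(3)[OF x] mod_hom_zero[OF s(1,2,4)]
        by (simp add: a_minus_def B.M.r_neg)
      then show "y (res_diff R N n x) = \<zero>\<^bsub>A\<^esub>"
        by (rule inj_onD[OF s(5)]) (use mod_homD(1)[OF y(1)] res_diff_closed[OF x] in auto)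
    qed
    have "z = ?\<beta> (restrict y (carrier F)) \<oplus>\<^bsub>hom_module R F B\<^esub> b"
    proof (rule hom_module_eqI[OF zD(1)])
      show "?\<beta> (restrict y (carrier F)) \<oplus>\<^bsub>hom_module R F B\<^esub> b \<in> carrier (hom_module R F B)"
        by (rule HB.M.add.m_closed[OF mod_homD(1)[OF \<beta> ext_cocyclesD(1)[OF yc]] bD(1)])
      show "z x = (?\<beta> (restrict y (carrier F)) \<oplus>\<^bsub>hom_module R F B\<^esub> b) x" if "x \<in> carrier F" for x
        using that y(2) mod_homD(1)[OF zD(2)] mod_homD(1)[OF bD(2)] B.M.minus_add_cancel
        by (simp add: hom_module_simps)
    qed
    then show "\<exists>y\<in>ext_cocycles R n N A. \<exists>b\<in>ext_coboundaries R n N B. z = ?\<beta> y \<oplus>\<^bsub>hom_module R F B\<^esub> b"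
      using yc b(1) by blast
  qed (rule hom_module_module[OF free_module_F s(1)] hom_module_module[OF free_module_F s(2)]
      hom_module_module[OF free_module_F s(3)])+
qed

text \<open>
  The relation used here is the connecting map on cochains: lift \<open>z\<close> to \<open>u\<close> along \<open>p\<close> and
  restrict \<open>u\<close> to the boundaries, where it takes values in \<open>A\<close>.
\<close>

lemma Ext_fg_right:
  assumes noeth: "noetherian_ring R" and ses: "short_exact R A i B p C"
    and fg: "fg_module R (Ext R n N B)" "fg_module R (Ext R (Suc n) N A)"
  shows "fg_module R (Ext R n N C)"
proof -
  note s = short_exactD[OF ses]
  interpret A: module R A by (rule s(1))
  interpret B: module R B by (rule s(2))
  interpret C: module R C by (rule s(3))
  interpret HC: module R "hom_module R F C" by (rule hom_module_module[OF free_module_F s(3)])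
  let ?\<beta> = "\<lambda>y. \<lambda>x\<in>carrier F. p (y x)"
  define \<delta> where "\<delta> = res_diff R N n"
  have \<delta>: "\<delta> \<in> mod_hom R F F" "\<And>x. x \<in> carrier F \<Longrightarrow> \<delta> x \<in> carrier F"
    unfolding \<delta>_def by (rule res_diff_hom, rule res_diff_closed)
  define \<rho> where "\<rho> = {(z, w). z \<in> carrier (hom_module R F C) \<and> w \<in> carrier (hom_module R F A) \<and>
    (\<exists>u\<in>mod_hom R F B. \<forall>x\<in>carrier F. p (u x) = z x \<and> i (w x) = u (\<delta> x))}"
  interpret HA: module R "hom_module R F A" by (rule hom_module_module[OF free_module_F s(1)])
  have lin: "linear_relation R (hom_module R F C) (hom_module R F A) \<rho>"
  proof (rule linear_relationI)
    show "(\<zero>\<^bsub>hom_module R F C\<^esub>, \<zero>\<^bsub>hom_module R F A\<^esub>) \<in> \<rho>"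
      unfolding \<rho>_def
      using HC.M.zero_closed HA.M.zero_closed mod_hom_zero[OF s(1,2,4)] mod_hom_zero[OF s(2,3,6)]
      by (auto simp: hom_module_simps(2) intro!: bexI[OF _ mod_hom_const_zero[OF s(2)]])
  next
    fix z w z' w' assume "(z, w) \<in> \<rho>" "(z', w') \<in> \<rho>"
    then obtain u u' where u: "u \<in> mod_hom R F B" "u' \<in> mod_hom R F B"
        "\<forall>x\<in>carrier F. p (u x) = z x \<and> i (w x) = u (\<delta> x)"
        "\<forall>x\<in>carrier F. p (u' x) = z' x \<and> i (w' x) = u' (\<delta> x)"
      and c: "z \<in> carrier (hom_module R F C)" "w \<in> carrier (hom_module R F A)"
        "z' \<in> carrier (hom_module R F C)" "w' \<in> carrier (hom_module R F A)"
      unfolding \<rho>_def by blast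
    have v: "w x \<in> carrier A" "w' x \<in> carrier A" "u x \<in> carrier B" "u' x \<in> carrier B" if "x \<in> carrier F" for x
      using that c u(1,2) mod_homD(1) by (fastforce simp: hom_module_simps(1))+
    show "(z \<oplus>\<^bsub>hom_module R F C\<^esub> z', w \<oplus>\<^bsub>hom_module R F A\<^esub> w') \<in> \<rho>"
      unfolding \<rho>_def mem_Collect_eq prod.case
      using HC.M.add.m_closed[OF c(1,3)] HA.M.add.m_closed[OF c(2,4)] u(3,4) v \<delta>(2)
      by (intro conjI bexI[OF _ mod_hom_add[OF free_module_F s(2) u(1,2)]])
         (simp_all add: hom_module_simps(3) mod_homD(2)[OF s(6)] mod_homD(2)[OF s(4)])
  next
    fix r z w assume r: "r \<in> carrier R" and "(z, w) \<in> \<rho>"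
    then obtain u where u: "u \<in> mod_hom R F B" "\<forall>x\<in>carrier F. p (u x) = z x \<and> i (w x) = u (\<delta> x)"
      and c: "z \<in> carrier (hom_module R F C)" "w \<in> carrier (hom_module R F A)"
      unfolding \<rho>_def by blast
    have v: "w x \<in> carrier A" "u x \<in> carrier B" if "x \<in> carrier F" for x
      using that c u(1) mod_homD(1) by (fastforce simp: hom_module_simps(1))+
    show "(r \<odot>\<^bsub>hom_module R F C\<^esub> z, r \<odot>\<^bsub>hom_module R F A\<^esub> w) \<in> \<rho>"
      unfolding \<rho>_def mem_Collect_eq prod.case
      using HC.smult_closed[OF r c(1)] HA.smult_closed[OF r c(2)] u(2) v \<delta>(2) r
      by (intro conjI bexI[OF _ mod_hom_smult[OF free_module_F s(2) u(1) r]])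
         (simp_all add: hom_module_simps(4) mod_homD(3)[OF s(6)] mod_homD(3)[OF s(4)])
  qed (auto simp: \<rho>_def)
  note \<beta> = hom_module_postcompose[OF free_module_F s(2,3,6)]
  note fg' = fg[unfolded fg_Ext_iff[OF s(1)] fg_Ext_iff[OF s(2)]]
  show ?thesis unfolding fg_Ext_iff[OF s(3)]
  proof (rule fg_modulo_exact[OF noeth _ _ _ fg' submodule_ext_cocycles[OF s(3)] submodule_ext_coboundaries[OF s(3)]
        submodule_ext_coboundaries[OF s(1)] submodule_ext_cocycles[OF s(1)] lin _ \<beta>])
    show "?\<beta> ` ext_cocycles R n N B \<subseteq> ext_cocycles R n N C"
      using ext_cocycles_postcompose[OF s(2,3,6)] by blast
    show "?\<beta> ` ext_coboundaries R n N B \<subseteq> ext_coboundaries R n N C"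
      using ext_coboundaries_postcompose[OF s(2,3,6)] by blast
    show "ext_cocycles R n N B \<subseteq> carrier (hom_module R F B)" using ext_cocyclesD(1) by blast
    show "ext_coboundaries R n N B \<subseteq> ext_cocycles R n N B" by (rule ext_coboundaries_subset[OF s(2)])
  next
    fix z assume z: "z \<in> ext_cocycles R n N C"
    note zD = ext_cocyclesD[OF z]
    obtain u where u: "u \<in> mod_hom R F B" "\<forall>x\<in>carrier F. p (u x) = z x"
      using free_module_lift[OF s(2,3,6,7) zD(2)[unfolded F_def]] unfolding F_def by blast
    \<comment> \<open>The lift \<open>u\<close> of a cocycle need not be a cocycle, but its
      coboundary dies in \<open>C\<close> and so comes from a cochain \<open>w\<close> with values
      in \<open>A\<close>.\<close>
    have "p (u (\<delta> x)) = \<zero>\<^bsub>C\<^esub>" if "x \<in> carrier F" for x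
      using that u(2) \<delta>(2) zD(3) by (simp add: \<delta>_def)
    from short_exact_factor[OF ses free_module_F mod_hom_compose[OF \<delta>(1) u(1)] this]
    obtain w where w: "w \<in> mod_hom R F A" "\<forall>x\<in>carrier F. i (w x) = u (\<delta> x)" by blast
    \<comment> \<open>Two consecutive differentials compose to zero and \<open>i\<close> is
      injective, so \<open>w\<close> is a cocycle one degree higher.\<close>
    have "restrict w (carrier F) \<in> ext_cocycles R (Suc n) N A"
    proof (rule ext_cocycles_restrict[OF w(1)])
      fix x assume x: "x \<in> carrier F"
      have x': "res_diff R N (Suc n) x \<in> carrier F" by (rule res_diff_closed[OF x])
      have "i (w (res_diff R N (Suc n) x)) = i \<zero>\<^bsub>A\<^esub>"
        using w(2) x' res_diff_res_diff[OF x, of n] mod_hom_zero[OF s(1,2,4)] mod_hom_zero[OF free_module_F s(2) u(1)]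
        by (simp add: \<delta>_def del: res_diff.simps)
      then show "w (res_diff R N (Suc n) x) = \<zero>\<^bsub>A\<^esub>"
        by (rule inj_onD[OF s(5)]) (use mod_homD(1)[OF w(1) x'] in auto)
    qed
    moreover have "(z, restrict w (carrier F)) \<in> \<rho>"
      unfolding \<rho>_def using zD(1) hom_module_restrict[OF free_module_F w(1)] u w(2) by auto
    ultimately show "\<exists>w\<in>ext_cocycles R (Suc n) N A. (z, w) \<in> \<rho>" by blast
  next
    fix z w assume z: "z \<in> ext_cocycles R n N C" and w: "w \<in> ext_coboundaries R (Suc n) N A" and "(z, w) \<in> \<rho>"
    then obtain u where u: "u \<in> mod_hom R F B" "\<forall>x\<in>carrier F. p (u x) = z x \<and> i (w x) = u (\<delta> x)"
      unfolding \<rho>_def by blast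
    obtain b where b: "b \<in> mod_hom R F A" "\<forall>x\<in>carrier F. w x = b (\<delta> x)"
      using ext_coboundaries_SucD(2)[OF w] unfolding \<delta>_def by blast
    \<comment> \<open>If the connecting class is the coboundary of \<open>b\<close>, then changing
      the lift \<open>u\<close> by \<open>b\<close> turns it into a cocycle. The change is invisible
      in \<open>C\<close>, so \<open>?y\<close> maps to \<open>z\<close> exactly and the coboundary
      term in the exactness condition can be zero.\<close>
    let ?y = "\<lambda>x. u x \<ominus>\<^bsub>B\<^esub> i (b x)"
    have c: "u x \<in> carrier B" "b x \<in> carrier A" "i (b x) \<in> carrier B" if "x \<in> carrier F" for x
      using mod_homD(1)[OF u(1) that] mod_homD(1)[OF b(1) that] mod_homD(1)[OF s(4)] by auto
    have y: "?y \<in> mod_hom R F B" by (rule mod_hom_diff[OF free_module_F s(2) u(1) mod_hom_compose[OF b(1) s(4)]])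
    have yc: "restrict ?y (carrier F) \<in> ext_cocycles R n N B"
    proof (rule ext_cocycles_restrict[OF y])
      fix x assume x: "x \<in> carrier F"
      have "i (b (\<delta> x)) = u (\<delta> x)" using x u(2) b(2) by metis
      then show "u (res_diff R N n x) \<ominus>\<^bsub>B\<^esub> i (b (res_diff R N n x)) = \<zero>\<^bsub>B\<^esub>"
        using c(1)[OF \<delta>(2)[OF x]] by (simp add: \<delta>_def a_minus_def B.M.r_neg)
    qed
    have py: "p (?y x) = z x" if x: "x \<in> carrier F" for x
    proof -
      have "p (?y x) = p (u x) \<oplus>\<^bsub>C\<^esub> \<ominus>\<^bsub>C\<^esub> p (i (b x))"
        using c[OF x] mod_homD(2)[OF s(6)] mod_hom_minus[OF s(2,3,6)] by (simp add: a_minus_def)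
      also have "\<dots> = z x" using s(8)[OF c(2)[OF x]] u(2) x mod_homD(1)[OF s(6) c(1)[OF x]] by simp
      finally show ?thesis .
    qed
    have "z = ?\<beta> (restrict ?y (carrier F)) \<oplus>\<^bsub>hom_module R F C\<^esub> \<zero>\<^bsub>hom_module R F C\<^esub>"
    proof (rule hom_module_eqI[OF ext_cocyclesD(1)[OF z]])
      show "?\<beta> (restrict ?y (carrier F)) \<oplus>\<^bsub>hom_module R F C\<^esub> \<zero>\<^bsub>hom_module R F C\<^esub> \<in> carrier (hom_module R F C)"
        by (rule HC.M.add.m_closed[OF mod_homD(1)[OF \<beta> ext_cocyclesD(1)[OF yc]] HC.M.zero_closed])
      show "z x = (?\<beta> (restrict ?y (carrier F)) \<oplus>\<^bsub>hom_module R F C\<^esub> \<zero>\<^bsub>hom_module R F C\<^esub>) x" if x: "x \<in> carrier F" for x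
        using x py[OF x] mod_homD(1)[OF ext_cocyclesD(2)[OF z] x] by (simp add: hom_module_simps)
    qed
    then show "\<exists>y\<in>ext_cocycles R n N B. \<exists>b\<in>ext_coboundaries R n N C. z = ?\<beta> y \<oplus>\<^bsub>hom_module R F C\<^esub> b"
      using yc HC.submoduleD(2)[OF submodule_ext_coboundaries[OF s(3)]] by blast
  qed (rule hom_module_module[OF free_module_F s(1)] hom_module_module[OF free_module_F s(2)]
      hom_module_module[OF free_module_F s(3)])+
qed

text \<open>The hypothesis \<open>inj\<close> says that Hom(N,C), the cocycles of degree 0 with
  values in \<open>C\<close>, vanishes. Then Ext^1(N,A) -> Ext^1(N,B) is injective, and a submodule
  of a finitely generated module over a Noetherian ring is finitely generated.\<close>

lemma Ext_1_fg_left: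
  assumes noeth: "noetherian_ring R" and ses: "short_exact R A i B p C"
    and inj: "\<And>c x. c \<in> mod_hom R F C \<Longrightarrow> (\<And>y. y \<in> carrier F \<Longrightarrow> c (res_diff R N 0 y) = \<zero>\<^bsub>C\<^esub>) \<Longrightarrow>
      x \<in> carrier F \<Longrightarrow> c x = \<zero>\<^bsub>C\<^esub>"
    and fg: "fg_module R (Ext R 1 N B)"
  shows "fg_module R (Ext R 1 N A)"
proof -
  note s = short_exactD[OF ses]
  interpret HA: module R "hom_module R F A" by (rule hom_module_module[OF free_module_F s(1)])
  let ?\<alpha> = "\<lambda>z. \<lambda>x\<in>carrier F. i (z x)"
  note \<alpha> = hom_module_postcompose[OF free_module_F s(1,2,4)]
  note subs = submodule_ext_cocycles[OF s(1)] submodule_ext_coboundaries[OF s(1)]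
        submodule_ext_coboundaries[OF s(2)] submodule_ext_cocycles[OF s(2)]
  \<comment> \<open>The exact sequence starts with zero: the identity is applied to the zero
    submodule modulo itself, so exactness amounts to injectivity.\<close>
  have id: "(\<lambda>z. z) \<in> mod_hom R (hom_module R F A) (hom_module R F A)" by (rule mod_homI) auto
  show ?thesis unfolding fg_Ext_iff[OF s(1)]
  proof (rule fg_modulo_exact[OF noeth _ _ _ fg_modulo_self[OF order_refl] fg[unfolded fg_Ext_iff[OF s(2)]]
        subs linear_relation_graph[OF _ _ \<alpha>] _ id])
    let ?O = "{\<zero>\<^bsub>hom_module R F A\<^esub>}"
    show "(\<lambda>z. z) ` ?O \<subseteq> ext_cocycles R 1 N A" using HA.submoduleD(2)[OF subs(1)] by blast
    show "(\<lambda>z. z) ` ?O \<subseteq> ext_coboundaries R 1 N A" using HA.submoduleD(2)[OF subs(2)] by blast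
    show "?O \<subseteq> carrier (hom_module R F A)" by auto
    show "\<exists>w\<in>ext_cocycles R 1 N B. (z, w) \<in> {(z, ?\<alpha> z) |z. z \<in> carrier (hom_module R F A)}"
      if "z \<in> ext_cocycles R 1 N A" for z
      using ext_cocycles_postcompose[OF s(1,2,4) that] ext_cocyclesD(1)[OF that] by blast
    fix z w assume z: "z \<in> ext_cocycles R 1 N A" and w: "w \<in> ext_coboundaries R 1 N B"
      and "(z, w) \<in> {(z, ?\<alpha> z) |z. z \<in> carrier (hom_module R F A)}"
    then have wz: "w = ?\<alpha> z" by blast
    note zD = ext_cocyclesD[OF z]
    obtain b where b: "b \<in> mod_hom R F B" "\<forall>x\<in>carrier F. w x = b (res_diff R N 0 x)"
      using ext_coboundaries_SucD(2)[of w 0 B] w by auto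
    have ib: "b (res_diff R N 0 x) = i (z x)" if "x \<in> carrier F" for x
      using that b(2) wz by (metis restrict_apply')
    \<comment> \<open>The coboundary of \<open>b\<close> takes values in \<open>A\<close>, so
      \<open>b\<close> followed by \<open>p\<close> is a cocycle of degree 0 and vanishes by
      \<open>inj\<close>. Hence \<open>b\<close> itself comes from \<open>A\<close> and already
      bounds \<open>z\<close> there.\<close>
    have "p (b x) = \<zero>\<^bsub>C\<^esub>" if "x \<in> carrier F" for x
    proof (rule inj[OF mod_hom_compose[OF b(1) s(6)] _ that])
      show "p (b (res_diff R N 0 y)) = \<zero>\<^bsub>C\<^esub>" if "y \<in> carrier F" for y
        using ib[OF that] s(8) mod_homD(1)[OF zD(2) that] by simp
    qed
    from short_exact_factor[OF ses free_module_F b(1) this]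
    obtain a where a: "a \<in> mod_hom R F A" "\<forall>x\<in>carrier F. i (a x) = b x" by blast
    have za: "z x = a (res_diff R N 0 x)" if x: "x \<in> carrier F" for x
    proof (rule inj_onD[OF s(5)])
      have x': "res_diff R N 0 x \<in> carrier F" by (rule res_diff_closed[OF x])
      show "i (z x) = i (a (res_diff R N 0 x))" using ib[OF x] a(2) x' by metis
      show "z x \<in> carrier A" "a (res_diff R N 0 x) \<in> carrier A"
        using mod_homD(1)[OF zD(2) x] mod_homD(1)[OF a(1) x'] by auto
    qed
    have "z = (\<lambda>x\<in>carrier F. a (res_diff R N 0 x))"
      by (rule hom_module_eqI[OF zD(1) hom_module_restrict[OF free_module_F mod_hom_compose[OF res_diff_hom a(1)]]])
         (use za in simp)
    then have "z \<in> ext_coboundaries R 1 N A" using ext_coboundaries_restrict[OF a(1), of 0] by simp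
    then show "\<exists>y\<in>?O. \<exists>b\<in>ext_coboundaries R 1 N A. z = y \<oplus>\<^bsub>hom_module R F A\<^esub> b"
      using HA.M.l_zero[OF zD(1)] by (intro bexI[of _ "\<zero>\<^bsub>hom_module R F A\<^esub>"] bexI[of _ z]) simp_all
  qed (rule hom_module_module[OF free_module_F s(1)] hom_module_module[OF free_module_F s(2)] order_refl)+
qed

end

section \<open>Baer's criterion\<close>

lemma self_module_simps [simp]:
  "carrier (self_module R) = carrier R" "\<zero>\<^bsub>self_module R\<^esub> = \<zero>\<^bsub>R\<^esub>"
  "x \<oplus>\<^bsub>self_module R\<^esub> y = x \<oplus>\<^bsub>R\<^esub> y" "r \<odot>\<^bsub>self_module R\<^esub> x = r \<otimes>\<^bsub>R\<^esub> x"
  by (simp_all add: self_module_def)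

lemma self_module_module:
  assumes "cring R" shows "module R (self_module R)"
proof -
  interpret cring R by fact
  show ?thesis
  proof (rule moduleI)
    show "abelian_group (self_module R)"
      by (rule abelian_groupI) (auto simp: a_ac intro!: bexI[of _ "\<ominus>\<^bsub>R\<^esub> x" for x] l_neg)
  qed (auto simp: is_cring l_distr r_distr m_assoc)
qed

text \<open>The homomorphisms on ideals are encoded by their graphs.\<close>

definition baer_module :: "('r, 'k) ring_scheme \<Rightarrow> ('r, 'e) module \<Rightarrow> bool"
  where "baer_module R E \<longleftrightarrow> module R E \<and>
    (\<forall>\<rho>. linear_relation R (self_module R) E \<rho> \<and> (\<forall>y. (\<zero>\<^bsub>R\<^esub>, y) \<in> \<rho> \<longrightarrow> y = \<zero>\<^bsub>E\<^esub>) \<longrightarrow>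
      (\<exists>e\<in>carrier E. \<forall>(r, y)\<in>\<rho>. y = r \<odot>\<^bsub>E\<^esub> e))"

lemma baer_moduleD:
  assumes "baer_module R E" "linear_relation R (self_module R) E \<rho>" "\<And>y. (\<zero>\<^bsub>R\<^esub>, y) \<in> \<rho> \<Longrightarrow> y = \<zero>\<^bsub>E\<^esub>"
  shows "\<exists>e\<in>carrier E. \<forall>(r, y)\<in>\<rho>. y = r \<odot>\<^bsub>E\<^esub> e"
  using assms unfolding baer_module_def by simp

text \<open>\<open>injective_module\<close> only admits test modules with elements in
  \<open>'r + 'e\<close>. The ring and the ideal \<open>Domain\<close> \<rho> are copied into that
  type, the extension is taken there, and its value at the copy of 1 is the required
  element.\<close>

lemma injective_imp_baer_module:
  fixes R :: "('r, 'k) ring_scheme" and E :: "('r, 'e) module"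
  assumes E: "injective_module R E"
  shows "baer_module R E"
  unfolding baer_module_def
proof (intro conjI allI impI; (elim conjE)?)
  show mE: "module R E" using E unfolding injective_module_def by blast
  interpret E: module R E by (rule mE)
  fix \<rho> assume \<rho>: "linear_relation R (self_module R) E \<rho>" and single: "\<forall>y. (\<zero>\<^bsub>R\<^esub>, y) \<in> \<rho> \<longrightarrow> y = \<zero>\<^bsub>E\<^esub>"
  let ?S = "self_module R"
  have mS: "module R ?S" by (rule self_module_module[OF E.R.is_cring])
  interpret S: module R ?S by (rule mS)
  note D = linear_relationD[OF \<rho>]
  let ?D = "?S\<lparr>carrier := Domain \<rho>\<rparr>"
  have "submodule (Domain \<rho>) R ?S"
  proof (rule S.submodule_closedI)
    show "Domain \<rho> \<subseteq> carrier ?S" using D(1) by blast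
    show "\<zero>\<^bsub>?S\<^esub> \<in> Domain \<rho>" using D(3) by blast
    show "x \<oplus>\<^bsub>?S\<^esub> y \<in> Domain \<rho>" if "x \<in> Domain \<rho>" "y \<in> Domain \<rho>" for x y using that D(4) by blast
    show "r \<odot>\<^bsub>?S\<^esub> x \<in> Domain \<rho>" if "r \<in> carrier R" "x \<in> Domain \<rho>" for r x using that D(5) by blast
  qed
  then have mD: "module R ?D" by (rule submodule.submodule_is_module[OF _ mS])
  define \<phi> where "\<phi> r = (SOME y. (r, y) \<in> \<rho>)" for r
  have \<phi>\<rho>: "(r, \<phi> r) \<in> \<rho>" if "r \<in> Domain \<rho>" for r
    unfolding \<phi>_def by (rule someI_ex) (use that in blast)
  have \<phi>_eq: "\<phi> r = y" if y: "(r, y) \<in> \<rho>" for r y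
    by (rule linear_relation_single_valued[OF mS mE \<rho> _ \<phi>\<rho> y]) (use single y in auto)
  have \<phi>: "\<phi> \<in> mod_hom R ?D E"
  proof (rule mod_homI)
    show "\<phi> x \<in> carrier E" if "x \<in> carrier ?D" for x using \<phi>\<rho>[of x] D(2) that by auto
    show "\<phi> (x \<oplus>\<^bsub>?D\<^esub> y) = \<phi> x \<oplus>\<^bsub>E\<^esub> \<phi> y" if "x \<in> carrier ?D" "y \<in> carrier ?D" for x y
      using \<phi>_eq[OF D(4)[OF \<phi>\<rho>[of x] \<phi>\<rho>[of y]]] that by simp
    show "\<phi> (r \<odot>\<^bsub>?D\<^esub> x) = r \<odot>\<^bsub>E\<^esub> \<phi> x" if "r \<in> carrier R" "x \<in> carrier ?D" for r x
      using \<phi>_eq[OF D(5)[OF that(1) \<phi>\<rho>[of x]]] that by simp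
  qed
  let ?h = "Inl :: 'r \<Rightarrow> 'r + 'e"
  have inj: "inj_on ?h X" for X by (rule inj_onI) simp
  note tS = transport_facts[OF mS inj] and tD = transport_facts[OF mD inj]
  \<comment> \<open>The inclusion of the ideal into the ring, conjugated by the two copies.\<close>
  let ?j = "\<lambda>x. ?h (inv_into (carrier ?D) ?h x)"
  have incl: "(\<lambda>x. x) \<in> mod_hom R ?D ?S" by (rule mod_homI) (use D(1) in auto)
  have j: "?j \<in> mod_hom R (transport ?h ?D) (transport ?h ?S)"
    by (rule mod_hom_compose[OF mod_hom_compose[OF tD(4) incl] tS(2)])
  have jx: "?j (?h r) = ?h r" "inv_into (carrier ?D) ?h (?h r) = r" if "r \<in> Domain \<rho>" for r
    using that inv_into_f_f[OF inj, of r "Domain \<rho>"] by simp_all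
  have jinj: "inj_on ?j (carrier (transport ?h ?D))"
  proof (rule inj_onI)
    fix a b assume ab: "a \<in> carrier (transport ?h ?D)" "b \<in> carrier (transport ?h ?D)" "?j a = ?j b"
    obtain r s where "a = ?h r" "b = ?h s" "r \<in> Domain \<rho>" "s \<in> Domain \<rho>" using ab(1,2) tD(3) by auto
    then show "a = b" using ab(3) jx(1) by metis
  qed
  obtain g where g: "g \<in> mod_hom R (transport ?h ?S) E"
    "\<forall>x\<in>carrier (transport ?h ?D). g (?j x) = \<phi> (inv_into (carrier ?D) ?h x)"
    using E j jinj tS(1) tD(1) mod_hom_compose[OF tD(4) \<phi>] unfolding injective_module_def by blast
  show "\<exists>e\<in>carrier E. \<forall>(r, y)\<in>\<rho>. y = r \<odot>\<^bsub>E\<^esub> e"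
  proof (rule bexI[of _ "g (?h \<one>\<^bsub>R\<^esub>)"])
    have one: "?h \<one>\<^bsub>R\<^esub> \<in> carrier (transport ?h ?S)" using tS(3) by simp
    then show "g (?h \<one>\<^bsub>R\<^esub>) \<in> carrier E" by (rule mod_homD(1)[OF g(1)])
    show "\<forall>(r, y)\<in>\<rho>. y = r \<odot>\<^bsub>E\<^esub> g (?h \<one>\<^bsub>R\<^esub>)"
    proof clarify
      fix r y assume ry: "(r, y) \<in> \<rho>"
      then have r: "r \<in> Domain \<rho>" "r \<in> carrier R" using D(1) by auto
      have "?h r \<in> carrier (transport ?h ?D)" using r tD(3) by simp
      then have "g (?h r) = y" using g(2) jx[OF r(1)] \<phi>_eq[OF ry] by metis
      moreover have "?h r = r \<odot>\<^bsub>transport ?h ?S\<^esub> ?h \<one>\<^bsub>R\<^esub>"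
        using mod_homD(3)[OF tS(2) r(2), of "\<one>\<^bsub>R\<^esub>"] r(2) by simp
      ultimately show "y = r \<odot>\<^bsub>E\<^esub> g (?h \<one>\<^bsub>R\<^esub>)"
        using mod_homD(3)[OF g(1) r(2) one] by simp
    qed
  qed
qed

text \<open>Baer's criterion: \<open>S0\<close> is the graph of a partial map, and Zorn's lemma on
  graphs gives a maximal extension, which one more element could always enlarge. The type of
  \<open>B\<close> is arbitrary, which frees injectivity from the type fixed in
  \<open>injective_module\<close>.\<close>

lemma baer_module_extension:
  fixes R :: "('r, 'k) ring_scheme" and B :: "('r, 'b) module" and E :: "('r, 'e) module"
  assumes E: "baer_module R E" and mB: "module R B" and S0: "linear_relation R B E S0"
    and single: "\<And>y. (\<zero>\<^bsub>B\<^esub>, y) \<in> S0 \<Longrightarrow> y = \<zero>\<^bsub>E\<^esub>"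
  shows "\<exists>g\<in>mod_hom R B E. \<forall>(b, y)\<in>S0. g b = y"
proof -
  have mE: "module R E" using E unfolding baer_module_def by blast
  interpret B: module R B by fact
  interpret E: module R E by (rule mE)
  define good where "good G \<longleftrightarrow> linear_relation R B E G \<and> (\<forall>y. (\<zero>\<^bsub>B\<^esub>, y) \<in> G \<longrightarrow> y = \<zero>\<^bsub>E\<^esub>)" for G
  let ?\<A> = "{G. good G \<and> S0 \<subseteq> G}"
  have "\<exists>G\<in>?\<A>. \<forall>H\<in>?\<A>. G \<subseteq> H \<longrightarrow> H = G"
  proof (rule subset_Zorn_nonempty)
    have "S0 \<in> ?\<A>" using S0 single unfolding good_def by simp
    then show "?\<A> \<noteq> {}" by blast
    fix C assume C: "C \<noteq> {}" "subset.chain ?\<A> C"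
    have g: "good G" "S0 \<subseteq> G" if "G \<in> C" for G using C(2) that unfolding subset.chain_def by auto
    note lin = g(1)[unfolded good_def, THEN conjunct1]
    have "linear_relation R B E (\<Union>C)"
    proof (rule linear_relationI)
      show "(\<zero>\<^bsub>B\<^esub>, \<zero>\<^bsub>E\<^esub>) \<in> \<Union>C" using C(1) linear_relationD(3)[OF lin] by blast
      show "x \<in> carrier B \<and> y \<in> carrier E" if "(x, y) \<in> \<Union>C" for x y
        using that linear_relationD(1,2)[OF lin] by blast
      show "(r \<odot>\<^bsub>B\<^esub> x, r \<odot>\<^bsub>E\<^esub> y) \<in> \<Union>C" if "r \<in> carrier R" "(x, y) \<in> \<Union>C" for r x y
        using that linear_relationD(5)[OF lin] by blast
      fix x y x' y' assume xy: "(x, y) \<in> \<Union>C" "(x', y') \<in> \<Union>C"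
      then obtain H where "H \<in> C" "(x, y) \<in> H" "(x', y') \<in> H"
        using C(2) unfolding subset_chain_def by blast
      then show "(x \<oplus>\<^bsub>B\<^esub> x', y \<oplus>\<^bsub>E\<^esub> y') \<in> \<Union>C" using linear_relationD(4)[OF lin] by blast
    qed
    moreover have "y = \<zero>\<^bsub>E\<^esub>" if "(\<zero>\<^bsub>B\<^esub>, y) \<in> \<Union>C" for y using that g(1) unfolding good_def by blast
    ultimately have "good (\<Union>C)" unfolding good_def by blast
    moreover have "S0 \<subseteq> \<Union>C" using C(1) g(2) by blast
    ultimately show "\<Union>C \<in> ?\<A>" by simp
  qed
  then obtain G where G: "good G" "S0 \<subseteq> G" and max0: "\<forall>H\<in>?\<A>. G \<subseteq> H \<longrightarrow> H = G" by blast
  have max: "H = G" if "good H" "G \<subseteq> H" for H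
  proof -
    have "S0 \<subseteq> H" using G(2) that(2) by (rule order_trans)
    then show ?thesis using max0 that by simp
  qed
  have lin: "linear_relation R B E G" and sG: "\<And>y. (\<zero>\<^bsub>B\<^esub>, y) \<in> G \<Longrightarrow> y = \<zero>\<^bsub>E\<^esub>"
    using G(1) unfolding good_def by auto
  note GD = linear_relationD[OF lin]
  have Gf: "y = y'" if "(x, y) \<in> G" "(x, y') \<in> G" for x y y'
    by (rule linear_relation_single_valued[OF mB mE lin sG that])
  have "\<exists>y. (x, y) \<in> G" if x: "x \<in> carrier B" for x
  proof -
    \<comment> \<open>The domain of this relation is the ideal of all r with r x in the domain of
      \<open>G\<close>, and \<open>G\<close> prescribes the value at r x. The Baer property yields
      an element \<open>e\<close> that can serve as the value at \<open>x\<close>.\<close>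
    let ?\<tau> = "{(r, y). r \<in> carrier R \<and> (r \<odot>\<^bsub>B\<^esub> x, y) \<in> G}"
    have "linear_relation R (self_module R) E ?\<tau>"
    proof (rule linear_relationI)
      show "(\<zero>\<^bsub>self_module R\<^esub>, \<zero>\<^bsub>E\<^esub>) \<in> ?\<tau>" using GD(3) x by simp
      show "(r \<oplus>\<^bsub>self_module R\<^esub> r', y \<oplus>\<^bsub>E\<^esub> y') \<in> ?\<tau>" if "(r, y) \<in> ?\<tau>" "(r', y') \<in> ?\<tau>" for r y r' y'
        using that GD(4) x by (simp add: B.smult_l_distr)
      show "(s \<odot>\<^bsub>self_module R\<^esub> r, s \<odot>\<^bsub>E\<^esub> y) \<in> ?\<tau>" if "s \<in> carrier R" "(r, y) \<in> ?\<tau>" for s r y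
        using that GD(5) x by (simp add: B.smult_assoc1)
    qed (use GD(2) in auto)
    moreover have "y = \<zero>\<^bsub>E\<^esub>" if "(\<zero>\<^bsub>R\<^esub>, y) \<in> ?\<tau>" for y using that sG x by simp
    ultimately obtain e where e: "e \<in> carrier E" "\<forall>(r, y)\<in>?\<tau>. y = r \<odot>\<^bsub>E\<^esub> e"
      using baer_moduleD[OF E, of ?\<tau>] by blast
    define H where "H = {(b \<oplus>\<^bsub>B\<^esub> r \<odot>\<^bsub>B\<^esub> x, y \<oplus>\<^bsub>E\<^esub> r \<odot>\<^bsub>E\<^esub> e) | b y r. (b, y) \<in> G \<and> r \<in> carrier R}"
    have HI: "(b \<oplus>\<^bsub>B\<^esub> r \<odot>\<^bsub>B\<^esub> x, y \<oplus>\<^bsub>E\<^esub> r \<odot>\<^bsub>E\<^esub> e) \<in> H" if "(b, y) \<in> G" "r \<in> carrier R" for b y r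
      using that unfolding H_def by blast
    have HE: "\<exists>b y r. p = b \<oplus>\<^bsub>B\<^esub> r \<odot>\<^bsub>B\<^esub> x \<and> q = y \<oplus>\<^bsub>E\<^esub> r \<odot>\<^bsub>E\<^esub> e \<and> (b, y) \<in> G \<and> r \<in> carrier R"
      if "(p, q) \<in> H" for p q using that unfolding H_def by blast
    have GH: "G \<subseteq> H"
    proof clarify
      fix b y assume bG: "(b, y) \<in> G"
      show "(b, y) \<in> H" using HI[OF bG, of "\<zero>\<^bsub>R\<^esub>"] GD(1,2)[OF bG] x e(1) by simp
    qed
    have "linear_relation R B E H"
    proof (rule linear_relationI)
      show "(\<zero>\<^bsub>B\<^esub>, \<zero>\<^bsub>E\<^esub>) \<in> H" using GH GD(3) by blast
      show "p \<in> carrier B \<and> q \<in> carrier E" if "(p, q) \<in> H" for p q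
        using HE[OF that] GD(1,2) x e(1) by auto
    next
      fix p q p' q' assume "(p, q) \<in> H" "(p', q') \<in> H"
      then obtain b y r b' y' r' where *: "p = b \<oplus>\<^bsub>B\<^esub> r \<odot>\<^bsub>B\<^esub> x" "q = y \<oplus>\<^bsub>E\<^esub> r \<odot>\<^bsub>E\<^esub> e" "(b, y) \<in> G" "r \<in> carrier R"
        "p' = b' \<oplus>\<^bsub>B\<^esub> r' \<odot>\<^bsub>B\<^esub> x" "q' = y' \<oplus>\<^bsub>E\<^esub> r' \<odot>\<^bsub>E\<^esub> e" "(b', y') \<in> G" "r' \<in> carrier R" using HE by meson
      have "p \<oplus>\<^bsub>B\<^esub> p' = (b \<oplus>\<^bsub>B\<^esub> b') \<oplus>\<^bsub>B\<^esub> (r \<oplus>\<^bsub>R\<^esub> r') \<odot>\<^bsub>B\<^esub> x"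
        using GD(1)[OF *(3)] GD(1)[OF *(7)] x *(4,8) by (simp add: *(1,5) B.smult_l_distr B.M.a_ac)
      moreover have "q \<oplus>\<^bsub>E\<^esub> q' = (y \<oplus>\<^bsub>E\<^esub> y') \<oplus>\<^bsub>E\<^esub> (r \<oplus>\<^bsub>R\<^esub> r') \<odot>\<^bsub>E\<^esub> e"
        using GD(2)[OF *(3)] GD(2)[OF *(7)] e(1) *(4,8) by (simp add: *(2,6) E.smult_l_distr E.M.a_ac)
      ultimately show "(p \<oplus>\<^bsub>B\<^esub> p', q \<oplus>\<^bsub>E\<^esub> q') \<in> H"
        using HI[OF GD(4)[OF *(3,7)] B.R.a_closed[OF *(4,8)]] by simp
    next
      fix s p q assume s: "s \<in> carrier R" and "(p, q) \<in> H"
      then obtain b y r where *: "p = b \<oplus>\<^bsub>B\<^esub> r \<odot>\<^bsub>B\<^esub> x" "q = y \<oplus>\<^bsub>E\<^esub> r \<odot>\<^bsub>E\<^esub> e" "(b, y) \<in> G" "r \<in> carrier R"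
        using HE by meson
      have "s \<odot>\<^bsub>B\<^esub> p = s \<odot>\<^bsub>B\<^esub> b \<oplus>\<^bsub>B\<^esub> (s \<otimes>\<^bsub>R\<^esub> r) \<odot>\<^bsub>B\<^esub> x"
        using GD(1)[OF *(3)] x s *(4) by (simp add: *(1) B.smult_r_distr B.smult_assoc1)
      moreover have "s \<odot>\<^bsub>E\<^esub> q = s \<odot>\<^bsub>E\<^esub> y \<oplus>\<^bsub>E\<^esub> (s \<otimes>\<^bsub>R\<^esub> r) \<odot>\<^bsub>E\<^esub> e"
        using GD(2)[OF *(3)] e(1) s *(4) by (simp add: *(2) E.smult_r_distr E.smult_assoc1)
      ultimately show "(s \<odot>\<^bsub>B\<^esub> p, s \<odot>\<^bsub>E\<^esub> q) \<in> H"
        using HI[OF GD(5)[OF s *(3)] B.R.m_closed[OF s *(4)]] by simp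
    qed
    \<comment> \<open>If b + r x = 0, then b = (-r) x lies in the domain of \<open>G\<close>, where
      the choice of \<open>e\<close> forces the value (-r) e. The two contributions to
      \<open>q\<close> cancel.\<close>
    moreover have "q = \<zero>\<^bsub>E\<^esub>" if q: "(\<zero>\<^bsub>B\<^esub>, q) \<in> H" for q
    proof -
      obtain b y r where *: "\<zero>\<^bsub>B\<^esub> = b \<oplus>\<^bsub>B\<^esub> r \<odot>\<^bsub>B\<^esub> x" "q = y \<oplus>\<^bsub>E\<^esub> r \<odot>\<^bsub>E\<^esub> e" "(b, y) \<in> G" "r \<in> carrier R"
        using HE[OF q] by blast
      have rx: "r \<odot>\<^bsub>B\<^esub> x \<in> carrier B" using *(4) x by simp
      have "\<ominus>\<^bsub>B\<^esub> (r \<odot>\<^bsub>B\<^esub> x) = b"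
        by (rule B.M.minus_equality[OF *(1)[symmetric] rx GD(1)[OF *(3)]])
      then have "(\<ominus>\<^bsub>R\<^esub> r) \<odot>\<^bsub>B\<^esub> x = b" using *(4) x by (simp add: B.smult_l_minus)
      then have "(\<ominus>\<^bsub>R\<^esub> r, y) \<in> ?\<tau>" using *(3,4) by simp
      then have "y = (\<ominus>\<^bsub>R\<^esub> r) \<odot>\<^bsub>E\<^esub> e" using e(2) by blast
      then show ?thesis using *(2,4) e(1) by (simp add: E.smult_l_minus E.M.l_neg)
    qed
    ultimately have "good H" unfolding good_def by blast
    then have "H = G" using GH by (rule max)
    then show ?thesis
      using HI[OF GD(3), of "\<one>\<^bsub>R\<^esub>"] x e(1) by auto
  qed
  then obtain g where g: "\<And>x. x \<in> carrier B \<Longrightarrow> (x, g x) \<in> G" by metis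
  have "g \<in> mod_hom R B E"
  proof (rule mod_homI)
    show "g x \<in> carrier E" if "x \<in> carrier B" for x using GD(2)[OF g[OF that]] .
    show "g (x \<oplus>\<^bsub>B\<^esub> y) = g x \<oplus>\<^bsub>E\<^esub> g y" if "x \<in> carrier B" "y \<in> carrier B" for x y
      by (rule Gf[OF g GD(4)[OF g g]]) (use that in auto)
    show "g (r \<odot>\<^bsub>B\<^esub> x) = r \<odot>\<^bsub>E\<^esub> g x" if "r \<in> carrier R" "x \<in> carrier B" for r x
      by (rule Gf[OF g GD(5)[OF _ g]]) (use that in auto)
  qed
  moreover have "\<forall>(b, y)\<in>S0. g b = y"
  proof clarify
    fix b y assume "(b, y) \<in> S0"
    then have bG: "(b, y) \<in> G" using G(2) by blast
    show "g b = y" by (rule Gf[OF g[OF GD(1)[OF bG]] bG])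
  qed
  ultimately show ?thesis by blast
qed

text \<open>These modules are zero. By exactness of the resolution a cocycle vanishes on the kernel
  of the preceding differential and thus defines a map on its image; extending that map to all of F
  exhibits the cocycle as a coboundary.\<close>

lemma baer_module_Ext_fg:
  fixes R :: "('r, 'k) ring_scheme" and N :: "('r, 'n) module" and Q :: "('r, 'q) module"
  assumes Q: "baer_module R Q" and N: "module R N"
  shows "fg_module R (Ext R (Suc n) N Q)"
proof (rule Ext_fg_trivial[OF N])
  show mQ: "module R Q" using Q unfolding baer_module_def by blast
  let ?F = "free_module R :: ('r, ('r, 'n) res_basis \<Rightarrow> 'r) module"
  have mF: "module R ?F" by (rule free_module_F[OF N])
  interpret F: module R ?F by (rule mF)
  interpret Q: module R Q by (rule mQ)
  let ?\<delta> = "res_diff R N n"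
  note \<delta> = res_diff_hom[OF N, of n]
  show "ext_cocycles R (Suc n) N Q \<subseteq> ext_coboundaries R (Suc n) N Q"
  proof
    fix z assume z: "z \<in> ext_cocycles R (Suc n) N Q"
    note zD = ext_cocyclesD[OF N z]
    let ?\<rho> = "{(?\<delta> x, z x) | x. x \<in> carrier ?F}"
    have lin: "linear_relation R ?F Q ?\<rho>"
    proof (rule linear_relationI)
      show "(\<zero>\<^bsub>?F\<^esub>, \<zero>\<^bsub>Q\<^esub>) \<in> ?\<rho>"
        using mod_hom_zero[OF mF mF \<delta>] mod_hom_zero[OF mF mQ zD(2)] F.M.zero_closed by force
      show "x \<in> carrier ?F \<and> y \<in> carrier Q" if "(x, y) \<in> ?\<rho>" for x y
        using that mod_homD(1)[OF \<delta>] mod_homD(1)[OF zD(2)] by blast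
    next
      fix x y x' y' assume "(x, y) \<in> ?\<rho>" "(x', y') \<in> ?\<rho>"
      then obtain a b where *: "x = ?\<delta> a" "y = z a" "x' = ?\<delta> b" "y' = z b" "a \<in> carrier ?F" "b \<in> carrier ?F" by blast
      show "(x \<oplus>\<^bsub>?F\<^esub> x', y \<oplus>\<^bsub>Q\<^esub> y') \<in> ?\<rho>"
        unfolding *(1-4) mod_homD(2)[OF \<delta> *(5,6), symmetric] mod_homD(2)[OF zD(2) *(5,6), symmetric]
        using F.M.add.m_closed[OF *(5,6)] by blast
    next
      fix r x y assume r: "r \<in> carrier R" and "(x, y) \<in> ?\<rho>"
      then obtain a where *: "x = ?\<delta> a" "y = z a" "a \<in> carrier ?F" by blast
      show "(r \<odot>\<^bsub>?F\<^esub> x, r \<odot>\<^bsub>Q\<^esub> y) \<in> ?\<rho>"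
        unfolding *(1,2) mod_homD(3)[OF \<delta> r *(3), symmetric] mod_homD(3)[OF zD(2) r *(3), symmetric]
        using F.smult_closed[OF r *(3)] by blast
    qed
    \<comment> \<open>Exactness makes the relation single-valued: an argument killed by the
      differential is itself a boundary, and the cocycle vanishes on boundaries.\<close>
    have single: "y = \<zero>\<^bsub>Q\<^esub>" if y: "(\<zero>\<^bsub>?F\<^esub>, y) \<in> ?\<rho>" for y
    proof -
      obtain x where x: "(\<zero>\<^bsub>?F\<^esub>, y) = (?\<delta> x, z x)" "x \<in> carrier ?F" using y by blast
      have "x \<in> a_kernel ?F ?F ?\<delta>" using x(2) Pair_inject[OF x(1)] by (metis a_kernel_iff)
      then obtain u where "u \<in> carrier ?F" "x = res_diff R N (Suc n) u"
        unfolding free_resolution(5)[OF N, symmetric] by blast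
      then show ?thesis using zD(3) x(1) by simp
    qed
    obtain g where g: "g \<in> mod_hom R ?F Q" "\<forall>(b, y)\<in>?\<rho>. g b = y"
      using baer_module_extension[OF Q mF lin single] by blast
    have gz: "z x = g (?\<delta> x)" if x: "x \<in> carrier ?F" for x
    proof -
      have "(?\<delta> x, z x) \<in> ?\<rho>" using x by blast
      then show ?thesis using g(2) by fast
    qed
    have "z = (\<lambda>x\<in>carrier ?F. g (?\<delta> x))"
      by (rule hom_module_eqI[OF zD(1) hom_module_restrict[OF mF mod_hom_compose[OF \<delta> g(1)]]])
         (simp add: gz)
    then show "z \<in> ext_coboundaries R (Suc n) N Q" using ext_coboundaries_restrict[OF N g(1), of n] by simp
  qed
qed

section \<open>Torsion over a Noetherian ring\<close>

text \<open>The maximal condition, drawn by Zorn's lemma from the fact that every chain of ideals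
  contains its union. It supplies each Noetherian induction on ideals below.\<close>

lemma (in noetherian_ring) ideal_family_maximal:
  assumes "\<C> \<noteq> {}" "\<And>I. I \<in> \<C> \<Longrightarrow> ideal I R"
  shows "\<exists>I\<in>\<C>. \<forall>J\<in>\<C>. I \<subseteq> J \<longrightarrow> J = I"
proof (rule subset_Zorn_nonempty[OF assms(1)])
  fix C assume C: "C \<noteq> {}" "subset.chain \<C> C"
  have sub: "C \<subseteq> \<C>" using C(2) by (simp add: subset_chain_def)
  then have "C \<subseteq> {I. ideal I R}" using assms(2) by auto
  then have "subset.chain {I. ideal I R} C" using C(2) by (simp add: subset_chain_def)
  from ideal_chain_is_trivial[OF C(1) this] show "\<Union>C \<in> \<C>" using sub by (rule rev_subsetD)
qed

section \<open>Colon ideals, sums and powers of ideals\<close>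

lemma (in cring) ideal_closed:
  assumes "ideal I R"
  shows "I \<subseteq> carrier R" "\<zero> \<in> I" "x \<in> I \<Longrightarrow> y \<in> I \<Longrightarrow> x \<oplus> y \<in> I" "r \<in> carrier R \<Longrightarrow> x \<in> I \<Longrightarrow> r \<otimes> x \<in> I"
proof -
  interpret ideal I R by fact
  show "I \<subseteq> carrier R" "\<zero> \<in> I" "x \<in> I \<Longrightarrow> y \<in> I \<Longrightarrow> x \<oplus> y \<in> I" "r \<in> carrier R \<Longrightarrow> x \<in> I \<Longrightarrow> r \<otimes> x \<in> I"
    using Icarr I_l_closed by auto
qed

lemma (in cring) ideal_colon:
  assumes "ideal J R" "a \<in> carrier R"
  shows "ideal {r \<in> carrier R. r \<otimes> a \<in> J} R"
  by (rule cring_idealI) (use ideal_closed[OF assms(1)] assms(2) in \<open>auto simp: l_distr m_assoc\<close>)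

lemma (in cring) ideal_adjoin:
  assumes "ideal J R" "a \<in> carrier R"
  shows "ideal {c \<oplus> r \<otimes> a | c r. c \<in> J \<and> r \<in> carrier R} R" (is "ideal ?K R")
    and "J \<subseteq> {c \<oplus> r \<otimes> a | c r. c \<in> J \<and> r \<in> carrier R}"
    and "a \<in> {c \<oplus> r \<otimes> a | c r. c \<in> J \<and> r \<in> carrier R}"
proof -
  note J = ideal_closed[OF assms(1)]
  show JK: "J \<subseteq> ?K"
  proof
    fix c assume c: "c \<in> J"
    then have "c = c \<oplus> \<zero> \<otimes> a" using J(1) assms(2) by auto
    then show "c \<in> ?K" using c by blast
  qed
  have "a = \<zero> \<oplus> \<one> \<otimes> a" using assms(2) by simp
  then show "a \<in> ?K" using J(2) by blast
  show "ideal ?K R"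
  proof (rule cring_idealI)
    show "?K \<subseteq> carrier R" using J(1) assms(2) by auto
    show "\<zero> \<in> ?K" using JK J(2) by blast
  next
    fix x y assume "x \<in> ?K" "y \<in> ?K"
    then obtain c r c' r' where *: "x = c \<oplus> r \<otimes> a" "y = c' \<oplus> r' \<otimes> a" "c \<in> J" "r \<in> carrier R" "c' \<in> J" "r' \<in> carrier R"
      by blast
    moreover have "c \<in> carrier R" "c' \<in> carrier R" using * J(1) by auto
    ultimately have "x \<oplus> y = (c \<oplus> c') \<oplus> (r \<oplus> r') \<otimes> a" using assms(2) by (simp add: l_distr a_ac)
    then show "x \<oplus> y \<in> ?K" using * J(3) by blast
  next
    fix s x assume s: "s \<in> carrier R" and "x \<in> ?K"
    then obtain c r where *: "x = c \<oplus> r \<otimes> a" "c \<in> J" "r \<in> carrier R" by blast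
    moreover have "c \<in> carrier R" using * J(1) by auto
    ultimately have "s \<otimes> x = s \<otimes> c \<oplus> (s \<otimes> r) \<otimes> a" using assms(2) s by (simp add: r_distr m_assoc)
    then show "s \<otimes> x \<in> ?K" using * J(4) s by blast
  qed
qed

lemma (in cring) ideal_power_simps:
  assumes "ideal \<aa> R"
  shows "ideal (\<aa> [^]\<^bsub>ideals_set R\<^esub> (n :: nat)) R"
    and "\<aa> [^]\<^bsub>ideals_set R\<^esub> (0 :: nat) = carrier R"
    and "\<aa> [^]\<^bsub>ideals_set R\<^esub> (Suc n) = ideal_prod R (\<aa> [^]\<^bsub>ideals_set R\<^esub> n) \<aa>"
    and "\<aa> [^]\<^bsub>ideals_set R\<^esub> (m + n) = ideal_prod R (\<aa> [^]\<^bsub>ideals_set R\<^esub> m) (\<aa> [^]\<^bsub>ideals_set R\<^esub> n)"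
proof -
  interpret I: semiring "ideals_set R" by (rule ideals_set_is_semiring)
  have c: "\<aa> \<in> carrier (ideals_set R)" using assms by (simp add: ideals_set_def)
  show "ideal (\<aa> [^]\<^bsub>ideals_set R\<^esub> n) R" using I.nat_pow_closed[OF c, of n] by (simp add: ideals_set_def)
  show "\<aa> [^]\<^bsub>ideals_set R\<^esub> (0 :: nat) = carrier R" by (simp add: ideals_set_def)
  show "\<aa> [^]\<^bsub>ideals_set R\<^esub> (Suc n) = ideal_prod R (\<aa> [^]\<^bsub>ideals_set R\<^esub> n) \<aa>"
    by (simp add: ideals_set_def)
  show "\<aa> [^]\<^bsub>ideals_set R\<^esub> (m + n) = ideal_prod R (\<aa> [^]\<^bsub>ideals_set R\<^esub> m) (\<aa> [^]\<^bsub>ideals_set R\<^esub> n)"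
    using I.nat_pow_mult[OF c, of m n] by (simp add: ideals_set_def)
qed

lemma (in cring) ideal_prod_subset:
  assumes "ideal J R" "\<And>x y. x \<in> A \<Longrightarrow> y \<in> B \<Longrightarrow> x \<otimes> y \<in> J"
  shows "ideal_prod R A B \<subseteq> J"
proof
  fix s assume "s \<in> ideal_prod R A B"
  then show "s \<in> J" by induction (use assms ideal_closed(3)[OF assms(1)] in auto)
qed

text \<open>
  Noetherian induction: if \<open>J\<close> is a maximal counterexample, pick \<open>a \<in> \<aa> - J\<close>. Then both \<open>J + aR\<close>
  and \<open>J : a\<close> are strictly larger, and their product lies in \<open>J\<close>.
\<close>

lemma ideal_power_subsetI:
  assumes "cring R" "noetherian_ring R" "ideal \<aa> R" "ideal J R"
    and "\<And>a. a \<in> \<aa> \<Longrightarrow> \<exists>n::nat. a [^]\<^bsub>R\<^esub> n \<in> J"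
  shows "\<exists>m::nat. \<aa> [^]\<^bsub>ideals_set R\<^esub> m \<subseteq> J"
proof (rule ccontr)
  interpret R: cring R by fact
  interpret noetherian_ring R by fact
  note \<aa> = R.ideal_closed[OF assms(3)] and pow = R.ideal_power_simps[OF assms(3)]
  let ?\<C> = "{J. ideal J R \<and> (\<forall>a\<in>\<aa>. \<exists>n::nat. a [^]\<^bsub>R\<^esub> n \<in> J) \<and> (\<nexists>m::nat. \<aa> [^]\<^bsub>ideals_set R\<^esub> m \<subseteq> J)}"
  assume "\<nexists>m::nat. \<aa> [^]\<^bsub>ideals_set R\<^esub> m \<subseteq> J"
  then have "?\<C> \<noteq> {}" using assms(4,5) by blast
  then have "\<exists>J\<in>?\<C>. \<forall>K\<in>?\<C>. J \<subseteq> K \<longrightarrow> K = J"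
    by (rule ideal_family_maximal) simp
  then obtain J where J: "J \<in> ?\<C>" "\<forall>K\<in>?\<C>. J \<subseteq> K \<longrightarrow> K = J" by (rule bexE)
  have idJ: "ideal J R" and nil: "\<forall>a\<in>\<aa>. \<exists>n::nat. a [^]\<^bsub>R\<^esub> n \<in> J"
    and nopow: "\<And>m::nat. \<not> \<aa> [^]\<^bsub>ideals_set R\<^esub> m \<subseteq> J" using J(1) by auto
  note Jc = R.ideal_closed[OF idJ]
  have larger: "\<exists>m::nat. \<aa> [^]\<^bsub>ideals_set R\<^esub> m \<subseteq> K" if K: "ideal K R" "J \<subseteq> K" "K \<noteq> J" for K
  proof (rule ccontr)
    assume "\<nexists>m::nat. \<aa> [^]\<^bsub>ideals_set R\<^esub> m \<subseteq> K"
    then have "K \<in> ?\<C>" using K nil by blast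
    then show False using J(2) K by blast
  qed
  have "\<not> \<aa> \<subseteq> J"
  proof
    assume "\<aa> \<subseteq> J"
    then have "\<aa> [^]\<^bsub>ideals_set R\<^esub> (Suc 0) \<subseteq> J"
      unfolding pow(3,2) by (intro R.ideal_prod_subset[OF idJ]) (use Jc(4) in blast)
    then show False using nopow by blast
  qed
  then obtain a where a: "a \<in> \<aa>" "a \<notin> J" by blast
  have ac: "a \<in> carrier R" using a(1) \<aa>(1) by blast
  \<comment> \<open>With the exponent least, the power just below it lies outside J but inside J :
    a, so J : a is strictly larger than J.\<close>
  define k where "k = (LEAST k::nat. a [^]\<^bsub>R\<^esub> k \<in> J)"
  have k: "a [^]\<^bsub>R\<^esub> k \<in> J" unfolding k_def by (rule LeastI_ex) (use nil a(1) in blast)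
  have "k \<noteq> 0"
  proof
    assume "k = 0"
    then have "\<one>\<^bsub>R\<^esub> \<in> J" using k by simp
    then have "carrier R \<subseteq> J" using Jc(4)[of _ "\<one>\<^bsub>R\<^esub>"] by auto
    then show False using nopow[of 0] pow(2) by simp
  qed
  then obtain k' where k': "k = Suc k'" by (cases k) auto
  have u: "a [^]\<^bsub>R\<^esub> k' \<notin> J" using not_less_Least[of k' "\<lambda>k. a [^]\<^bsub>R\<^esub> k \<in> J"] k' unfolding k_def by simp
  let ?K = "{c \<oplus>\<^bsub>R\<^esub> r \<otimes>\<^bsub>R\<^esub> a | c r. c \<in> J \<and> r \<in> carrier R}" and ?L = "{r \<in> carrier R. r \<otimes>\<^bsub>R\<^esub> a \<in> J}"
  obtain m where m: "\<aa> [^]\<^bsub>ideals_set R\<^esub> (m :: nat) \<subseteq> ?K"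
    using larger[OF R.ideal_adjoin(1,2)[OF idJ ac]] R.ideal_adjoin(3)[OF idJ ac] a(2) by blast
  have "J \<subseteq> ?L"
  proof
    fix x assume x: "x \<in> J"
    then have xc: "x \<in> carrier R" using Jc(1) by blast
    then show "x \<in> ?L" using Jc(4)[OF ac x] R.m_comm[OF xc ac] by simp
  qed
  moreover have "a [^]\<^bsub>R\<^esub> k' \<in> ?L" using k ac by (simp add: k')
  ultimately obtain n where n: "\<aa> [^]\<^bsub>ideals_set R\<^esub> (n :: nat) \<subseteq> ?L"
    using larger[OF R.ideal_colon[OF idJ ac]] u by blast
  have "\<aa> [^]\<^bsub>ideals_set R\<^esub> (m + n) \<subseteq> J" unfolding pow(4)
  proof (rule R.ideal_prod_subset[OF idJ])
    fix x y assume "x \<in> \<aa> [^]\<^bsub>ideals_set R\<^esub> m" "y \<in> \<aa> [^]\<^bsub>ideals_set R\<^esub> n"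
    then obtain c r where *: "x = c \<oplus>\<^bsub>R\<^esub> r \<otimes>\<^bsub>R\<^esub> a" "c \<in> J" "r \<in> carrier R" and y: "y \<in> carrier R" "y \<otimes>\<^bsub>R\<^esub> a \<in> J"
      using m n by blast
    have "c \<in> carrier R" using *(2) Jc(1) by blast
    \<comment> \<open>The first summand is a multiple of c in J, the second a multiple of y a, which
      is in J because y lies in J : a.\<close>
    then have "x \<otimes>\<^bsub>R\<^esub> y = y \<otimes>\<^bsub>R\<^esub> c \<oplus>\<^bsub>R\<^esub> r \<otimes>\<^bsub>R\<^esub> (y \<otimes>\<^bsub>R\<^esub> a)"
      using * y(1) ac by (simp add: R.l_distr R.r_distr R.m_ac)
    then show "x \<otimes>\<^bsub>R\<^esub> y \<in> J" using Jc(3,4) * y by simp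
  qed
  then show False using nopow by blast
qed

text \<open>Each element of \<aa> may need its own exponent, unlike in \<open>torsion\<close>.
  Closure properties become statements about single ring elements; \<open>torsion_eq\<close> shows
  that the two notions agree over a Noetherian ring.\<close>

definition torsion_elements :: "('r, 'k) ring_scheme \<Rightarrow> 'r set \<Rightarrow> ('r, 'm) module \<Rightarrow> 'm set"
  where "torsion_elements R \<aa> M = {x \<in> carrier M. \<forall>a\<in>\<aa>. \<exists>n::nat. a [^]\<^bsub>R\<^esub> n \<odot>\<^bsub>M\<^esub> x = \<zero>\<^bsub>M\<^esub>}"

lemma (in module) annihilated_power_mono:
  assumes "a \<in> carrier R" "x \<in> carrier M" "a [^] (m::nat) \<odot>\<^bsub>M\<^esub> x = \<zero>\<^bsub>M\<^esub>"
  shows "a [^] (n + m) \<odot>\<^bsub>M\<^esub> x = \<zero>\<^bsub>M\<^esub>"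
proof -
  have "a [^] (n + m) \<odot>\<^bsub>M\<^esub> x = a [^] n \<odot>\<^bsub>M\<^esub> (a [^] m \<odot>\<^bsub>M\<^esub> x)"
    using assms(1,2) by (simp add: smult_assoc1 flip: R.nat_pow_mult)
  then show ?thesis using assms by simp
qed

context
  fixes R :: "('r, 'k) ring_scheme" and \<aa> :: "'r set"
  assumes cring: "cring R" and noeth: "noetherian_ring R" and ideal: "ideal \<aa> R"
begin

interpretation R: cring R by (rule cring)
interpretation RN: noetherian_ring R by (rule noeth)

text \<open>The annihilator of \<open>x\<close> is an ideal containing a power of every element of
  \<aa>, hence by \<open>ideal_power_subsetI\<close> a power of \<aa> itself.\<close>

lemma torsion_eq:
  assumes M: "module R M"
  shows "torsion R \<aa> M = M\<lparr>carrier := torsion_elements R \<aa> M\<rparr>"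
proof -
  interpret M: module R M by fact
  note \<aa> = R.ideal_closed[OF ideal] and pow = R.ideal_power_simps[OF ideal]
  have elt: "a [^]\<^bsub>R\<^esub> n \<in> \<aa> [^]\<^bsub>ideals_set R\<^esub> n" if a: "a \<in> \<aa>" for a and n :: nat
  proof (induction n)
    case (Suc n)
    show ?case unfolding pow(3) using ideal_prod.prod[OF Suc a, of R] by simp
  qed (simp add: ideals_set_def)
  have "(\<exists>n::nat. \<forall>r\<in>\<aa> [^]\<^bsub>ideals_set R\<^esub> n. r \<odot>\<^bsub>M\<^esub> x = \<zero>\<^bsub>M\<^esub>) \<longleftrightarrow>
      (\<forall>a\<in>\<aa>. \<exists>n::nat. a [^]\<^bsub>R\<^esub> n \<odot>\<^bsub>M\<^esub> x = \<zero>\<^bsub>M\<^esub>)" if x: "x \<in> carrier M" for x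
  proof
    assume "\<exists>n::nat. \<forall>r\<in>\<aa> [^]\<^bsub>ideals_set R\<^esub> n. r \<odot>\<^bsub>M\<^esub> x = \<zero>\<^bsub>M\<^esub>"
    then show "\<forall>a\<in>\<aa>. \<exists>n::nat. a [^]\<^bsub>R\<^esub> n \<odot>\<^bsub>M\<^esub> x = \<zero>\<^bsub>M\<^esub>" using elt by blast
  next
    assume *: "\<forall>a\<in>\<aa>. \<exists>n::nat. a [^]\<^bsub>R\<^esub> n \<odot>\<^bsub>M\<^esub> x = \<zero>\<^bsub>M\<^esub>"
    let ?J = "{r \<in> carrier R. r \<odot>\<^bsub>M\<^esub> x = \<zero>\<^bsub>M\<^esub>}"
    have "ideal ?J R"
      by (rule R.cring_idealI) (use x in \<open>auto simp: M.smult_l_distr M.smult_assoc1\<close>)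
    moreover have "\<exists>n::nat. a [^]\<^bsub>R\<^esub> n \<in> ?J" if "a \<in> \<aa>" for a using * that \<aa>(1) by auto
    ultimately obtain m where "\<aa> [^]\<^bsub>ideals_set R\<^esub> (m::nat) \<subseteq> ?J"
      using ideal_power_subsetI[OF cring noeth ideal, of ?J] by blast
    then show "\<exists>n::nat. \<forall>r\<in>\<aa> [^]\<^bsub>ideals_set R\<^esub> n. r \<odot>\<^bsub>M\<^esub> x = \<zero>\<^bsub>M\<^esub>" by blast
  qed
  then have "{x \<in> carrier M. \<exists>n::nat. \<forall>r\<in>\<aa> [^]\<^bsub>ideals_set R\<^esub> n. r \<odot>\<^bsub>M\<^esub> x = \<zero>\<^bsub>M\<^esub>} = torsion_elements R \<aa> M"
    unfolding torsion_elements_def by blast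
  then show ?thesis unfolding torsion_def by simp
qed

lemma submodule_torsion_elements:
  assumes M: "module R M"
  shows "submodule (torsion_elements R \<aa> M) R M"
proof -
  interpret M: module R M by fact
  note \<aa> = R.ideal_closed(1)[OF ideal]
  show ?thesis
  proof (rule M.submodule_closedI)
    show "\<zero>\<^bsub>M\<^esub> \<in> torsion_elements R \<aa> M" using \<aa> unfolding torsion_elements_def by auto
  next
    fix x y assume xy: "x \<in> torsion_elements R \<aa> M" "y \<in> torsion_elements R \<aa> M"
    then have c: "x \<in> carrier M" "y \<in> carrier M" by (auto simp: torsion_elements_def)
    have "\<exists>n::nat. a [^]\<^bsub>R\<^esub> n \<odot>\<^bsub>M\<^esub> (x \<oplus>\<^bsub>M\<^esub> y) = \<zero>\<^bsub>M\<^esub>" if a: "a \<in> \<aa>" for a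
    proof -
      obtain m n :: nat where mn: "a [^]\<^bsub>R\<^esub> m \<odot>\<^bsub>M\<^esub> x = \<zero>\<^bsub>M\<^esub>" "a [^]\<^bsub>R\<^esub> n \<odot>\<^bsub>M\<^esub> y = \<zero>\<^bsub>M\<^esub>"
        using xy a unfolding torsion_elements_def by blast
      have ac: "a \<in> carrier R" using a \<aa> by blast
      have "a [^]\<^bsub>R\<^esub> (n + m) \<odot>\<^bsub>M\<^esub> (x \<oplus>\<^bsub>M\<^esub> y) = \<zero>\<^bsub>M\<^esub>"
        using M.annihilated_power_mono[OF ac c(1) mn(1), of n] M.annihilated_power_mono[OF ac c(2) mn(2), of m] ac c
        by (simp add: M.smult_r_distr add.commute)
      then show ?thesis by blast
    qed
    then show "x \<oplus>\<^bsub>M\<^esub> y \<in> torsion_elements R \<aa> M" using c by (simp add: torsion_elements_def)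
  next
    fix r x assume r: "r \<in> carrier R" and x: "x \<in> torsion_elements R \<aa> M"
    then have c: "x \<in> carrier M" by (auto simp: torsion_elements_def)
    have "\<exists>n::nat. a [^]\<^bsub>R\<^esub> n \<odot>\<^bsub>M\<^esub> (r \<odot>\<^bsub>M\<^esub> x) = \<zero>\<^bsub>M\<^esub>" if a: "a \<in> \<aa>" for a
    proof -
      obtain m :: nat where m: "a [^]\<^bsub>R\<^esub> m \<odot>\<^bsub>M\<^esub> x = \<zero>\<^bsub>M\<^esub>" using x a unfolding torsion_elements_def by blast
      have ac: "a [^]\<^bsub>R\<^esub> m \<in> carrier R" using a \<aa> by auto
      have "a [^]\<^bsub>R\<^esub> m \<odot>\<^bsub>M\<^esub> (r \<odot>\<^bsub>M\<^esub> x) = r \<odot>\<^bsub>M\<^esub> (a [^]\<^bsub>R\<^esub> m \<odot>\<^bsub>M\<^esub> x)"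
        using ac r c by (simp add: R.m_comm flip: M.smult_assoc1)
      then show ?thesis using m r by auto
    qed
    then show "r \<odot>\<^bsub>M\<^esub> x \<in> torsion_elements R \<aa> M" using c r by (simp add: torsion_elements_def)
  qed (auto simp: torsion_elements_def)
qed

text \<open>One more power of \<open>a\<close> suffices. Consequently M modulo its torsion has no
  nonzero element annihilated by \<aa>.\<close>

lemma torsion_elements_colon:
  assumes M: "module R M" and x: "x \<in> carrier M" "\<And>a. a \<in> \<aa> \<Longrightarrow> a \<odot>\<^bsub>M\<^esub> x \<in> torsion_elements R \<aa> M"
  shows "x \<in> torsion_elements R \<aa> M"
proof -
  interpret M: module R M by fact
  have "\<exists>n::nat. a [^]\<^bsub>R\<^esub> n \<odot>\<^bsub>M\<^esub> x = \<zero>\<^bsub>M\<^esub>" if a: "a \<in> \<aa>" for a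
  proof -
    have ac: "a \<in> carrier R" using a R.ideal_closed(1)[OF ideal] by blast
    obtain n :: nat where "a [^]\<^bsub>R\<^esub> n \<odot>\<^bsub>M\<^esub> (a \<odot>\<^bsub>M\<^esub> x) = \<zero>\<^bsub>M\<^esub>"
      using x(2)[OF a] a unfolding torsion_elements_def by blast
    then have "a [^]\<^bsub>R\<^esub> Suc n \<odot>\<^bsub>M\<^esub> x = \<zero>\<^bsub>M\<^esub>" using ac x(1) by (simp add: M.smult_assoc1)
    then show ?thesis by blast
  qed
  then show ?thesis using x(1) by (simp add: torsion_elements_def)
qed

text \<open>
  This replaces the Artin--Rees lemma. Let \<open>\<rho>\<close> be the graph of a homomorphism from an ideal to the
  torsion, with kernel \<open>L\<close>, and \<open>C\<close> an ideal that is maximal among those meeting the domain of \<open>\<rho>\<close>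
  in \<open>L\<close>. Extending \<open>\<rho>\<close> by zero on \<open>C\<close> makes the extension to \<open>R\<close> factor through \<open>R/C\<close>, and
  maximality of \<open>C\<close> forces every element of \<open>\<aa>\<close> to be nilpotent modulo \<open>C\<close>.
\<close>

lemma baer_module_torsion:
  assumes E: "baer_module R E"
  shows "baer_module R (torsion R \<aa> E)"
proof -
  have mE: "module R E" using E unfolding baer_module_def by blast
  interpret E: module R E by (rule mE)
  let ?T = "torsion_elements R \<aa> E"
  note \<aa> = R.ideal_closed(1)[OF ideal]
  have mT: "module R (E\<lparr>carrier := ?T\<rparr>)"
    by (rule submodule.submodule_is_module[OF submodule_torsion_elements[OF mE] mE])
  have "\<exists>e\<in>?T. \<forall>(r, y)\<in>\<rho>. y = r \<odot>\<^bsub>E\<^esub> e"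
    if \<rho>: "linear_relation R (self_module R) (E\<lparr>carrier := ?T\<rparr>) \<rho>" and single: "\<And>y. (\<zero>\<^bsub>R\<^esub>, y) \<in> \<rho> \<Longrightarrow> y = \<zero>\<^bsub>E\<^esub>" for \<rho>
  proof -
    note D = linear_relationD[OF \<rho>, simplified]
    have DT: "y \<in> carrier E" if "(r, y) \<in> \<rho>" for r y using D(2)[OF that] by (simp add: torsion_elements_def)
    \<comment> \<open>Such an ideal meets the domain of \<rho> exactly in the kernel of \<rho>, so
      \<rho> can be extended by zero on it.\<close>
    define ok where "ok C \<longleftrightarrow> ideal C R \<and> {r. (r, \<zero>\<^bsub>E\<^esub>) \<in> \<rho>} \<subseteq> C \<and> (\<forall>c\<in>C. \<forall>y. (c, y) \<in> \<rho> \<longrightarrow> y = \<zero>\<^bsub>E\<^esub>)" for C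
    have mS: "module R (self_module R)" by (rule self_module_module[OF cring])
    have sv: "y = y'" if "(r, y) \<in> \<rho>" "(r, y') \<in> \<rho>" for r y y'
      by (rule linear_relation_single_valued[OF mS mT \<rho> _ that]) (use single in simp)
    have "ideal {r. (r, \<zero>\<^bsub>E\<^esub>) \<in> \<rho>} R"
    proof (rule R.cring_idealI)
      show "\<zero>\<^bsub>R\<^esub> \<in> {r. (r, \<zero>\<^bsub>E\<^esub>) \<in> \<rho>}" using D(3) by simp
      show "x \<oplus>\<^bsub>R\<^esub> y \<in> {r. (r, \<zero>\<^bsub>E\<^esub>) \<in> \<rho>}" if "x \<in> {r. (r, \<zero>\<^bsub>E\<^esub>) \<in> \<rho>}" "y \<in> {r. (r, \<zero>\<^bsub>E\<^esub>) \<in> \<rho>}" for x y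
        using that D(4)[of x "\<zero>\<^bsub>E\<^esub>" y "\<zero>\<^bsub>E\<^esub>"] by simp
      show "r \<otimes>\<^bsub>R\<^esub> x \<in> {r. (r, \<zero>\<^bsub>E\<^esub>) \<in> \<rho>}" if "r \<in> carrier R" "x \<in> {r. (r, \<zero>\<^bsub>E\<^esub>) \<in> \<rho>}" for r x
        using that D(5)[of r x "\<zero>\<^bsub>E\<^esub>"] by simp
    qed (use D(1) in blast)
    then have "ok {r. (r, \<zero>\<^bsub>E\<^esub>) \<in> \<rho>}" unfolding ok_def using sv by blast
    then have "\<exists>C\<in>Collect ok. \<forall>K\<in>Collect ok. C \<subseteq> K \<longrightarrow> K = C"
      by (intro RN.ideal_family_maximal) (auto simp: ok_def)
    then obtain C where C: "ok C" and max: "\<And>K. ok K \<Longrightarrow> C \<subseteq> K \<Longrightarrow> K = C" by auto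
    have idC: "ideal C R" and LC: "\<And>r. (r, \<zero>\<^bsub>E\<^esub>) \<in> \<rho> \<Longrightarrow> r \<in> C"
      and C0: "\<And>c y. c \<in> C \<Longrightarrow> (c, y) \<in> \<rho> \<Longrightarrow> y = \<zero>\<^bsub>E\<^esub>" using C unfolding ok_def by auto
    note Cc = R.ideal_closed[OF idC]
    have nil: "\<exists>k::nat. a [^]\<^bsub>R\<^esub> k \<in> C" if a: "a \<in> \<aa>" for a
    proof -
      have ac: "a \<in> carrier R" using a \<aa> by blast
      \<comment> \<open>The ascending colon ideals C : a^k. From a maximal one onwards, r a^k lies
        in C as soon as some a^n r a^k does.\<close>
      define Q where "Q k = {r \<in> carrier R. r \<otimes>\<^bsub>R\<^esub> a [^]\<^bsub>R\<^esub> k \<in> C}" for k :: nat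
      have "\<exists>I\<in>range Q. \<forall>K\<in>range Q. I \<subseteq> K \<longrightarrow> K = I"
        by (rule RN.ideal_family_maximal) (use R.ideal_colon[OF idC] ac in \<open>auto simp: Q_def\<close>)
      then obtain k where k: "\<And>n. Q k \<subseteq> Q n \<Longrightarrow> Q n = Q k" by auto
      have stable: "r \<otimes>\<^bsub>R\<^esub> a [^]\<^bsub>R\<^esub> k \<in> C" if r: "r \<in> carrier R" "a [^]\<^bsub>R\<^esub> n \<otimes>\<^bsub>R\<^esub> (r \<otimes>\<^bsub>R\<^esub> a [^]\<^bsub>R\<^esub> k) \<in> C" for r and n :: nat
      proof -
        have e: "s \<otimes>\<^bsub>R\<^esub> a [^]\<^bsub>R\<^esub> (n + k) = a [^]\<^bsub>R\<^esub> n \<otimes>\<^bsub>R\<^esub> (s \<otimes>\<^bsub>R\<^esub> a [^]\<^bsub>R\<^esub> k)" if "s \<in> carrier R" for s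
          using that ac by (simp add: R.m_ac flip: R.nat_pow_mult)
        have "Q k \<subseteq> Q (n + k)" using Cc(4) ac by (auto simp: Q_def e)
        then have "Q (n + k) = Q k" by (rule k)
        moreover have "r \<in> Q (n + k)" using r by (simp add: Q_def e)
        ultimately show ?thesis by (simp add: Q_def)
      qed
      have "a [^]\<^bsub>R\<^esub> k \<in> C"
      proof (rule ccontr)
        assume nk: "a [^]\<^bsub>R\<^esub> k \<notin> C"
        have akc: "a [^]\<^bsub>R\<^esub> k \<in> carrier R" using ac by simp
        let ?K = "{c \<oplus>\<^bsub>R\<^esub> r \<otimes>\<^bsub>R\<^esub> a [^]\<^bsub>R\<^esub> k | c r. c \<in> C \<and> r \<in> carrier R}"
        note adj = R.ideal_adjoin[OF idC akc]
        \<comment> \<open>By maximality of C, the sum of C and R a^k contains an element at which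
          \<rho> is nonzero.\<close>
        have "\<not> ok ?K" using max[OF _ adj(2)] adj(3) nk by blast
        moreover have "{r. (r, \<zero>\<^bsub>E\<^esub>) \<in> \<rho>} \<subseteq> ?K" using LC adj(2) by blast
        ultimately obtain c r y where *: "c \<in> C" "r \<in> carrier R" "(c \<oplus>\<^bsub>R\<^esub> r \<otimes>\<^bsub>R\<^esub> a [^]\<^bsub>R\<^esub> k, y) \<in> \<rho>" "y \<noteq> \<zero>\<^bsub>E\<^esub>"
          using adj(1) unfolding ok_def by blast
        \<comment> \<open>The values of \<rho> are torsion, so a^n moves c + r a^k into the kernel
          of \<rho> and hence into C. Subtracting a^n c leaves a^n r a^k in C; by the choice of k
          already r a^k lies in C, where \<rho> must vanish.\<close>
        obtain n :: nat where n: "a [^]\<^bsub>R\<^esub> n \<odot>\<^bsub>E\<^esub> y = \<zero>\<^bsub>E\<^esub>"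
          using D(2)[OF *(3)] a unfolding torsion_elements_def by blast
        have anc: "a [^]\<^bsub>R\<^esub> n \<in> carrier R" using ac by simp
        have cc: "c \<in> carrier R" using *(1) Cc(1) by blast
        let ?u = "r \<otimes>\<^bsub>R\<^esub> a [^]\<^bsub>R\<^esub> k"
        have uc: "?u \<in> carrier R" using *(2) akc by simp
        have "a [^]\<^bsub>R\<^esub> n \<otimes>\<^bsub>R\<^esub> (c \<oplus>\<^bsub>R\<^esub> ?u) \<in> C" using D(5)[OF anc *(3)] n LC by simp
        moreover have "(\<ominus>\<^bsub>R\<^esub> (a [^]\<^bsub>R\<^esub> n)) \<otimes>\<^bsub>R\<^esub> c \<in> C" using Cc(4) anc *(1) by simp
        ultimately have "a [^]\<^bsub>R\<^esub> n \<otimes>\<^bsub>R\<^esub> (c \<oplus>\<^bsub>R\<^esub> ?u) \<oplus>\<^bsub>R\<^esub> (\<ominus>\<^bsub>R\<^esub> (a [^]\<^bsub>R\<^esub> n)) \<otimes>\<^bsub>R\<^esub> c \<in> C" by (rule Cc(3))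
        also have "a [^]\<^bsub>R\<^esub> n \<otimes>\<^bsub>R\<^esub> (c \<oplus>\<^bsub>R\<^esub> ?u) \<oplus>\<^bsub>R\<^esub> (\<ominus>\<^bsub>R\<^esub> (a [^]\<^bsub>R\<^esub> n)) \<otimes>\<^bsub>R\<^esub> c = a [^]\<^bsub>R\<^esub> n \<otimes>\<^bsub>R\<^esub> ?u"
          using anc cc uc by algebra
        finally have "?u \<in> C" using stable[OF *(2)] by blast
        then have "c \<oplus>\<^bsub>R\<^esub> ?u \<in> C" using Cc(3) *(1) by blast
        then show False using C0 *(3,4) by blast
      qed
      then show ?thesis by blast
    qed
    \<comment> \<open>The sum of \<rho> and the zero map on C; the two agree on the overlap, which
      is the kernel of \<rho>.\<close>
    define \<sigma> where "\<sigma> = {(r \<oplus>\<^bsub>R\<^esub> c, y) | r c y. (r, y) \<in> \<rho> \<and> c \<in> C}"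
    have \<sigma>I: "(r \<oplus>\<^bsub>R\<^esub> c, y) \<in> \<sigma>" if "(r, y) \<in> \<rho>" "c \<in> C" for r c y using that unfolding \<sigma>_def by blast
    have "linear_relation R (self_module R) E \<sigma>"
    proof (rule linear_relationI)
      show "x \<in> carrier (self_module R) \<and> y \<in> carrier E" if "(x, y) \<in> \<sigma>" for x y
        using that D(1) DT Cc(1) unfolding \<sigma>_def by auto
      show "(\<zero>\<^bsub>self_module R\<^esub>, \<zero>\<^bsub>E\<^esub>) \<in> \<sigma>" using \<sigma>I[OF D(3) Cc(2)] by simp
    next
      fix x y x' y' assume "(x, y) \<in> \<sigma>" "(x', y') \<in> \<sigma>"
      then obtain r c r' c' where *: "x = r \<oplus>\<^bsub>R\<^esub> c" "x' = r' \<oplus>\<^bsub>R\<^esub> c'" "(r, y) \<in> \<rho>" "(r', y') \<in> \<rho>" "c \<in> C" "c' \<in> C"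
        unfolding \<sigma>_def by blast
      have "x \<oplus>\<^bsub>R\<^esub> x' = (r \<oplus>\<^bsub>R\<^esub> r') \<oplus>\<^bsub>R\<^esub> (c \<oplus>\<^bsub>R\<^esub> c')"
        using D(1)[OF *(3)] D(1)[OF *(4)] *(5,6) Cc(1) unfolding *(1,2) by (simp add: R.a_ac subset_iff)
      then show "(x \<oplus>\<^bsub>self_module R\<^esub> x', y \<oplus>\<^bsub>E\<^esub> y') \<in> \<sigma>"
        using \<sigma>I[OF D(4)[OF *(3,4)] Cc(3)[OF *(5,6)]] by simp
    next
      fix s x y assume s: "s \<in> carrier R" and "(x, y) \<in> \<sigma>"
      then obtain r c where *: "x = r \<oplus>\<^bsub>R\<^esub> c" "(r, y) \<in> \<rho>" "c \<in> C" unfolding \<sigma>_def by blast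
      have "s \<otimes>\<^bsub>R\<^esub> x = s \<otimes>\<^bsub>R\<^esub> r \<oplus>\<^bsub>R\<^esub> s \<otimes>\<^bsub>R\<^esub> c" using D(1)[OF *(2)] *(1,3) Cc(1) s by (simp add: R.r_distr subset_iff)
      then show "(s \<odot>\<^bsub>self_module R\<^esub> x, s \<odot>\<^bsub>E\<^esub> y) \<in> \<sigma>"
        using \<sigma>I[OF D(5)[OF s *(2)] Cc(4)[OF s *(3)]] by simp
    qed
    moreover have "y = \<zero>\<^bsub>E\<^esub>" if "(\<zero>\<^bsub>R\<^esub>, y) \<in> \<sigma>" for y
    proof -
      obtain r c where *: "\<zero>\<^bsub>R\<^esub> = r \<oplus>\<^bsub>R\<^esub> c" "(r, y) \<in> \<rho>" "c \<in> C" using \<open>(\<zero>\<^bsub>R\<^esub>, y) \<in> \<sigma>\<close> unfolding \<sigma>_def by blast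
      have c: "c \<in> carrier R" "r \<in> carrier R" using *(2,3) Cc(1) D(1) by auto
      have "r = (\<ominus>\<^bsub>R\<^esub> \<one>\<^bsub>R\<^esub>) \<otimes>\<^bsub>R\<^esub> c" using R.minus_equality[OF *(1)[symmetric] c] R.l_minus[of "\<one>\<^bsub>R\<^esub>" c] c by simp
      then have "r \<in> C" using Cc(4)[of "\<ominus>\<^bsub>R\<^esub> \<one>\<^bsub>R\<^esub>" c] *(3) by simp
      then show ?thesis using C0 *(2) by blast
    qed
    ultimately obtain e where e: "e \<in> carrier E" "\<forall>(r, y)\<in>\<sigma>. y = r \<odot>\<^bsub>E\<^esub> e"
      using baer_moduleD[OF E, of \<sigma>] by blast
    \<comment> \<open>Since C kills \<open>e\<close> and contains a power of each element of \<aa>,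
      the extending element \<open>e\<close> is itself torsion.\<close>
    have "c \<odot>\<^bsub>E\<^esub> e = \<zero>\<^bsub>E\<^esub>" if "c \<in> C" for c
      using e(2) \<sigma>I[OF D(3) that] that Cc(1) by fastforce
    then have "e \<in> ?T" unfolding torsion_elements_def using e(1) nil by blast
    moreover have "y = r \<odot>\<^bsub>E\<^esub> e" if "(r, y) \<in> \<rho>" for r y
      using e(2) \<sigma>I[OF that Cc(2)] D(1)[OF that] by fastforce
    ultimately show ?thesis by blast
  qed
  then show ?thesis unfolding torsion_eq[OF mE] baer_module_def using mT by simp
qed

end

section \<open>The exact sequences\<close>

lemma submodule_zero:
  assumes "module R M" shows "submodule {\<zero>\<^bsub>M\<^esub>} R M"
proof -
  interpret M: module R M by fact
  show ?thesis by (rule M.submodule_closedI) auto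
qed

text \<open>Zero modules occur as B^0 and as the right end of \<open>short_exact_iso\<close>.
  Regarded as injective, they get their positive Ext from \<open>baer_module_Ext_fg\<close>.\<close>

lemma baer_module_zero:
  assumes "module R M" shows "baer_module R (M\<lparr>carrier := {\<zero>\<^bsub>M\<^esub>}\<rparr>)"
proof -
  interpret M: module R M by fact
  have "\<forall>(r, y)\<in>\<rho>. y = r \<odot>\<^bsub>M\<^esub> \<zero>\<^bsub>M\<^esub>"
    if \<rho>: "linear_relation R (self_module R) (M\<lparr>carrier := {\<zero>\<^bsub>M\<^esub>}\<rparr>) \<rho>" for \<rho>
  proof clarify
    fix r y assume "(r, y) \<in> \<rho>"
    then show "y = r \<odot>\<^bsub>M\<^esub> \<zero>\<^bsub>M\<^esub>"
      using linear_relationD(1,2)[OF \<rho>, of r y] M.smult_r_null[of r] by simp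
  qed
  then show ?thesis
    using submodule.submodule_is_module[OF submodule_zero[OF assms] assms] unfolding baer_module_def by simp blast
qed

lemma short_exact_quotient:
  assumes M: "module R M" and S: "submodule S R M"
  shows "short_exact R (M\<lparr>carrier := S\<rparr>) (\<lambda>x. x) M (\<lambda>x. S +>\<^bsub>M\<^esub> x) (quotient_module M S)"
proof -
  interpret M: module R M by fact
  note q = quotient_module_facts[OF M S]
  have "a_kernel M (quotient_module M S) (\<lambda>x. S +>\<^bsub>M\<^esub> x) = S"
    using q(4) M.submoduleD(1)[OF S] by (auto simp: a_kernel_iff)
  moreover have "(\<lambda>x. x) \<in> mod_hom R (M\<lparr>carrier := S\<rparr>) M"
    by (rule mod_homI) (use M.submoduleD(1)[OF S] in auto)
  ultimately show ?thesis
    unfolding short_exact_def using q submodule.submodule_is_module[OF S M] M by simp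
qed

lemma short_exact_kernel:
  assumes M: "module R M" and M': "module R M'" and f: "f \<in> mod_hom R M M'"
  shows "short_exact R (M\<lparr>carrier := a_kernel M M' f\<rparr>) (\<lambda>x. x) M f (M'\<lparr>carrier := f ` carrier M\<rparr>)"
proof -
  let ?I = "M'\<lparr>carrier := f ` carrier M\<rparr>"
  have "(\<lambda>x. x) \<in> mod_hom R (M\<lparr>carrier := a_kernel M M' f\<rparr>) M"
    by (rule mod_homI) (auto simp: a_kernel_iff)
  moreover have "f \<in> mod_hom R M ?I" by (rule mod_homI) (use mod_homD[OF f] in auto)
  moreover have "a_kernel M ?I f = a_kernel M M' f" by (auto simp: a_kernel_iff)
  ultimately show ?thesis
    unfolding short_exact_def
    using submodule.submodule_is_module[OF kernel_submodule[OF M M' f] M]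
      submodule.submodule_is_module[OF submodule_image[OF M M' f] M'] M by simp
qed

text \<open>An isomorphism written as a short exact sequence ending in zero, so that
  \<open>Ext_fg_middle\<close> also transports finite generation between isomorphic modules of
  different types.\<close>

lemma short_exact_iso:
  assumes M: "module R M" and K: "module R K" and f: "f \<in> mod_hom R M K" "inj_on f (carrier M)" "f ` carrier M = carrier K"
  shows "short_exact R M f K (\<lambda>x. \<zero>\<^bsub>K\<^esub>) (K\<lparr>carrier := {\<zero>\<^bsub>K\<^esub>}\<rparr>)"
proof -
  interpret K: module R K by fact
  let ?O = "K\<lparr>carrier := {\<zero>\<^bsub>K\<^esub>}\<rparr>"
  have O: "module R ?O" by (rule submodule.submodule_is_module[OF submodule_zero[OF K] K])
  have "(\<lambda>x. \<zero>\<^bsub>K\<^esub>) \<in> mod_hom R K ?O" using mod_hom_const_zero[OF O, of K] by simp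
  moreover have "(\<lambda>x. \<zero>\<^bsub>K\<^esub>) ` carrier K = {\<zero>\<^bsub>K\<^esub>}" using K.M.zero_closed by blast
  moreover have "a_kernel K ?O (\<lambda>x. \<zero>\<^bsub>K\<^esub>) = carrier K" by (auto simp: a_kernel_iff)
  ultimately show ?thesis unfolding short_exact_def using M K f O by simp
qed

text \<open>A cocycle of degree 0 represents a homomorphism from R/\<aa>. The augmentation kills a x
  because \<aa> annihilates R/\<aa>; exactness then makes a x a boundary, on which \<open>z\<close>
  vanishes.\<close>

lemma hom_quotient_annihilated:
  fixes R :: "('r, 'k) ring_scheme" and X :: "('r, 'x) module"
  assumes R: "cring R" and \<aa>: "ideal \<aa> R" and X: "module R X"
  defines "N \<equiv> quotient_module (self_module R) \<aa>"
  assumes z: "z \<in> mod_hom R (free_module R) X"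
    and zero: "\<And>y. y \<in> carrier (free_module R) \<Longrightarrow> z (res_diff R N 0 y) = \<zero>\<^bsub>X\<^esub>"
    and x: "x \<in> carrier (free_module R)" and a: "a \<in> \<aa>"
  shows "a \<odot>\<^bsub>X\<^esub> z x = \<zero>\<^bsub>X\<^esub>"
proof -
  interpret R: cring R by (rule R)
  have mS: "module R (self_module R)" by (rule self_module_module[OF R])
  interpret S: module R "self_module R" by (rule mS)
  note \<aa>c = R.ideal_closed[OF \<aa>]
  have sub: "submodule \<aa> R (self_module R)" by (rule S.submodule_closedI) (use \<aa>c in auto)
  note q = quotient_module_facts[OF mS sub, folded N_def]
  let ?F = "free_module R :: ('r, ('r, 'r set) res_basis \<Rightarrow> 'r) module"
  interpret F: module R ?F by (rule free_module_module[OF R])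
  have ac: "a \<in> carrier R" using a \<aa>c(1) by blast
  note aug = free_resolution(1)[OF q(1)]
  obtain r where r: "r \<in> carrier R" "augmentation R N x = \<aa> +>\<^bsub>self_module R\<^esub> r"
    using mod_homD(1)[OF aug x] q(3) by auto
  have "augmentation R N (a \<odot>\<^bsub>?F\<^esub> x) = a \<odot>\<^bsub>N\<^esub> (\<aa> +>\<^bsub>self_module R\<^esub> r)"
    using mod_homD(3)[OF aug ac x] r(2) by simp
  also have "\<dots> = \<aa> +>\<^bsub>self_module R\<^esub> (a \<otimes>\<^bsub>R\<^esub> r)" using mod_homD(3)[OF q(2) ac] r(1) by simp
  also have "\<dots> = \<zero>\<^bsub>N\<^esub>"
  proof -
    have "a \<otimes>\<^bsub>R\<^esub> r \<in> \<aa>" using \<aa>c(4)[OF r(1) a] R.m_comm[OF ac r(1)] by simp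
    then show ?thesis using q(4)[of "a \<otimes>\<^bsub>R\<^esub> r"] ac r(1) by simp
  qed
  finally have "a \<odot>\<^bsub>?F\<^esub> x \<in> a_kernel ?F N (augmentation R N)"
    using F.smult_closed[OF ac x] by (simp add: a_kernel_iff)
  then obtain y where "y \<in> carrier ?F" "a \<odot>\<^bsub>?F\<^esub> x = res_diff R N 0 y"
    unfolding free_resolution(4)[OF q(1), symmetric] by blast
  then have "z (a \<odot>\<^bsub>?F\<^esub> x) = \<zero>\<^bsub>X\<^esub>" using zero by metis
  then show ?thesis using mod_homD(3)[OF z ac x] by simp
qed

section \<open>The complex of torsion submodules\<close>

locale torsion_complex =
  fixes R :: "('r, 'k) ring_scheme" and \<aa> :: "'r set" and M :: "('r, 'm) module"
    and I :: "nat \<Rightarrow> ('r, 'e) module" and \<epsilon> :: "'m \<Rightarrow> 'e" and d :: "nat \<Rightarrow> 'e \<Rightarrow> 'e"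
  assumes cring: "cring R" and noeth: "noetherian_ring R" and ideal: "ideal \<aa> R"
    and M: "module R M" and res: "injective_resolution R M I \<epsilon> d"
begin

abbreviation "N \<equiv> quotient_module (self_module R) \<aa>"
abbreviation "J n \<equiv> torsion R \<aa> (I n)"

definition boundaries :: "nat \<Rightarrow> 'e set"
  where "boundaries n = (case n of 0 \<Rightarrow> {\<zero>\<^bsub>J 0\<^esub>} | Suc k \<Rightarrow> d k ` carrier (J k))"

abbreviation "B n \<equiv> (J n)\<lparr>carrier := boundaries n\<rparr>"
abbreviation "Z n \<equiv> (J n)\<lparr>carrier := a_kernel (J n) (J (Suc n)) (d n)\<rparr>"
abbreviation "K n \<equiv> (I n)\<lparr>carrier := a_kernel (I n) (I (Suc n)) (d n)\<rparr>"
abbreviation "H n \<equiv> cohomology J d n"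

lemma d_hom: "d n \<in> mod_hom R (I n) (I (Suc n))"
  using res by (simp add: injective_resolution_def)

lemma d_image: "d n ` carrier (I n) = a_kernel (I (Suc n)) (I (Suc (Suc n))) (d (Suc n))"
  using res by (simp add: injective_resolution_def)

lemma baer_I: "baer_module R (I n)"
  using res by (intro injective_imp_baer_module) (simp add: injective_resolution_def)

lemma module_I: "module R (I n)"
  using baer_I unfolding baer_module_def by blast

lemma baer_J: "baer_module R (J n)"
  by (rule baer_module_torsion[OF cring noeth ideal baer_I])

lemma module_J: "module R (J n)"
  using baer_J unfolding baer_module_def by blast

lemma J_eq: "J n = (I n)\<lparr>carrier := torsion_elements R \<aa> (I n)\<rparr>"
  by (rule torsion_eq[OF cring noeth ideal module_I])

lemma J_simps [simp]:
  "carrier (J n) = torsion_elements R \<aa> (I n)" "\<zero>\<^bsub>J n\<^esub> = \<zero>\<^bsub>I n\<^esub>"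
  "x \<oplus>\<^bsub>J n\<^esub> y = x \<oplus>\<^bsub>I n\<^esub> y" "r \<odot>\<^bsub>J n\<^esub> x = r \<odot>\<^bsub>I n\<^esub> x"
  by (simp_all add: J_eq)

lemma d_hom_J: "d n \<in> mod_hom R (J n) (J (Suc n))"
proof (rule mod_homI)
  note D = mod_homD[OF d_hom[of n]]
  interpret R: cring R by (rule cring)
  show "d n x \<in> carrier (J (Suc n))" if x: "x \<in> carrier (J n)" for x
  proof -
    have xc: "x \<in> carrier (I n)" using x by (simp add: torsion_elements_def)
    have "\<exists>k::nat. a [^]\<^bsub>R\<^esub> k \<odot>\<^bsub>I (Suc n)\<^esub> d n x = \<zero>\<^bsub>I (Suc n)\<^esub>" if a: "a \<in> \<aa>" for a
    proof -
      obtain k :: nat where "a [^]\<^bsub>R\<^esub> k \<odot>\<^bsub>I n\<^esub> x = \<zero>\<^bsub>I n\<^esub>" using x a by (auto simp: torsion_elements_def)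
      moreover have "a [^]\<^bsub>R\<^esub> k \<in> carrier R" using a R.ideal_closed(1)[OF ideal] by auto
      ultimately show ?thesis using D(3)[OF _ xc] mod_hom_zero[OF module_I module_I d_hom] by metis
    qed
    then show ?thesis using D(1)[OF xc] by (simp add: torsion_elements_def)
  qed
qed (use mod_homD[OF d_hom[of n]] in \<open>auto simp: torsion_elements_def\<close>)

lemma d_d: "x \<in> carrier (I n) \<Longrightarrow> d (Suc n) (d n x) = \<zero>\<^bsub>I (Suc (Suc n))\<^esub>"
  using d_image[of n] by (metis a_kernel_iff image_eqI)

lemma module_N: "module R N"
proof -
  interpret R: cring R by (rule cring)
  have mS: "module R (self_module R)" by (rule self_module_module[OF cring])
  interpret S: module R "self_module R" by (rule mS)
  have "submodule \<aa> R (self_module R)"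
    by (rule S.submodule_closedI) (use R.ideal_closed[OF ideal] in auto)
  then show ?thesis by (rule quotient_module_facts(1)[OF mS])
qed

lemma module_Z: "module R (Z n)"
  by (rule submodule.submodule_is_module[OF kernel_submodule[OF module_J module_J d_hom_J] module_J])

lemma module_K: "module R (K n)"
  by (rule submodule.submodule_is_module[OF kernel_submodule[OF module_I module_I d_hom] module_I])

lemma submodule_boundaries: "submodule (boundaries n) R (Z n)"
proof (cases n)
  case 0
  then show ?thesis using submodule_zero[OF module_Z, of 0] by (simp add: boundaries_def)
next
  case (Suc k)
  have "d k \<in> mod_hom R (J k) (Z (Suc k))"
    by (rule mod_homI)
      (use mod_homD[OF d_hom_J[of k]] d_d in \<open>auto simp: a_kernel_iff torsion_elements_def\<close>)
  from submodule_image[OF module_J module_Z this] show ?thesis by (simp add: Suc boundaries_def)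
qed

section \<open>The short exact sequences attached to the complex\<close>

lemma short_exact_Z_J_B: "short_exact R (Z n) (\<lambda>x. x) (J n) (d n) (B (Suc n))"
  using short_exact_kernel[OF module_J module_J d_hom_J, of n] by (simp add: boundaries_def)

lemma short_exact_B_Z_H: "\<exists>p. short_exact R (B n) (\<lambda>x. x) (Z n) p (H n)"
  using short_exact_quotient[OF module_Z submodule_boundaries, of n]
  unfolding cohomology_def boundaries_def by auto

lemma short_exact_K_I_K: "short_exact R (K n) (\<lambda>x. x) (I n) (d n) (K (Suc n))"
  using short_exact_kernel[OF module_I module_I d_hom, of n] by (simp add: d_image)

text \<open>Being torsion depends on the element and not on the ambient submodule, so taking torsion
  commutes with taking kernels.\<close>

lemma torsion_K: "(K n)\<lparr>carrier := torsion_elements R \<aa> (K n)\<rparr> = Z n"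
proof -
  have "torsion_elements R \<aa> (K n) = a_kernel (J n) (J (Suc n)) (d n)"
    by (auto simp: torsion_elements_def a_kernel_iff)
  then show ?thesis by (simp add: J_eq)
qed

text \<open>The index starts at degree 1 because Ext in positive degree vanishes on J^n, whereas in
  degree 0 it need not be finitely generated. The degree \<open>j\<close> is arbitrary in the
  induction since each step calls on the next higher degree.\<close>

lemma Ext_B_fg:
  assumes "\<And>i j. i < n \<Longrightarrow> fg_module R (Ext R j N (H i))"
  shows "fg_module R (Ext R (Suc j) N (B n))"
  using assms
proof (induction n arbitrary: j)
  case 0
  have "B 0 = (J 0)\<lparr>carrier := {\<zero>\<^bsub>J 0\<^esub>}\<rparr>" by (simp add: boundaries_def)
  then show ?case using baer_module_Ext_fg[OF baer_module_zero[OF module_J] module_N] by simp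
next
  case (Suc n)
  obtain p where p: "short_exact R (B n) (\<lambda>x. x) (Z n) p (H n)" using short_exact_B_Z_H by blast
  \<comment> \<open>One degree higher than the goal, to be consumed by the connecting map from
    B^(n+1) to Z^n.\<close>
  have "fg_module R (Ext R (Suc (Suc j)) N (Z n))"
    by (rule Ext_fg_middle[OF module_N noeth p Suc.IH]) (use Suc.prems in auto)
  then show ?case
    by (rule Ext_fg_right[OF module_N noeth short_exact_Z_J_B baer_module_Ext_fg[OF baer_J module_N]])
qed

text \<open>Dimension shifting: the positive Ext of I^n vanishes, so moving from K^n to K^(n+1)
  lowers the degree by one and leaves the sum n + j unchanged. At the start \<epsilon> identifies M
  with K^0.\<close>

lemma Ext_K_fg:
  assumes "fg_module R (Ext R (Suc (n + j)) N M)"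
  shows "fg_module R (Ext R (Suc j) N (K n))"
  using assms
proof (induction n arbitrary: j)
  case 0
  have \<epsilon>: "\<epsilon> \<in> mod_hom R M (I 0)" "inj_on \<epsilon> (carrier M)" "\<epsilon> ` carrier M = carrier (K 0)"
    using res by (simp_all add: injective_resolution_def)
  have "\<epsilon> \<in> mod_hom R M (K 0)" by (rule mod_homI) (use mod_homD[OF \<epsilon>(1)] \<epsilon>(3) in auto)
  from Ext_fg_middle[OF module_N noeth short_exact_iso[OF M module_K this \<epsilon>(2,3)] _
      baer_module_Ext_fg[OF baer_module_zero[OF module_K] module_N]]
  show ?case using 0 by simp
next
  case (Suc n)
  show ?case
    by (rule Ext_fg_right[OF module_N noeth short_exact_K_I_K baer_module_Ext_fg[OF baer_I module_N] Suc.IH])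
       (use Suc.prems in simp)
qed

text \<open>\<open>K n / Z n\<close> is torsion-free, so that \<open>Hom(R/\<aa>, K n / Z n) = 0\<close>.\<close>

lemma Ext_1_Z_fg:
  assumes "fg_module R (Ext R 1 N (K n))"
  shows "fg_module R (Ext R 1 N (Z n))"
proof -
  let ?T = "torsion_elements R \<aa> (K n)"
  have T: "submodule ?T R (K n)" by (rule submodule_torsion_elements[OF cring noeth ideal module_K])
  note q = quotient_module_facts[OF module_K T]
  interpret R: cring R by (rule cring)
  show ?thesis
  proof (rule Ext_1_fg_left[OF module_N noeth short_exact_quotient[OF module_K T, unfolded torsion_K] _ assms])
    fix c and x :: "('r, 'r set) res_basis \<Rightarrow> 'r" assume c: "c \<in> mod_hom R (free_module R) (quotient_module (K n) ?T)"
      "\<And>y. y \<in> carrier (free_module R) \<Longrightarrow> c (res_diff R N 0 y) = \<zero>\<^bsub>quotient_module (K n) ?T\<^esub>"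
      and x: "x \<in> carrier (free_module R)"
    obtain k where k: "k \<in> carrier (K n)" "c x = ?T +>\<^bsub>K n\<^esub> k" using mod_homD(1)[OF c(1) x] q(3) by auto
    interpret K: module R "K n" by (rule module_K)
    \<comment> \<open>The value \<open>c x\<close> is killed by \<aa>; read on its representative
      \<open>k\<close>, this says that every a k is torsion.\<close>
    have "a \<odot>\<^bsub>K n\<^esub> k \<in> ?T" if a: "a \<in> \<aa>" for a
    proof -
      have ac: "a \<in> carrier R" using a R.ideal_closed(1)[OF ideal] by blast
      have "?T +>\<^bsub>K n\<^esub> (a \<odot>\<^bsub>K n\<^esub> k) = a \<odot>\<^bsub>quotient_module (K n) ?T\<^esub> c x"
        using mod_homD(3)[OF q(2) ac k(1)] k(2) by simp
      also have "\<dots> = \<zero>\<^bsub>quotient_module (K n) ?T\<^esub>"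
        by (rule hom_quotient_annihilated[OF cring ideal q(1) c x a])
      finally show ?thesis using q(4)[OF K.smult_closed[OF ac k(1)]] by blast
    qed
    then have "k \<in> ?T" by (rule torsion_elements_colon[OF cring noeth ideal module_K k(1)])
    then show "c x = \<zero>\<^bsub>quotient_module (K n) ?T\<^esub>" using q(4)[OF k(1)] k(2) by blast
  qed
qed

text \<open>The connecting map from degree 1 lands in degree 2 on B^n, which is
  \<open>Ext_B_fg\<close> at j = 1. The left neighbour Ext^1 on Z^n comes from K^n with no degree
  left to shift, which is \<open>Ext_K_fg\<close> at j = 0.\<close>

lemma Ext_1_H_fg:
  assumes "fg_module R (Ext R (Suc n) N M)" "\<And>i j. i < n \<Longrightarrow> fg_module R (Ext R j N (H i))"
  shows "fg_module R (Ext R 1 N (H n))"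
proof -
  obtain p where p: "short_exact R (B n) (\<lambda>x. x) (Z n) p (H n)" using short_exact_B_Z_H by blast
  have "fg_module R (Ext R 1 N (Z n))" using Ext_1_Z_fg[of n] Ext_K_fg[of n 0] assms(1) by simp
  then show ?thesis by (rule Ext_fg_right[OF module_N noeth p _ Ext_B_fg[OF assms(2)]])
qed

end

theorem theoremA:
  fixes R :: "('r, 'k) ring_scheme"
    and \<aa> :: "'r set"
    and M :: "('r, 'm) module"
    and t :: nat
  assumes "cring R"
    and "noetherian_ring R"
    and "ideal \<aa> R"
    and "module R M"
    and "fg_module R (Ext R (t + 1) (quotient_module (self_module R) \<aa>) M)"
    and "\<And>i. i < t \<Longrightarrow> cofinite_module R \<aa> (local_cohomology R \<aa> i M)"
  shows "fg_module R (Ext R 1 (quotient_module (self_module R) \<aa>) (local_cohomology R \<aa> t M))"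
proof -
  obtain I d where Id: "chosen_injective_resolution R M = (I, d)" by fastforce
  obtain \<epsilon> where "injective_resolution R M I \<epsilon> d" using chosen_injective_resolution[OF assms(4) Id] by blast
  then interpret torsion_complex R \<aa> M I \<epsilon> d using assms(1-4) by (intro torsion_complex.intro)
  \<comment> \<open>The locale is instantiated with the very resolution that
    \<open>local_cohomology\<close> chooses, so the identification holds by unfolding.\<close>
  have lc: "local_cohomology R \<aa> i M = H i" for i by (simp add: local_cohomology_def Id)
  show ?thesis
    unfolding lc using assms(5,6) by (intro Ext_1_H_fg) (simp_all add: lc cofinite_module_def)
qed

end
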